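(* Let $n\geq1$ and let $(\mathrm{P}_{t})_{t\geq0}$ be the Poisson semigroup on $L^\infty(\mathbb{T}^n)$. Let $\omega_{n+1}=\frac{2\pi^{(n+1)/2}}{\Gamma((n+1)/2)}$ and let $\nu$ be the probability measure on $\mathbb{R}^n$ with density $y\mapsto\frac{2}{\omega_{n+1}(1+|y|^2)^{\frac{n+1}{2}}}$ with respect to Lebesgue measure. Put $N=L^\infty(\mathbb{T}^n)\overline{\otimes}L^\infty(\mathbb{R}^n,\nu)$, and define - $J\colon L^\infty(\mathbb{T}^n)\to N$, $J(f)=f\otimes1$; - $\mathbb{E}\colon N\to L^\infty(\mathbb{T}^n)$, the trace preserving normal faithful conditional expectation $f\otimes g\mapsto\left(\int_{\mathbb{R}^n}g\,d\nu\right)f$ associated with $J$; - $U_t\colon N\to N$, $[U_t(g)](x,y)=g(x-ty,y)$, for $t\in\mathbb{R}$. Then $J$ is a trace preserving unital normal $*$-monomorphism, $(U_t)_{t\in\mathbb{R}}$ is a weak* continuous group of trace preserving $*$-automorphisms of $N$, and $$\mathrm{P}_{t}=\mathbb{E}U_tJ,\qquad t\geq0.$$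
   Context: $L^\infty(\mathbb{T}^n)$ is identified with the space of (classes of) essentially bounded measurable functions on $\mathbb{R}^n$ that are $1$-periodic in each of the $n$ canonical directions. The Poisson semigroup on $L^\infty(\mathbb{T}^n)$ is given by $\mathrm{P}_0=\mathrm{Id}$ and, for $t>0$, $[\mathrm{P}_t(f)](x)=\int_{[0,1]^n}p_t(y)f(x-y)\,dy$ with $p_t(y)=\sum_{m\in\mathbb{Z}^n}e^{-2\pi t|m|}e_m(y)$, where $e_m(y)=e^{2i\pi m_1y_1}\cdots e^{2i\pi m_ny_n}$ and $|\cdot|$ is the Euclidean norm. The traces on $L^\infty(\mathbb{T}^n)$ and $N$ are the integrals with respect to Lebesgue measure on $[0,1]^n$ and its product with $\nu$. Weak* continuity of the group means that $t\mapsto\langle h,U_t(g)\rangle_{N_*,N}$ is continuous for all $g\in N$, $h\in N_*$. *)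

theory Defs
  imports "HOL-Probability.Probability_Measure" "HOL-Algebra.Module" "HOL-Algebra.RingHom"
begin

section \<open>Tracial algebras with a predual\<close>

text \<open>
  Only the values on the carrier of \<open>tr\<close> and of the functionals in \<open>predual\<close> matter.
\<close>

record 'b tracial_algebra = "(complex, 'b) module" +
  adj :: "'b \<Rightarrow> 'b"
  tr :: "'b \<Rightarrow> complex"
  predual :: "('b \<Rightarrow> complex) set"

definition weak_star_topology :: "('b, 'm) tracial_algebra_scheme \<Rightarrow> 'b topology" where
  "weak_star_topology A =
     topology_generated_by {{x \<in> carrier A. \<omega> x \<in> V} |\<omega> V. \<omega> \<in> predual A \<and> open V}"

definition positive_elements :: "('b, 'm) tracial_algebra_scheme \<Rightarrow> 'b set" where
  "positive_elements A = {adj A x \<otimes>\<^bsub>A\<^esub> x |x. x \<in> carrier A}"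

definition linear_map ::
  "('b, 'm) tracial_algebra_scheme \<Rightarrow> ('c, 'k) tracial_algebra_scheme \<Rightarrow> ('b \<Rightarrow> 'c) \<Rightarrow> bool" where
  "linear_map A B \<phi> \<longleftrightarrow>
     \<phi> \<in> carrier A \<rightarrow> carrier B \<and>
     (\<forall>x\<in>carrier A. \<forall>y\<in>carrier A. \<phi> (x \<oplus>\<^bsub>A\<^esub> y) = \<phi> x \<oplus>\<^bsub>B\<^esub> \<phi> y) \<and>
     (\<forall>c. \<forall>x\<in>carrier A. \<phi> (c \<odot>\<^bsub>A\<^esub> x) = c \<odot>\<^bsub>B\<^esub> \<phi> x)"

text \<open>The library's \<open>ring_hom\<close> already includes preservation of the unit.\<close>

definition unital_star_hom ::
  "('b, 'm) tracial_algebra_scheme \<Rightarrow> ('c, 'k) tracial_algebra_scheme \<Rightarrow> ('b \<Rightarrow> 'c) \<Rightarrow> bool" where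
  "unital_star_hom A B \<phi> \<longleftrightarrow>
     \<phi> \<in> ring_hom A B \<and> linear_map A B \<phi> \<and> (\<forall>x\<in>carrier A. \<phi> (adj A x) = adj B (\<phi> x))"

definition unital_star_monomorphism ::
  "('b, 'm) tracial_algebra_scheme \<Rightarrow> ('c, 'k) tracial_algebra_scheme \<Rightarrow> ('b \<Rightarrow> 'c) \<Rightarrow> bool" where
  "unital_star_monomorphism A B \<phi> \<longleftrightarrow> unital_star_hom A B \<phi> \<and> inj_on \<phi> (carrier A)"

definition star_automorphism ::
  "('b, 'm) tracial_algebra_scheme \<Rightarrow> ('b \<Rightarrow> 'b) \<Rightarrow> bool" where
  "star_automorphism A \<phi> \<longleftrightarrow> unital_star_hom A A \<phi> \<and> bij_betw \<phi> (carrier A) (carrier A)"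

definition trace_preserving ::
  "('b, 'm) tracial_algebra_scheme \<Rightarrow> ('c, 'k) tracial_algebra_scheme \<Rightarrow> ('b \<Rightarrow> 'c) \<Rightarrow> bool" where
  "trace_preserving A B \<phi> \<longleftrightarrow> (\<forall>x\<in>carrier A. tr B (\<phi> x) = tr A x)"

text \<open>Normality is understood as weak* continuity.\<close>

definition normal_map ::
  "('b, 'm) tracial_algebra_scheme \<Rightarrow> ('c, 'k) tracial_algebra_scheme \<Rightarrow> ('b \<Rightarrow> 'c) \<Rightarrow> bool" where
  "normal_map A B \<phi> \<longleftrightarrow> continuous_map (weak_star_topology A) (weak_star_topology B) \<phi>"

text \<open>
  A conditional expectation associated with an embedding \<open>J\<close> of \<open>A\<close> into \<open>B\<close> takes its values
  in \<open>A\<close>; composing it with \<open>J\<close> gives a conditional expectation onto the image of \<open>J\<close>.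
\<close>

definition conditional_expectation ::
  "('b, 'm) tracial_algebra_scheme \<Rightarrow> ('c, 'k) tracial_algebra_scheme \<Rightarrow>
     ('b \<Rightarrow> 'c) \<Rightarrow> ('c \<Rightarrow> 'b) \<Rightarrow> bool" where
  "conditional_expectation A B J E \<longleftrightarrow>
     linear_map B A E \<and>
     (\<forall>x\<in>positive_elements B. E x \<in> positive_elements A) \<and>
     (\<forall>a\<in>carrier A. E (J a) = a) \<and>
     (\<forall>a\<in>carrier A. \<forall>b\<in>carrier A. \<forall>x\<in>carrier B.
        E (J a \<otimes>\<^bsub>B\<^esub> x \<otimes>\<^bsub>B\<^esub> J b) = a \<otimes>\<^bsub>A\<^esub> E x \<otimes>\<^bsub>A\<^esub> b)"

definition faithful_map ::
  "('b, 'm) tracial_algebra_scheme \<Rightarrow> ('c, 'k) tracial_algebra_scheme \<Rightarrow> ('b \<Rightarrow> 'c) \<Rightarrow> bool" where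
  "faithful_map A B \<phi> \<longleftrightarrow> (\<forall>x\<in>positive_elements A. \<phi> x = \<zero>\<^bsub>B\<^esub> \<longrightarrow> x = \<zero>\<^bsub>A\<^esub>)"

definition weak_star_continuous_group ::
  "('b, 'm) tracial_algebra_scheme \<Rightarrow> (real \<Rightarrow> 'b \<Rightarrow> 'b) \<Rightarrow> bool" where
  "weak_star_continuous_group A U \<longleftrightarrow>
     (\<forall>x\<in>carrier A. U 0 x = x) \<and>
     (\<forall>s t. \<forall>x\<in>carrier A. U (s + t) x = U s (U t x)) \<and>
     (\<forall>\<omega>\<in>predual A. \<forall>x\<in>carrier A. continuous_on UNIV (\<lambda>t. \<omega> (U t x)))"

inductive_set linear_span :: "('b, 'm) tracial_algebra_scheme \<Rightarrow> 'b set \<Rightarrow> 'b set"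
  for A :: "('b, 'm) tracial_algebra_scheme" and S :: "'b set" where
  zero: "\<zero>\<^bsub>A\<^esub> \<in> linear_span A S"
| add: "s \<in> S \<Longrightarrow> v \<in> linear_span A S \<Longrightarrow> (c \<odot>\<^bsub>A\<^esub> s) \<oplus>\<^bsub>A\<^esub> v \<in> linear_span A S"


section \<open>Algebras of essentially bounded functions\<close>

text \<open>
  \<open>dom X\<close> is a fundamental domain for the symmetry (periodicity) expressed by \<open>invariant X\<close>:
  functions live on the whole space, integrals are taken over \<open>dom X\<close>.
\<close>

record 'a function_domain =
  meas :: "'a measure"
  dom :: "'a set"
  invariant :: "('a \<Rightarrow> complex) set"

definition bounded_functions :: "'a function_domain \<Rightarrow> ('a \<Rightarrow> complex) set" where
  "bounded_functions X =
     {f \<in> borel_measurable (meas X). f \<in> invariant X \<and> (\<exists>C. AE x in meas X. norm (f x) \<le> C)}"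

definition ae_rel :: "'a function_domain \<Rightarrow> (('a \<Rightarrow> complex) \<times> ('a \<Rightarrow> complex)) set" where
  "ae_rel X = {(f, g). f \<in> bounded_functions X \<and> g \<in> bounded_functions X \<and>
                       (AE x in meas X. f x = g x)}"

abbreviation ae_class :: "'a function_domain \<Rightarrow> ('a \<Rightarrow> complex) \<Rightarrow> ('a \<Rightarrow> complex) set" where
  "ae_class X f \<equiv> ae_rel X `` {f}"

text \<open>
  The value of the functional on \<open>L\<^sup>\<infinity>\<close> with density \<open>h\<close>; it does not depend on the chosen
  element of the class.
\<close>

definition pairing ::
  "'a function_domain \<Rightarrow> ('a \<Rightarrow> complex) \<Rightarrow> ('a \<Rightarrow> complex) set \<Rightarrow> complex" where
  "pairing X h F = the_elem ((\<lambda>f. LINT x:dom X|meas X. h x * f x) ` F)"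

text \<open>
  Operations on classes are defined as unions over all representatives, as is usual in
  \<open>Equiv_Relations\<close>.  The class of an inadmissible function is empty, and such a union is a
  single class only if the operation respects almost everywhere equality.
\<close>

definition Linfty :: "'a function_domain \<Rightarrow> ('a \<Rightarrow> complex) set tracial_algebra" where
  "Linfty X = \<lparr>
     carrier = bounded_functions X // ae_rel X,
     mult = (\<lambda>F G. \<Union>f\<in>F. \<Union>g\<in>G. ae_class X (\<lambda>x. f x * g x)),
     one = ae_class X (\<lambda>_. 1),
     zero = ae_class X (\<lambda>_. 0),
     add = (\<lambda>F G. \<Union>f\<in>F. \<Union>g\<in>G. ae_class X (\<lambda>x. f x + g x)),
     smult = (\<lambda>c F. \<Union>f\<in>F. ae_class X (\<lambda>x. c * f x)),
     adj = (\<lambda>F. \<Union>f\<in>F. ae_class X (\<lambda>x. cnj (f x))),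
     tr = pairing X (\<lambda>_. 1),
     predual = {pairing X h |h. h \<in> borel_measurable (meas X) \<and> h \<in> invariant X \<and>
                               set_integrable (meas X) (dom X) h}\<rparr>"

definition product_domain ::
  "'a function_domain \<Rightarrow> 'b function_domain \<Rightarrow> ('a \<times> 'b) function_domain" where
  "product_domain X Y = \<lparr>
     meas = meas X \<Otimes>\<^sub>M meas Y,
     dom = dom X \<times> dom Y,
     invariant = {g. (\<forall>y. (\<lambda>x. g (x, y)) \<in> invariant X) \<and> (\<forall>x. (\<lambda>y. g (x, y)) \<in> invariant Y)}\<rparr>"

definition tensor ::
  "'a function_domain \<Rightarrow> 'b function_domain \<Rightarrow>
     ('a \<Rightarrow> complex) set \<Rightarrow> ('b \<Rightarrow> complex) set \<Rightarrow> ('a \<times> 'b \<Rightarrow> complex) set" where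
  "tensor X Y F G = (\<Union>f\<in>F. \<Union>g\<in>G. ae_class (product_domain X Y) (\<lambda>(x, y). f x * g y))"

text \<open>
  The von Neumann algebra tensor product of two \<open>L\<^sup>\<infinity>\<close>-algebras acts on \<open>L\<^sup>2\<close> of the product and
  is the weak* closure of the span of the elementary tensors.  The latter are multiplication
  operators by functions on the product, so the closure can be taken inside \<open>L\<^sup>\<infinity>\<close> of the product.
\<close>

definition vn_tensor ::
  "'a function_domain \<Rightarrow> 'b function_domain \<Rightarrow> ('a \<times> 'b \<Rightarrow> complex) set tracial_algebra" where
  "vn_tensor X Y =
     (let L = Linfty (product_domain X Y) in
      L\<lparr>carrier := weak_star_topology L closure_of
          linear_span L {tensor X Y F G |F G. F \<in> carrier (Linfty X) \<and> G \<in> carrier (Linfty Y)}\<rparr>)"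


section \<open>The Poisson semigroup on the torus and its dilation\<close>

definition torus :: "(real ^ 'n) function_domain" where
  "torus = \<lparr>meas = lborel, dom = cbox 0 1, invariant = {f. \<forall>x i. f (x + axis i 1) = f x}\<rparr>"

definition sphere_area :: "'n::finite itself \<Rightarrow> real" where
  "sphere_area _ = 2 * pi powr ((real CARD('n) + 1) / 2) / Gamma ((real CARD('n) + 1) / 2)"

definition nu_measure :: "(real ^ 'n) measure" where
  "nu_measure = density lborel (\<lambda>y. ennreal
     (2 / (sphere_area TYPE('n) * (1 + (norm y)\<^sup>2) powr ((real CARD('n) + 1) / 2))))"

definition nu_domain :: "(real ^ 'n) function_domain" where
  "nu_domain = \<lparr>meas = nu_measure, dom = UNIV, invariant = UNIV\<rparr>"

definition torus_algebra :: "(real ^ 'n \<Rightarrow> complex) set tracial_algebra" where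
  "torus_algebra = Linfty torus"

definition nu_algebra :: "(real ^ 'n \<Rightarrow> complex) set tracial_algebra" where
  "nu_algebra = Linfty nu_domain"

definition N_algebra :: "((real ^ 'n) \<times> (real ^ 'n) \<Rightarrow> complex) set tracial_algebra" where
  "N_algebra = vn_tensor torus nu_domain"

definition character :: "int ^ 'n \<Rightarrow> real ^ 'n \<Rightarrow> complex" where
  "character m y =
     (\<Prod>i\<in>UNIV. exp (2 * \<i> * complex_of_real pi * of_int (m $ i) * complex_of_real (y $ i)))"

definition poisson_kernel :: "real \<Rightarrow> real ^ 'n \<Rightarrow> complex" where
  "poisson_kernel t y =
     (\<Sum>\<^sub>\<infinity>m\<in>UNIV. complex_of_real (exp (- 2 * pi * t * norm (\<chi> i. real_of_int (m $ i)))) * character m y)"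

text \<open>Only meaningful for \<open>t \<ge> 0\<close>.\<close>

definition poisson ::
  "real \<Rightarrow> (real ^ 'n \<Rightarrow> complex) set \<Rightarrow> (real ^ 'n \<Rightarrow> complex) set" where
  "poisson t F =
     (if t = 0 then F
      else \<Union>f\<in>F. ae_class torus (\<lambda>x. LINT y:cbox 0 1|lborel. poisson_kernel t y * f (x - y)))"

definition J_map ::
  "(real ^ 'n \<Rightarrow> complex) set \<Rightarrow> ((real ^ 'n) \<times> (real ^ 'n) \<Rightarrow> complex) set" where
  "J_map F = tensor torus nu_domain F \<one>\<^bsub>nu_algebra\<^esub>"

definition U_map ::
  "real \<Rightarrow> ((real ^ 'n) \<times> (real ^ 'n) \<Rightarrow> complex) set \<Rightarrow> ((real ^ 'n) \<times> (real ^ 'n) \<Rightarrow> complex) set" where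
  "U_map t G =
     (\<Union>g\<in>G. ae_class (product_domain torus nu_domain) (\<lambda>(x, y). g (x - t *\<^sub>R y, y)))"

definition is_E_map ::
  "(((real ^ 'n) \<times> (real ^ 'n) \<Rightarrow> complex) set \<Rightarrow> (real ^ 'n \<Rightarrow> complex) set) \<Rightarrow> bool" where
  "is_E_map E \<longleftrightarrow>
     E \<in> extensional (carrier N_algebra) \<and>
     conditional_expectation torus_algebra N_algebra J_map E \<and>
     trace_preserving N_algebra torus_algebra E \<and>
     normal_map N_algebra torus_algebra E \<and>
     faithful_map N_algebra torus_algebra E \<and>
     (\<forall>F\<in>carrier torus_algebra. \<forall>G\<in>carrier nu_algebra.
        E (tensor torus nu_domain F G) = tr nu_algebra G \<odot>\<^bsub>torus_algebra\<^esub> F)"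

definition E_map ::
  "((real ^ 'n) \<times> (real ^ 'n) \<Rightarrow> complex) set \<Rightarrow> (real ^ 'n \<Rightarrow> complex) set" where
  "E_map = (THE E. is_E_map E)"

end

theory Submission
  imports Defs "HOL-Probability.Characteristic_Functions" "HOL-Real_Asymp.Real_Asymp"
begin

text \<open>
  On a representative \<open>f\<close> the composition \<open>\<bbbE> U\<^sub>t J\<close> is
  \<open>x \<mapsto> \<integral> f (x - t y) d\<nu>(y)\<close>, and \<open>P\<^sub>t\<close> is \<open>x \<mapsto> \<integral> p\<^sub>t(y) f (x - y) dy\<close> over the cube.  For fixed \<open>x\<close> both
  integrate the same periodic function \<open>y \<mapsto> f (x - y)\<close>: once against the image of \<open>\<nu>\<close> under dilation
  by \<open>t\<close>, once against the density \<open>p\<^sub>t\<close> on the cube.  An integrable density is determined, as a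
  functional on periodic functions, by its integrals against the characters (\<open>fourier_uniqueness\<close>), so
  it suffices that both have the coefficients \<open>exp (-2\<pi>t|m|)\<close>.  For \<open>p\<^sub>t\<close> this is term by term integration
  (\<open>poisson_kernel_fourier\<close>).  For \<open>\<nu>\<close> it says that the characteristic function of \<open>\<nu>\<close> is \<open>exp (-|\<xi>|)\<close>
  (\<open>nu_density_fourier\<close>): the Gamma integral presents the density of \<open>\<nu>\<close> as a mixture of Gaussians, the
  Fourier transform of a Gaussian is a Gaussian, and the remaining integral over the mixing parameter
  is the subordination formula for \<open>exp (-\<beta>)\<close> (\<open>subordination\<close>).  The case \<open>\<xi> = 0\<close> shows that \<open>\<nu>\<close> is a
  probability measure.

  Fourier uniqueness rests on a density statement: a periodic Borel function is a Borel function of the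
  coordinates \<open>exp (2\<pi>ix\<^sub>1), ..., exp (2\<pi>ix\<^sub>n)\<close>, continuous functions are dense in \<open>L\<^sup>1\<close> of every finite Borel
  measure, and on the torus they are uniform limits of trigonometric polynomials by Stone--Weierstrass.
  It also yields the translation invariance of the integral over the cube, hence that the maps \<open>U\<^sub>t\<close>
  preserve the trace and that they can be moved to the other side of the duality pairing.  Weak*
  continuity follows by approximating the density of the functional in \<open>L\<^sup>1\<close> by a continuous function of
  the torus coordinates and \<open>y\<close>; invariance makes the approximation uniform in \<open>t\<close>.

  The tensor product \<open>N\<close> is all of \<open>L\<^sup>\<infinity>\<close> of the product (\<open>tensors_weak_star_dense\<close>): a weak* neighbourhood
  tests only finitely many integrable densities, and combinations of rectangles are dense in \<open>L\<^sup>1\<close> of a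
  finite measure dominating them.  A normal map on \<open>N\<close> is therefore determined by its values on
  elementary tensors, which is the uniqueness of \<open>\<bbbE>\<close> (\<open>is_E_map_unique\<close>).  Its existence is averaging
  over the second variable.  Both \<open>J\<close> and \<open>\<bbbE>\<close> are normal because Fubini's theorem exhibits their
  preadjoints, which average and lift densities, respectively.
\<close>

section \<open>Approximation in the mean\<close>

lemma integrable_mult_bounded:
  fixes h g :: "'a \<Rightarrow> complex"
  assumes h: "integrable M h" and g: "g \<in> borel_measurable M" and C: "AE x in M. norm (g x) \<le> C"
  shows "integrable M (\<lambda>x. h x * g x)"
proof (rule Bochner_Integration.integrable_bound)
  show "integrable M (\<lambda>x. C * norm (h x))" by (intro integrable_mult_right integrable_norm h)
  show "(\<lambda>x. h x * g x) \<in> borel_measurable M" using h g by (intro borel_measurable_times) auto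
  show "AE x in M. norm (h x * g x) \<le> norm (C * norm (h x))"
    using C
  proof eventually_elim
    case (elim x)
    then have "norm (h x) * norm (g x) \<le> norm (h x) * C" by (intro mult_left_mono) auto
    also have "\<dots> = C * norm (h x)" by (rule mult.commute)
    also have "\<dots> \<le> norm (C * norm (h x))" by simp
    finally show ?case by (simp only: norm_mult)
  qed
qed

definition L1_approximable :: "'a measure \<Rightarrow> ('a \<Rightarrow> complex) set \<Rightarrow> ('a \<Rightarrow> complex) \<Rightarrow> bool" where
  "L1_approximable M V f \<longleftrightarrow> (\<forall>e>0. \<exists>v\<in>V. (\<integral>x. norm (f x - v x) \<partial>M) < e)"

lemma L1_distance_triangle:
  fixes f g h :: "'a \<Rightarrow> complex"
  assumes "integrable M f" "integrable M g" "integrable M h"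
  shows "(\<integral>x. norm (f x - h x) \<partial>M) \<le> (\<integral>x. norm (f x - g x) \<partial>M) + (\<integral>x. norm (g x - h x) \<partial>M)"
proof -
  have "(\<integral>x. norm (f x - h x) \<partial>M) \<le> (\<integral>x. norm (f x - g x) + norm (g x - h x) \<partial>M)"
    using assms by (intro integral_mono) (auto intro: norm_triangle_sub simp: norm_diff_triangle_ineq
        intro!: norm_diff_triangle_le[of _ "g _"])
  also have "\<dots> = (\<integral>x. norm (f x - g x) \<partial>M) + (\<integral>x. norm (g x - h x) \<partial>M)"
    using assms by (intro Bochner_Integration.integral_add) auto
  finally show ?thesis .
qed

lemma L1_approximable_limit:
  assumes V: "\<And>v. v \<in> V \<Longrightarrow> integrable M v"
    and s: "\<And>i. integrable M (s i)" "\<And>i. L1_approximable M V (s i)"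
    and lim: "\<And>x. x \<in> space M \<Longrightarrow> (\<lambda>i. s i x) \<longlonglongrightarrow> f x"
    and bound: "\<And>i x. x \<in> space M \<Longrightarrow> norm (s i x) \<le> w x"
    and w: "integrable M w" and f: "integrable M f"
  shows "L1_approximable M V f"
  unfolding L1_approximable_def
proof (intro allI impI)
  fix e :: real assume e: "e > 0"
  have fw: "norm (f x) \<le> w x" if "x \<in> space M" for x
    using tendsto_norm[OF lim[OF that]] by (rule LIMSEQ_le_const2) (use bound that in auto)
  have "(\<lambda>i. \<integral>x. norm (f x - s i x) \<partial>M) \<longlonglongrightarrow> (\<integral>x. 0 \<partial>M)"
  proof (rule integral_dominated_convergence[where w = "\<lambda>x. 2 * w x"])
    show "AE x in M. (\<lambda>i. norm (f x - s i x)) \<longlonglongrightarrow> 0"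
    proof (rule AE_I2)
      fix x assume "x \<in> space M"
      from tendsto_norm[OF tendsto_diff[OF tendsto_const[of "f x"] lim[OF this]]]
      show "(\<lambda>i. norm (f x - s i x)) \<longlonglongrightarrow> 0" by simp
    qed
    show "AE x in M. norm (norm (f x - s i x)) \<le> 2 * w x" for i
    proof (rule AE_I2)
      fix x assume "x \<in> space M"
      with fw[OF this] bound[OF this, of i] norm_triangle_ineq4[of "f x" "s i x"]
      show "norm (norm (f x - s i x)) \<le> 2 * w x" by auto
    qed
  qed (use f s(1) w in auto)
  then have "eventually (\<lambda>i. (\<integral>x. norm (f x - s i x) \<partial>M) < e / 2) sequentially"
    by (rule order_tendstoD) (use e in auto)
  then obtain i where i: "(\<integral>x. norm (f x - s i x) \<partial>M) < e / 2"
    using eventually_happens trivial_limit_sequentially by blast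
  obtain v where v: "v \<in> V" "(\<integral>x. norm (s i x - v x) \<partial>M) < e / 2"
    using s(2)[of i] e unfolding L1_approximable_def by (meson half_gt_zero)
  have "(\<integral>x. norm (f x - v x) \<partial>M) < e"
    using L1_distance_triangle[OF f s(1)[of i] V[OF v(1)]] i v(2) by linarith
  with v(1) show "\<exists>v\<in>V. (\<integral>x. norm (f x - v x) \<partial>M) < e" by blast
qed

text \<open>
  The sets whose indicator can be approximated form a Dynkin system, because dominated convergence
  handles countable disjoint unions and \<open>V\<close> is a vector space; simple functions and their limits
  follow.  The lemma is used for continuous functions, and for sums of elementary tensors.
\<close>

lemma L1_dense_of_generator:
  fixes f :: "'a \<Rightarrow> complex"
  assumes M: "finite_measure M" and G: "sets M = sigma_sets (space M) G" "Int_stable G" "G \<subseteq> Pow (space M)"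
    and V: "\<And>v. v \<in> V \<Longrightarrow> integrable M v"
    and V_add: "\<And>v w. v \<in> V \<Longrightarrow> w \<in> V \<Longrightarrow> (\<lambda>x. v x + w x) \<in> V"
    and V_scale: "\<And>c v. v \<in> V \<Longrightarrow> (\<lambda>x. c * v x) \<in> V"
    and V_space: "L1_approximable M V (\<lambda>_. 1)"
    and V_gen: "\<And>A. A \<in> G \<Longrightarrow> L1_approximable M V (indicator A)"
    and f: "integrable M f"
  shows "L1_approximable M V f"
proof -
  interpret finite_measure M by fact
  have sum: "L1_approximable M V (\<lambda>x. f x + g x)"
    if f: "integrable M f" "L1_approximable M V f" and g: "integrable M g" "L1_approximable M V g" for f g
    unfolding L1_approximable_def
  proof (intro allI impI)
    fix e :: real assume e: "e > 0"
    obtain v where v: "v \<in> V" "(\<integral>x. norm (f x - v x) \<partial>M) < e / 2"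
      using f(2) e unfolding L1_approximable_def by (meson half_gt_zero)
    obtain w where w: "w \<in> V" "(\<integral>x. norm (g x - w x) \<partial>M) < e / 2"
      using g(2) e unfolding L1_approximable_def by (meson half_gt_zero)
    note [simp] = f(1) g(1) V[OF v(1)] V[OF w(1)]
    have "(\<integral>x. norm ((f x + g x) - (v x + w x)) \<partial>M) \<le> (\<integral>x. norm (f x - v x) + norm (g x - w x) \<partial>M)"
      by (intro integral_mono) (auto intro: norm_diff_triangle_ineq)
    also have "\<dots> = (\<integral>x. norm (f x - v x) \<partial>M) + (\<integral>x. norm (g x - w x) \<partial>M)"
      by (intro Bochner_Integration.integral_add) auto
    also have "\<dots> < e" using v w by linarith
    finally show "\<exists>v\<in>V. (\<integral>x. norm (f x + g x - v x) \<partial>M) < e"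
      using V_add[OF v(1) w(1)] by (intro bexI[of _ "\<lambda>x. v x + w x"]) auto
  qed
  have scale: "L1_approximable M V (\<lambda>x. c * f x)" if f: "L1_approximable M V f" for c f
    unfolding L1_approximable_def
  proof (intro allI impI)
    fix e :: real assume e: "e > 0"
    obtain v where v: "v \<in> V" "(\<integral>x. norm (f x - v x) \<partial>M) < e / (norm c + 1)"
      using f e unfolding L1_approximable_def by (metis add_nonneg_pos divide_pos_pos norm_ge_zero zero_less_one)
    have "(\<integral>x. norm (c * f x - c * v x) \<partial>M) = (\<integral>x. norm c * norm (f x - v x) \<partial>M)"
      by (simp add: norm_mult flip: right_diff_distrib)
    also have "\<dots> = norm c * (\<integral>x. norm (f x - v x) \<partial>M)" by simp
    also have "\<dots> \<le> (norm c + 1) * (\<integral>x. norm (f x - v x) \<partial>M)"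
      by (intro mult_right_mono) auto
    also have "\<dots> < (norm c + 1) * (e / (norm c + 1))"
      using v(2) by (intro mult_strict_left_mono) (auto simp: add_nonneg_pos)
    also have "\<dots> = e"
      using norm_ge_zero[of c] by (simp add: add_nonneg_eq_0_iff)
    finally show "\<exists>v\<in>V. (\<integral>x. norm (c * f x - v x) \<partial>M) < e"
      using V_scale[OF v(1)] by (intro bexI[of _ "\<lambda>x. c * v x"]) auto
  qed
  have ind_int [simp]: "integrable M (indicator A :: 'a \<Rightarrow> complex)" if "A \<in> sets M" for A
    using that by (intro integrable_const_bound[of _ 1]) (auto simp: indicator_def)
  have ind: "L1_approximable M V (indicator A)" if "A \<in> sets M" for A
    using G(2,3) that[unfolded G(1)]
  proof (induction A rule: sigma_sets_induct_disjoint)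
    case (basic A)
    then show ?case by (rule V_gen)
  next
    case empty
    then show ?case using scale[OF V_space, of 0] by (simp add: indicator_def[abs_def])
  next
    case (compl A)
    then have A: "A \<in> sets M" by (simp add: G(1))
    have "L1_approximable M V (\<lambda>x. 1 + (-1) * indicator A x)"
      using A by (intro sum V_space scale compl) auto
    moreover have "(\<integral>x. norm (indicator (space M - A) x - v x) \<partial>M) = (\<integral>x. norm (1 + (-1) * indicator A x - v x) \<partial>M)" for v :: "'a \<Rightarrow> complex"
      by (intro Bochner_Integration.integral_cong) (auto simp: indicator_def)
    ultimately show ?case unfolding L1_approximable_def by simp
  next
    case (union A)
    then have A: "A i \<in> sets M" for i by (auto simp: G(1))
    have fin: "L1_approximable M V (\<lambda>x. \<Sum>i<n. indicator (A i) x)" for n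
    proof (induction n)
      case 0
      then show ?case using scale[OF V_space, of 0] by simp
    next
      case (Suc n)
      show ?case using A by (auto intro!: sum Suc union)
    qed
    have eq: "(\<Sum>i<n. indicator (A i) x) = (indicator (\<Union>i<n. A i) x :: complex)" for n x
      using union(1) by (subst indicator_UN_disjoint) (auto simp: disjoint_family_on_def)
    show ?case
    proof (rule L1_approximable_limit[OF V, where s = "\<lambda>n x. \<Sum>i<n. indicator (A i) x" and w = "\<lambda>_. 1"])
      show "(\<lambda>n. \<Sum>i<n. indicator (A i) x) \<longlonglongrightarrow> (indicator (\<Union>i. A i) x :: complex)" for x
        unfolding eq by (rule LIMSEQ_indicator_UN)
      show "norm (\<Sum>i<n. indicator (A i) x :: complex) \<le> 1" for n x
        unfolding eq by (simp add: indicator_def)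
    qed (use A fin in auto)
  qed
  show ?thesis
    using f
  proof (induction rule: integrable_induct)
    case (base A c)
    have "L1_approximable M V (\<lambda>x. c * indicator A x)" by (intro scale ind base)
    moreover have "(\<lambda>x. c * indicator A x) = (\<lambda>x. indicator A x *\<^sub>R c)" by (auto simp: indicator_def)
    ultimately show ?case by simp
  next
    case (add f g)
    then show ?case by (intro sum)
  next
    case (lim f s)
    show ?case
      by (rule L1_approximable_limit[OF V, where s = s and w = "\<lambda>x. 2 * norm (f x)"]) (use lim in auto)
  qed
qed

text \<open>
  The closed sets generate the Borel sets, and the indicator of a closed set is a decreasing limit of
  continuous functions that fall off linearly with the distance from it.
\<close>

lemma continuous_L1_dense:
  fixes f :: "'a::metric_space \<Rightarrow> complex"
  assumes M: "finite_measure M" "sets M = sets borel" and f: "integrable M f"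
  shows "L1_approximable M {\<phi>. continuous_on UNIV \<phi> \<and> bounded (range \<phi>)} f"
proof -
  interpret finite_measure M by fact
  have sp: "space M = UNIV" using M(2) sets_eq_imp_space_eq by force
  let ?V = "{\<phi> :: 'a \<Rightarrow> complex. continuous_on UNIV \<phi> \<and> bounded (range \<phi>)}"
  have int: "integrable M v" if "v \<in> ?V" for v
  proof -
    from that obtain B where B: "\<And>x. norm (v x) \<le> B" by (auto simp: bounded_iff)
    have "v \<in> borel_measurable M"
      unfolding measurable_cong_sets[OF M(2) refl]
      using that by (intro borel_measurable_continuous_onI) auto
    then show ?thesis
      using B by (intro integrable_const_bound[of _ B]) auto
  qed
  have one: "L1_approximable M ?V (\<lambda>_. 1)"
    unfolding L1_approximable_def
    by (intro allI impI bexI[of _ "\<lambda>_. 1"]) (auto intro: continuous_intros)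
  show ?thesis
  proof (rule L1_dense_of_generator[OF M(1), where G = "Collect closed"])
    show "sets M = sigma_sets (space M) (Collect closed)"
      unfolding M(2) sp by (subst borel_eq_closed) simp
    show "Int_stable (Collect closed :: 'a set set)" by (auto simp: Int_stable_def)
    show "(\<lambda>x. v x + w x) \<in> ?V" if "v \<in> ?V" "w \<in> ?V" for v w
      using that by (auto intro!: continuous_intros bounded_plus_comp)
    show "(\<lambda>x. c * v x) \<in> ?V" if "v \<in> ?V" for c v
    proof -
      from that obtain B where B: "\<And>x. norm (v x) \<le> B" by (auto simp: bounded_iff)
      have "bounded (range (\<lambda>x. c * v x))"
        unfolding bounded_iff using B
        by (intro exI[of _ "norm c * B"]) (auto simp: norm_mult intro: mult_left_mono)
      with that show ?thesis by (auto intro!: continuous_intros)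
    qed
    show "L1_approximable M ?V (indicator A)" if "A \<in> Collect closed" for A
    proof (cases "A = {}")
      case True
      have "(\<lambda>_. 0) \<in> ?V" by auto
      then show ?thesis
        unfolding L1_approximable_def using True by (intro allI impI bexI[of _ "\<lambda>_. 0"]) auto
    next
      case False
      let ?s = "\<lambda>(k::nat) x. complex_of_real (max 0 (1 - of_nat k * infdist x A))"
      have b: "norm (?s k x) \<le> 1" for k x using infdist_nonneg[of x A] by (auto simp: max_def)
      have sV: "?s k \<in> ?V" for k
        using b[of k] by (auto simp: bounded_iff intro!: continuous_intros exI[of _ 1])
      show ?thesis
      proof (rule L1_approximable_limit[OF int, where s = ?s and w = "\<lambda>_. 1"])
        show "L1_approximable M ?V (?s k)" for k
          unfolding L1_approximable_def using sV[of k] by (intro allI impI bexI[of _ "?s k"]) auto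
        show "(\<lambda>k. ?s k x) \<longlonglongrightarrow> indicator A x" for x
        proof (cases "x \<in> A")
          case True
          then show ?thesis by simp
        next
          case False
          then have pos: "infdist x A > 0"
            using that \<open>A \<noteq> {}\<close> in_closed_iff_infdist_zero[of A x] infdist_nonneg[of x A] by force
          obtain N :: nat where N: "1 / infdist x A < of_nat N" using reals_Archimedean2 by blast
          have "?s k x = 0" if "k \<ge> N" for k
          proof -
            have "1 < of_nat N * infdist x A" using N pos by (simp add: field_simps)
            also have "\<dots> \<le> of_nat k * infdist x A" using that pos by (intro mult_right_mono) auto
            finally show ?thesis by simp
          qed
          then have "eventually (\<lambda>k. ?s k x = 0) sequentially"
            unfolding eventually_sequentially by blast
          then have "(\<lambda>k. ?s k x) \<longlonglongrightarrow> 0" by (rule tendsto_eventually)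
          with False show ?thesis by simp
        qed
        show "integrable M (?s k)" for k by (rule int[OF sV])
        show "integrable M (indicator A :: 'a \<Rightarrow> complex)"
        proof -
          have "A \<in> sets M" using that M(2) by auto
          then show ?thesis by (intro integrable_const_bound[of _ 1]) (auto simp: indicator_def)
        qed
      qed (use b in auto)
    qed
  qed (use int one f sp in auto)
qed

section \<open>Periodic functions and their Fourier coefficients\<close>

definition torus_coords :: "real ^ 'n \<Rightarrow> complex ^ 'n" where
  "torus_coords x = (\<chi> i. cis (2 * pi * x $ i))"

text \<open>
  A Borel measurable choice of preimages under \<open>torus_coords\<close>, which exists although no continuous one
  does; it recovers a point only up to the integer lattice.
\<close>

definition torus_point :: "complex ^ 'n \<Rightarrow> real ^ 'n" where
  "torus_point w = (\<chi> i. Arg (w $ i) / (2 * pi))"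

lemma character_eq_cis: "character m x = cis (2 * pi * (\<Sum>i\<in>UNIV. of_int (m $ i) * x $ i))"
  unfolding character_def cis_conv_exp exp_sum[OF finite, symmetric]
  by (simp add: sum_distrib_left sum_distrib_right algebra_simps)

lemma character_add: "character (m + m') x = character m x * character m' x"
  by (simp add: character_eq_cis cis_mult algebra_simps sum.distrib)

lemma character_zero: "character 0 x = 1"
  by (simp add: character_eq_cis)

lemma norm_character [simp]: "norm (character m x) = 1"
  by (simp add: character_eq_cis)

lemma continuous_on_character [continuous_intros]: "continuous_on A (character m)"
  unfolding character_eq_cis cis_conv_exp by (intro continuous_intros)

lemma character_measurable [measurable]: "character m \<in> borel_measurable borel"
  by (intro borel_measurable_continuous_onI continuous_intros)

lemma character_plus: "character m (x + y) = character m x * character m y"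
  by (simp add: character_eq_cis cis_mult algebra_simps sum.distrib)

lemma character_axis: "character (axis i k) x = cis (2 * pi * of_int k * x $ i)"
proof -
  have "(\<Sum>j\<in>UNIV. of_int (axis i k $ j) * x $ j) = (\<Sum>j\<in>UNIV. if j = i then of_int k * x $ i else 0)"
    by (intro sum.cong) (auto simp: axis_def)
  then show ?thesis by (simp add: character_eq_cis mult.assoc)
qed

lemma periodic_integer_shift:
  fixes f :: "real ^ 'n \<Rightarrow> 'b"
  assumes f: "\<And>x i. f (x + axis i 1) = f x" and m: "\<And>i. m $ i \<in> \<int>"
  shows "f (x + m) = f x"
proof -
  have nat: "f (x + axis i (of_nat k)) = f x" for x i k
  proof (induction k arbitrary: x)
    case 0
    have "x + axis i (of_nat 0) = x" by (simp add: vec_eq_iff axis_def)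
    then show ?case by (rule arg_cong)
  next
    case (Suc k)
    have "x + axis i (of_nat (Suc k)) = (x + axis i (of_nat k)) + axis i 1"
      by (simp add: vec_eq_iff axis_def)
    then show ?case using f[of "x + axis i (of_nat k)" i] Suc[of x] by metis
  qed
  have int: "f (x + axis i (of_int k)) = f x" for x i k
  proof (cases k)
    case (nonneg n)
    then show ?thesis using nat by simp
  next
    case (neg n)
    have "x = (x + axis i (of_int k)) + axis i (of_nat (Suc n))"
      by (simp add: vec_eq_iff axis_def neg)
    then show ?thesis using nat[of "x + axis i (of_int k)" i "Suc n"] by metis
  qed
  have "f (x + (\<Sum>i\<in>A. axis i (m $ i))) = f x" if "finite A" for A
    using that
  proof (induction A arbitrary: x)
    case (insert a A)
    obtain k where k: "m $ a = of_int k" using m[of a] by (auto elim: Ints_cases)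
    have "x + (\<Sum>i\<in>insert a A. axis i (m $ i)) = (x + (\<Sum>i\<in>A. axis i (m $ i))) + axis a (of_int k)"
      using insert(1,2) k by (simp add: algebra_simps)
    then show ?case using int insert.IH by metis
  qed simp
  moreover have "(\<Sum>i\<in>UNIV. axis i (m $ i)) = m"
    by (simp add: vec_eq_iff axis_def if_distrib cong: if_cong)
  ultimately show ?thesis by (metis finite)
qed

lemma periodic_torus_point:
  fixes f :: "real ^ 'n \<Rightarrow> 'b"
  assumes f: "\<And>x i. f (x + axis i 1) = f x"
  shows "f (torus_point (torus_coords x)) = f x"
proof -
  let ?m = "torus_point (torus_coords x) - x"
  have "?m $ i \<in> \<int>" for i
  proof -
    have "cis (Arg (cis (2 * pi * x $ i))) = cis (2 * pi * x $ i)"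
      by (subst cis_Arg) (auto simp: sgn_div_norm)
    then obtain k :: int where "Arg (cis (2 * pi * x $ i)) = 2 * pi * x $ i + 2 * pi * k"
      using sin_cos_eq_iff by (metis cis.simps)
    then have "?m $ i = of_int k"
      by (simp add: torus_point_def torus_coords_def field_simps)
    then show ?thesis by simp
  qed
  from periodic_integer_shift[OF f this, of x] show ?thesis by simp
qed

lemma Arg_measurable [measurable]: "Arg \<in> borel_measurable borel"
proof -
  have "(\<lambda>z. indicator (- \<real>\<^sub>\<le>\<^sub>0) z *\<^sub>R Arg z) \<in> borel_measurable borel"
    by (intro borel_measurable_continuous_on_indicator continuous_on_Arg) auto
  moreover have "\<real>\<^sub>\<le>\<^sub>0 - {0 :: complex} \<in> sets borel" by auto
  ultimately have [measurable]: "(\<lambda>z. if z \<in> \<real>\<^sub>\<le>\<^sub>0 - {0} then pi else indicator (- \<real>\<^sub>\<le>\<^sub>0) z *\<^sub>R Arg z) \<in> borel_measurable borel"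
    by (intro measurable_If_set) auto
  have "Arg = (\<lambda>z. if z \<in> \<real>\<^sub>\<le>\<^sub>0 - {0} then pi else indicator (- \<real>\<^sub>\<le>\<^sub>0) z *\<^sub>R Arg z)"
  proof
    fix z :: complex
    have "Arg z = pi" if "z \<in> \<real>\<^sub>\<le>\<^sub>0" "z \<noteq> 0"
      using that Arg_eq_pi[of z] by (auto simp: nonpos_Reals_def complex_eq_iff)
    moreover have "Arg 0 = 0" by (rule Arg_zero)
    ultimately show "Arg z = (if z \<in> \<real>\<^sub>\<le>\<^sub>0 - {0} then pi else indicator (- \<real>\<^sub>\<le>\<^sub>0) z *\<^sub>R Arg z)"
      by (auto simp: indicator_def)
  qed
  then show ?thesis by (metis (no_types, lifting) \<open>(\<lambda>z. if z \<in> \<real>\<^sub>\<le>\<^sub>0 - {0} then pi else indicator (- \<real>\<^sub>\<le>\<^sub>0) z *\<^sub>R Arg z) \<in> borel_measurable borel\<close>)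
qed

lemma borel_measurable_vecI:
  fixes f :: "'a \<Rightarrow> 'b::euclidean_space ^ 'n"
  assumes "\<And>i. (\<lambda>x. f x $ i) \<in> borel_measurable M"
  shows "f \<in> borel_measurable M"
proof (subst borel_measurable_euclidean_space, rule ballI)
  fix b :: "'b ^ 'n" assume "b \<in> Basis"
  then obtain i c where b: "b = axis i c" unfolding Basis_vec_def by auto
  show "(\<lambda>x. f x \<bullet> b) \<in> borel_measurable M"
    unfolding b inner_axis using assms by simp
qed

lemma torus_point_measurable [measurable]: "torus_point \<in> borel_measurable borel"
proof (rule borel_measurable_vecI)
  fix i
  have [measurable]: "(\<lambda>w :: complex ^ 'n. w $ i) \<in> borel_measurable borel"
    by (intro borel_measurable_continuous_onI continuous_intros)
  show "(\<lambda>w. torus_point w $ i) \<in> borel_measurable borel"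
    unfolding torus_point_def by simp
qed

lemma continuous_torus_coords [continuous_intros]: "continuous_on A torus_coords"
  unfolding torus_coords_def cis_conv_exp by (intro continuous_intros continuous_on_vec_lambda)

lemma torus_coords_measurable [measurable]: "torus_coords \<in> borel_measurable borel"
  by (intro borel_measurable_continuous_onI continuous_intros)

lemma bounded_torus_coords: "torus_coords (x :: real ^ 'n) \<in> cball 0 (real CARD('n))"
proof -
  have "norm (torus_coords x) \<le> (\<Sum>i\<in>UNIV. norm (torus_coords x $ i))"
    unfolding norm_vec_def by (rule L2_set_le_sum) auto
  also have "\<dots> = real CARD('n)" by (simp add: torus_coords_def)
  finally show ?thesis by simp
qed

inductive_set trig_polynomials :: "(real ^ 'n \<Rightarrow> complex) set" where
  char: "character m \<in> trig_polynomials"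
| add: "p \<in> trig_polynomials \<Longrightarrow> q \<in> trig_polynomials \<Longrightarrow> (\<lambda>x. p x + q x) \<in> trig_polynomials"
| scale: "p \<in> trig_polynomials \<Longrightarrow> (\<lambda>x. c * p x) \<in> trig_polynomials"

lemma trig_polynomials_const: "(\<lambda>_. c) \<in> trig_polynomials"
  using trig_polynomials.scale[OF trig_polynomials.char[of 0], of c] by (simp add: character_zero)

lemma trig_polynomials_mult:
  assumes "p \<in> trig_polynomials" "q \<in> trig_polynomials"
  shows "(\<lambda>x. p x * q x) \<in> trig_polynomials"
  using assms
proof (induction p rule: trig_polynomials.induct)
  case (char m)
  then show ?case
  proof (induction q rule: trig_polynomials.induct)
    case (char m')
    then show ?case using trig_polynomials.char[of "m + m'"] by (simp add: character_add[abs_def])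
  next
    case (add p q)
    then show ?case by (simp add: ring_distribs trig_polynomials.add)
  next
    case (scale p c)
    then have "(\<lambda>x. c * (character m x * p x)) \<in> trig_polynomials" by (intro trig_polynomials.scale)
    then show ?case by (simp add: mult.left_commute)
  qed
next
  case (add p q)
  then show ?case by (simp add: ring_distribs trig_polynomials.add)
next
  case (scale p c)
  then have "(\<lambda>x. c * (p x * q x)) \<in> trig_polynomials" by (intro trig_polynomials.scale)
  then show ?case by (simp add: mult.assoc)
qed

lemma trig_polynomials_sum:
  "finite A \<Longrightarrow> (\<And>i. i \<in> A \<Longrightarrow> p i \<in> trig_polynomials) \<Longrightarrow> (\<lambda>x. \<Sum>i\<in>A. p i x) \<in> trig_polynomials"
  by (induction A rule: finite_induct) (auto intro: trig_polynomials.add trig_polynomials_const)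

lemma trig_polynomials_bounded:
  assumes "p \<in> trig_polynomials"
  shows "p \<in> borel_measurable borel \<and> (\<exists>B. \<forall>x. norm (p x) \<le> B)"
  using assms
proof (induction p rule: trig_polynomials.induct)
  case (char m)
  then show ?case by (auto intro!: exI[of _ 1])
next
  case (add p q)
  then obtain B C where "\<forall>x. norm (p x) \<le> B" "\<forall>x. norm (q x) \<le> C" by auto
  then have "\<forall>x. norm (p x + q x) \<le> B + C" by (meson norm_triangle_mono)
  with add show ?case by auto
next
  case (scale p c)
  then obtain B where "\<forall>x. norm (p x) \<le> B" by auto
  then have "\<forall>x. norm (c * p x) \<le> norm c * B" by (simp add: norm_mult mult_left_mono)
  with scale show ?case by auto
qed

text \<open>
  The Stone--Weierstrass theorem is applied to polynomials in the real and imaginary parts of the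
  coordinates; cosine and sine are combinations of the characters of frequencies \<open>1\<close> and \<open>-1\<close>.
\<close>

lemma real_polynomial_torus_coords:
  fixes p :: "complex ^ 'n \<Rightarrow> real"
  assumes "real_polynomial_function p"
  shows "(\<lambda>x. of_real (p (torus_coords x))) \<in> trig_polynomials"
  using assms
proof (induction p rule: real_polynomial_function.induct)
  case (linear f)
  then interpret bounded_linear f .
  have f_eq: "f (torus_coords x) = (\<Sum>i\<in>UNIV. cos (2 * pi * x $ i) * f (axis i 1) + sin (2 * pi * x $ i) * f (axis i \<i>))" for x
  proof -
    have "torus_coords x = (\<Sum>i\<in>UNIV. cos (2 * pi * x $ i) *\<^sub>R axis i 1 + sin (2 * pi * x $ i) *\<^sub>R axis i \<i>)"
    proof (rule vec_eq_iff[THEN iffD2], rule allI)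
      fix j
      have "(\<Sum>i\<in>UNIV. cos (2 * pi * x $ i) *\<^sub>R axis i 1 + sin (2 * pi * x $ i) *\<^sub>R axis i \<i>) $ j
        = (\<Sum>i\<in>UNIV. if i = j then cos (2 * pi * x $ j) *\<^sub>R 1 + sin (2 * pi * x $ j) *\<^sub>R \<i> else 0)"
        unfolding sum_component by (intro sum.cong) (auto simp: axis_def)
      also have "\<dots> = torus_coords x $ j" by (simp add: torus_coords_def complex_eq_iff)
      finally show "torus_coords x $ j = (\<Sum>i\<in>UNIV. cos (2 * pi * x $ i) *\<^sub>R axis i 1 + sin (2 * pi * x $ i) *\<^sub>R axis i \<i>) $ j" ..
    qed
    then show ?thesis by (simp add: sum add scale)
  qed
  have cos_eq: "complex_of_real (cos (2 * pi * x $ i)) = 1 / 2 * (character (axis i 1) x + character (axis i (-1)) x)" for x :: "real ^ 'n" and i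
    by (simp add: character_axis complex_eq_iff)
  have sin_eq: "complex_of_real (sin (2 * pi * x $ i)) = (- \<i> / 2) * (character (axis i 1) x + (-1) * character (axis i (-1)) x)" for x :: "real ^ 'n" and i
    by (simp add: character_axis complex_eq_iff)
  have "complex_of_real (f (torus_coords x)) = (\<Sum>i\<in>UNIV.
      f (axis i 1) * (1 / 2 * (character (axis i 1) x + character (axis i (-1)) x)) +
      f (axis i \<i>) * ((- \<i> / 2) * (character (axis i 1) x + (-1) * character (axis i (-1)) x)))" for x
    unfolding f_eq of_real_sum of_real_add of_real_mult cos_eq sin_eq
    by (intro sum.cong refl) (simp add: mult.commute)
  then show ?case
    by (simp only:) (intro trig_polynomials_sum finite trig_polynomials.intros)
next
  case (const c)
  then show ?case by (rule trig_polynomials_const)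
next
  case (add f g)
  then show ?case by (simp add: trig_polynomials.add)
next
  case (mult f g)
  then show ?case by (simp add: trig_polynomials_mult)
qed

lemma polynomial_torus_coords:
  fixes p :: "complex ^ 'n \<Rightarrow> complex"
  assumes "polynomial_function p"
  shows "(\<lambda>x. p (torus_coords x)) \<in> trig_polynomials"
proof -
  have "real_polynomial_function (Re \<circ> p)" "real_polynomial_function (Im \<circ> p)"
    using assms bounded_linear_Re bounded_linear_Im unfolding polynomial_function_def by blast+
  from this[THEN real_polynomial_torus_coords]
  have "(\<lambda>x. of_real (Re (p (torus_coords x))) + \<i> * of_real (Im (p (torus_coords x)))) \<in> trig_polynomials"
    by (intro trig_polynomials.add trig_polynomials.scale) (simp_all add: o_def)
  then show ?thesis by (simp flip: complex_eq)
qed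

text \<open>
  Density of the continuous functions, transported from the image measure.  With the torus coordinates
  for \<open>q\<close>, the approximating functions are continuous and periodic, whichever finite measure is used.
\<close>

lemma L1_approximable_pullback:
  fixes g :: "'a \<Rightarrow> complex" and q :: "'a \<Rightarrow> 'b::metric_space"
  assumes M: "finite_measure M" and q: "q \<in> borel_measurable M" and G: "G \<in> borel_measurable borel"
    and g: "\<And>x. g x = G (q x)" and int: "integrable M g" and e: "e > 0"
  obtains \<phi> where "continuous_on UNIV \<phi>" "bounded (range \<phi>)" "(\<integral>x. norm (g x - \<phi> (q x)) \<partial>M) < e"
proof -
  interpret finite_measure M by fact
  let ?M = "distr M borel q"
  have "integrable ?M G"
    using int q G by (subst integrable_distr_eq) (auto simp: g[abs_def])
  moreover have "finite_measure ?M" using q by (rule finite_measure_distr)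
  ultimately have "L1_approximable ?M {\<phi>. continuous_on UNIV \<phi> \<and> bounded (range \<phi>)} G"
    by (intro continuous_L1_dense) auto
  then obtain \<phi> where \<phi>: "continuous_on UNIV \<phi>" "bounded (range \<phi>)" "(\<integral>x. norm (G x - \<phi> x) \<partial>?M) < e"
    unfolding L1_approximable_def using e by blast
  moreover have "\<phi> \<in> borel_measurable borel" by (rule borel_measurable_continuous_onI) fact
  then have "(\<integral>x. norm (G x - \<phi> x) \<partial>?M) = (\<integral>x. norm (g x - \<phi> (q x)) \<partial>M)"
    using q G by (subst integral_distr) (auto simp: g)
  ultimately show ?thesis using that by auto
qed

lemma integral_trig_polynomial_eq_0:
  assumes K: "integrable lborel K" and 0: "\<And>m. (\<integral>x. K x * character m x \<partial>lborel) = 0"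
    and p: "p \<in> trig_polynomials"
  shows "integrable lborel (\<lambda>x. K x * p x) \<and> (\<integral>x. K x * p x \<partial>lborel) = 0"
  using p
proof (induction p rule: trig_polynomials.induct)
  case (char m)
  then show ?case
    using 0 K by (auto intro!: Bochner_Integration.integrable_bound[OF K] simp: norm_mult)
next
  case (add p q)
  then show ?case by (simp add: ring_distribs)
next
  case (scale p c)
  then have "integrable lborel (\<lambda>x. c * (K x * p x)) \<and> (\<integral>x. c * (K x * p x) \<partial>lborel) = 0" by simp
  then show ?case by (simp add: mult.left_commute)
qed

text \<open>
  The measure \<open>|K| dx\<close> is finite, so \<open>g\<close> is approximated in its \<open>L\<^sup>1\<close> norm by a trigonometric polynomial,
  whose integral against \<open>K\<close> vanishes.  That \<open>K\<close> lives on the whole space rather than on the cube allows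
  the density of \<open>\<nu>\<close> to be used without periodising it.
\<close>

lemma fourier_uniqueness:
  fixes K :: "real ^ 'n \<Rightarrow> complex"
  assumes K: "integrable lborel K" and 0: "\<And>m. (\<integral>x. K x * character m x \<partial>lborel) = 0"
    and g [measurable]: "g \<in> borel_measurable borel" and per: "\<And>x i. g (x + axis i 1) = g x"
    and bound: "AE x in lborel. norm (g x) \<le> C"
  shows "(\<integral>x. K x * g x \<partial>lborel) = 0"
proof -
  define M where "M = density lborel (\<lambda>x. ennreal (norm (K x)))"
  have [measurable]: "K \<in> borel_measurable borel" using K by auto
  have Mint: "integrable M f \<longleftrightarrow> integrable lborel (\<lambda>x. norm (K x) *\<^sub>R f x)"
    if "f \<in> borel_measurable borel" for f :: "_ \<Rightarrow> complex"
    unfolding M_def using that by (subst integrable_density) auto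
  have "finite_measure M"
    using K unfolding M_def
    by (intro finite_measureI) (auto simp: emeasure_density integrable_iff_bounded top.not_eq_extremum)
  then interpret finite_measure M .
  have setsM [measurable_cong]: "sets M = sets borel" by (simp add: M_def)
  have boundM: "AE x in M. norm (g x) \<le> C"
    using bound unfolding M_def by (subst AE_density) auto
  have gM: "integrable M g" by (rule integrable_const_bound[OF boundM]) simp
  have "norm (\<integral>x. K x * g x \<partial>lborel) < e" if e: "e > 0" for e
  proof -
    obtain \<phi> where \<phi>: "continuous_on UNIV \<phi>" "bounded (range \<phi>)"
      "(\<integral>x. norm (g x - \<phi> (torus_coords x)) \<partial>M) < e / 2"
      by (rule L1_approximable_pullback[OF \<open>finite_measure M\<close>, of torus_coords "\<lambda>w. g (torus_point w)" g "e / 2"])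
         (use e gM periodic_torus_point[of g, OF per] in auto)
    \<comment> \<open>The summand 1 covers the case that \<open>K\<close> vanishes almost everywhere.\<close>
    define d where "d = e / (2 * (measure M (space M) + 1))"
    have d: "d > 0" using e by (simp add: d_def add_nonneg_pos)
    have "\<exists>p. polynomial_function p \<and> (\<forall>w\<in>cball 0 (real CARD('n)). norm (\<phi> w - p w) < d)"
      using \<phi>(1) d by (intro Stone_Weierstrass_polynomial_function) (auto intro: continuous_on_subset)
    then obtain p where p: "polynomial_function p" "\<And>w. w \<in> cball 0 (real CARD('n)) \<Longrightarrow> norm (\<phi> w - p w) < d"
      by blast
    define v where "v x = p (torus_coords x)" for x :: "real ^ 'n"
    have v: "v \<in> trig_polynomials" unfolding v_def[abs_def] using p(1) by (rule polynomial_torus_coords)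
    have v_close: "norm (\<phi> (torus_coords x) - v x) < d" for x
      unfolding v_def by (intro p(2) bounded_torus_coords)
    from trig_polynomials_bounded[OF v] obtain B where [measurable]: "v \<in> borel_measurable borel" and B: "\<And>x. norm (v x) \<le> B"
      by auto
    have vM: "integrable M v" by (rule integrable_const_bound[of _ B]) (use B in auto)
    have [measurable]: "\<phi> \<in> borel_measurable borel" by (rule borel_measurable_continuous_onI) fact
    have \<phi>M: "integrable M (\<lambda>x. \<phi> (torus_coords x))"
    proof -
      obtain A where "\<And>w. norm (\<phi> w) \<le> A" using \<phi>(2) by (auto simp: bounded_iff)
      then show ?thesis by (intro integrable_const_bound[of _ A]) auto
    qed
    have "(\<integral>x. norm (\<phi> (torus_coords x) - v x) \<partial>M) \<le> (\<integral>x. d \<partial>M)"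
      using v_close by (intro integral_mono) (auto intro!: integrable_norm Bochner_Integration.integrable_diff \<phi>M vM intro: less_imp_le)
    also have "\<dots> = d * measure M (space M)" by (simp add: mult.commute)
    also have "\<dots> < d * (measure M (space M) + 1)"
      using d by (intro mult_strict_left_mono) auto
    also have "\<dots> = e / 2"
      using measure_nonneg[of M "space M"] by (simp add: d_def add_nonneg_eq_0_iff field_simps)
    finally have close: "(\<integral>x. norm (g x - v x) \<partial>M) < e"
      using L1_distance_triangle[OF gM \<phi>M vM] \<phi>(3) by linarith
    note v0 = integral_trig_polynomial_eq_0[OF K 0 v]
    have Kg: "integrable lborel (\<lambda>x. K x * g x)"
      using gM Mint[of g] by (simp add: norm_mult integrable_iff_bounded)
    have "(\<integral>x. K x * g x \<partial>lborel) = (\<integral>x. K x * g x \<partial>lborel) - (\<integral>x. K x * v x \<partial>lborel)"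
      using v0 by simp
    also have "\<dots> = (\<integral>x. K x * (g x - v x) \<partial>lborel)"
      using Kg v0 by (subst Bochner_Integration.integral_diff[symmetric]) (auto simp: right_diff_distrib)
    also have "norm \<dots> \<le> (\<integral>x. norm (K x * (g x - v x)) \<partial>lborel)" by (rule integral_norm_bound)
    also have "\<dots> = (\<integral>x. norm (g x - v x) \<partial>M)"
      unfolding M_def by (subst integral_density) (auto simp: norm_mult)
    finally show ?thesis using close by linarith
  qed
  from this[of "norm (\<integral>x. K x * g x \<partial>lborel)"] show ?thesis by fastforce
qed

section \<open>The Fourier transform of the measure \<open>\<nu>\<close>\<close>

lemma integral_lborel_vec_prod:
  fixes f :: "'n::finite \<Rightarrow> real \<Rightarrow> complex"
  assumes f: "\<And>i. integrable lborel (f i)"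
  shows "integrable lborel (\<lambda>x :: real ^ 'n. \<Prod>i\<in>UNIV. f i (x $ i))"
    and "(\<integral>x. (\<Prod>i\<in>UNIV. f i ((x :: real ^ 'n) $ i)) \<partial>lborel) = (\<Prod>i\<in>UNIV. integral\<^sup>L lborel (f i))"
proof -
  interpret product_sigma_finite "\<lambda>_ :: real ^ 'n. lborel :: real measure"
    by (simp add: product_sigma_finite_def sigma_finite_lborel)
  have [measurable]: "f i \<in> borel_measurable borel" for i using f[of i] by auto
  let ?T = "\<lambda>x :: real ^ 'n \<Rightarrow> real. \<Sum>b\<in>Basis. x b *\<^sub>R b"
  have Basis: "(Basis :: (real ^ 'n) set) = (\<lambda>i. axis i 1) ` UNIV"
    by (auto simp: Basis_vec_def)
  have inj: "inj (\<lambda>i. axis i 1 :: real ^ 'n)" by (auto simp: inj_on_def axis_eq_axis)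
  have comp: "?T x $ i = x (axis i 1)" for x i
    unfolding Basis by (subst sum.reindex[OF inj]) (simp add: axis_def if_distrib cong: if_cong)
  have prod: "(\<Prod>i\<in>UNIV. f i (?T x $ i)) = (\<Prod>b\<in>Basis. f (axis_index b) (x b))" for x
  proof -
    have "(\<Prod>i\<in>UNIV. f i (?T x $ i)) = (\<Prod>i\<in>UNIV. f i (x (axis i 1)))" by (simp only: comp)
    also have "\<dots> = (\<Prod>b\<in>Basis. f (axis_index b) (x b))"
      unfolding Basis by (subst prod.reindex[OF inj]) simp
    finally show ?thesis .
  qed
  have [measurable]: "(\<lambda>x :: real ^ 'n. \<Prod>i\<in>UNIV. f i (x $ i)) \<in> borel_measurable borel"
  proof (intro borel_measurable_prod)
    fix i
    have [measurable]: "(\<lambda>x :: real ^ 'n. x $ i) \<in> borel_measurable borel"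
      by (intro borel_measurable_continuous_onI continuous_intros)
    show "(\<lambda>x :: real ^ 'n. f i (x $ i)) \<in> borel_measurable borel" by measurable
  qed
  have T [measurable]: "?T \<in> (\<Pi>\<^sub>M b\<in>Basis. lborel) \<rightarrow>\<^sub>M borel" by measurable
  have int: "integrable (\<Pi>\<^sub>M b\<in>Basis. lborel) (\<lambda>x. \<Prod>b\<in>(Basis :: (real ^ 'n) set). f (axis_index b) (x b))"
    by (intro product_integrable_prod f) auto
  have lborel: "(lborel :: (real ^ 'n) measure) = distr (\<Pi>\<^sub>M b\<in>Basis. lborel) borel ?T"
    by (rule lborel_eq)
  have "integrable (\<Pi>\<^sub>M b\<in>Basis. lborel) (\<lambda>x. \<Prod>i\<in>UNIV. f i (?T x $ i))"
    unfolding prod by (rule int)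
  then show "integrable lborel (\<lambda>x :: real ^ 'n. \<Prod>i\<in>UNIV. f i (x $ i))"
    unfolding lborel by (subst integrable_distr_eq[OF T]) simp_all
  have "(\<integral>x. (\<Prod>i\<in>UNIV. f i ((x :: real ^ 'n) $ i)) \<partial>lborel) = (\<integral>x. (\<Prod>i\<in>UNIV. f i (?T x $ i)) \<partial>(\<Pi>\<^sub>M b\<in>Basis. lborel))"
    unfolding lborel by (subst integral_distr[OF T]) simp_all
  also have "\<dots> = (\<Prod>b\<in>(Basis :: (real ^ 'n) set). integral\<^sup>L lborel (f (axis_index b)))"
    unfolding prod by (intro product_integral_prod f) auto
  finally have "(\<integral>x. (\<Prod>i\<in>UNIV. f i ((x :: real ^ 'n) $ i)) \<partial>lborel) = (\<Prod>b\<in>(Basis :: (real ^ 'n) set). integral\<^sup>L lborel (f (axis_index b)))" .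
  then show "(\<integral>x. (\<Prod>i\<in>UNIV. f i ((x :: real ^ 'n) $ i)) \<partial>lborel) = (\<Prod>i\<in>UNIV. integral\<^sup>L lborel (f i))"
    unfolding Basis by (subst (asm) prod.reindex[OF inj]) simp
qed

lemma gaussian_fourier_real:
  fixes u b :: real
  assumes u: "u > 0"
  shows "integrable lborel (\<lambda>x. of_real (exp (- u * x\<^sup>2)) * cis (b * x))"
    and "(\<integral>x. of_real (exp (- u * x\<^sup>2)) * cis (b * x) \<partial>lborel) = of_real (sqrt (pi / u) * exp (- b\<^sup>2 / (4 * u)))"
proof -
  define s where "s = sqrt (2 * u)"
  have s: "s > 0" "s\<^sup>2 = 2 * u" using u by (auto simp: s_def)
  let ?f = "\<lambda>x. std_normal_density x *\<^sub>R iexp (b / s * x)"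
  have f_int: "integrable lborel ?f"
    by (rule Bochner_Integration.integrable_bound[OF integrable_normal_density[of 1 0]]) (auto simp: normal_density_nonneg)
  have "(\<integral>x. ?f x \<partial>lborel) = char std_normal_distribution (b / s)"
    unfolding char_def by (subst integral_density) (auto simp: normal_density_nonneg)
  also have "\<dots> = of_real (exp (- b\<^sup>2 / (4 * u)))"
    using s by (simp add: char_std_normal_distribution power_divide)
  finally have 1: "(\<integral>x. ?f x \<partial>lborel) = of_real (exp (- b\<^sup>2 / (4 * u)))" .
  have eq: "?f (0 + s * x) = of_real (1 / sqrt (2 * pi)) * (of_real (exp (- u * x\<^sup>2)) * cis (b * x))" for x
    using s by (simp add: std_normal_density_def power_mult_distrib cis_conv_exp scaleR_conv_of_real)
  have "integrable lborel (\<lambda>x. ?f (0 + s * x))"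
    using s f_int by (intro lborel_integrable_real_affine) auto
  then have "integrable lborel (\<lambda>x. of_real (sqrt (2 * pi)) * ?f (0 + s * x))"
    by (rule integrable_mult_right)
  moreover have "of_real (sqrt (2 * pi)) * ?f (0 + s * x) = of_real (exp (- u * x\<^sup>2)) * cis (b * x)" for x
    unfolding eq by simp
  ultimately show "integrable lborel (\<lambda>x. of_real (exp (- u * x\<^sup>2)) * cis (b * x))"
    by (simp only:)
  have "(\<integral>x. ?f x \<partial>lborel) = s *\<^sub>R (\<integral>x. ?f (0 + s * x) \<partial>lborel)"
    using lborel_integral_real_affine[of s ?f 0] s by simp
  also have "\<dots> = of_real (s / sqrt (2 * pi)) * (\<integral>x. of_real (exp (- u * x\<^sup>2)) * cis (b * x) \<partial>lborel)"
    unfolding eq by (simp add: scaleR_conv_of_real)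
  finally have "(\<integral>x. of_real (exp (- u * x\<^sup>2)) * cis (b * x) \<partial>lborel) = of_real (sqrt (2 * pi) / s) * of_real (exp (- b\<^sup>2 / (4 * u)))"
    using s unfolding 1 by (simp add: field_simps)
  also have "sqrt (2 * pi) / s = sqrt (pi / u)"
    unfolding s_def using u by (simp add: real_sqrt_mult real_sqrt_divide)
  finally show "(\<integral>x. of_real (exp (- u * x\<^sup>2)) * cis (b * x) \<partial>lborel) = of_real (sqrt (pi / u) * exp (- b\<^sup>2 / (4 * u)))"
    by simp
qed

lemma gaussian_fourier_vec:
  fixes u :: real and \<xi> :: "real ^ 'n"
  assumes u: "u > 0"
  shows "integrable lborel (\<lambda>y. of_real (exp (- u * (norm y)\<^sup>2)) * cis (\<xi> \<bullet> y))"
    and "(\<integral>y. of_real (exp (- u * (norm y)\<^sup>2)) * cis (\<xi> \<bullet> y) \<partial>lborel) =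
      of_real ((pi / u) powr (real CARD('n) / 2) * exp (- (norm \<xi>)\<^sup>2 / (4 * u)))"
proof -
  have norm2: "(norm y)\<^sup>2 = (\<Sum>i\<in>UNIV. (y $ i)\<^sup>2)" for y :: "real ^ 'n"
    by (simp add: norm_vec_def L2_set_def sum_nonneg)
  have eq: "of_real (exp (- u * (norm y)\<^sup>2)) * cis (\<xi> \<bullet> y) = (\<Prod>i\<in>UNIV. of_real (exp (- u * (y $ i)\<^sup>2)) * cis (\<xi> $ i * y $ i))" for y
    by (simp add: norm2 inner_vec_def sum_distrib_left exp_sum cis_conv_exp prod.distrib flip: sum_negf exp_of_real)
  note int = gaussian_fourier_real[OF u]
  show "integrable lborel (\<lambda>y. of_real (exp (- u * (norm y)\<^sup>2)) * cis (\<xi> \<bullet> y))"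
    unfolding eq by (intro integral_lborel_vec_prod int)
  have "(\<integral>y. of_real (exp (- u * (norm y)\<^sup>2)) * cis (\<xi> \<bullet> y) \<partial>lborel) = (\<Prod>i\<in>UNIV. of_real (sqrt (pi / u) * exp (- (\<xi> $ i)\<^sup>2 / (4 * u))))"
    unfolding eq by (subst integral_lborel_vec_prod(2)[OF int(1)]) (simp only: int(2))
  also have "\<dots> = of_real ((\<Prod>i\<in>(UNIV :: 'n set). sqrt (pi / u)) * (\<Prod>i\<in>UNIV. exp (- (\<xi> $ i)\<^sup>2 / (4 * u))))"
    by (simp add: prod.distrib)
  also have "(\<Prod>i\<in>(UNIV :: 'n set). sqrt (pi / u)) = (pi / u) powr (real CARD('n) / 2)"
    using u by (simp add: powr_half_sqrt[symmetric] powr_realpow[symmetric] powr_powr)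
  also have "(\<Prod>i\<in>UNIV. exp (- (\<xi> $ i)\<^sup>2 / (4 * u))) = exp (- (norm \<xi>)\<^sup>2 / (4 * u))"
    by (simp add: norm2 exp_sum[symmetric] sum_negf sum_divide_distrib)
  finally show "(\<integral>y. of_real (exp (- u * (norm y)\<^sup>2)) * cis (\<xi> \<bullet> y) \<partial>lborel) =
      of_real ((pi / u) powr (real CARD('n) / 2) * exp (- (norm \<xi>)\<^sup>2 / (4 * u)))" .
qed

lemma gaussian_integral: "has_bochner_integral lborel (\<lambda>x :: real. exp (- x\<^sup>2)) (sqrt pi)"
  using has_bochner_integral_even_function[OF gaussian_moment_0] by simp

lemma gamma_integral_scaled:
  fixes a s :: real
  assumes "a > 0" "s > 0"
  shows "has_bochner_integral lborel (\<lambda>u. indicator {0<..} u * (u powr (a - 1) * exp (- s * u))) (Gamma a / s powr a)"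
proof (rule has_bochner_integral_nn_integral)
  have "ennreal (Gamma a) = (\<integral>\<^sup>+ t. ennreal (indicator {0..} t * t powr (a - 1) / exp t) \<partial>lborel)"
    by (rule Gamma_conv_nn_integral_real) fact
  also have "\<dots> = ennreal s * (\<integral>\<^sup>+ u. ennreal (indicator {0..} (0 + s * u) * (0 + s * u) powr (a - 1) / exp (0 + s * u)) \<partial>lborel)"
    using assms by (subst nn_integral_real_affine[where c = s and t = 0]) auto
  also have "(\<integral>\<^sup>+ u. ennreal (indicator {0..} (0 + s * u) * (0 + s * u) powr (a - 1) / exp (0 + s * u)) \<partial>lborel)
      = (\<integral>\<^sup>+ u. ennreal (s powr (a - 1)) * ennreal (indicator {0<..} u * (u powr (a - 1) * exp (- s * u))) \<partial>lborel)"
  proof (intro nn_integral_cong_AE)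
    show "AE u in lborel. ennreal (indicator {0..} (0 + s * u) * (0 + s * u) powr (a - 1) / exp (0 + s * u)) =
      ennreal (s powr (a - 1)) * ennreal (indicator {0<..} u * (u powr (a - 1) * exp (- s * u)))"
      using AE_lborel_singleton[of "0 :: real"]
    proof eventually_elim
      case (elim u)
      then show ?case using assms
        by (auto simp: indicator_def zero_le_mult_iff powr_mult exp_minus field_simps simp flip: ennreal_mult)
    qed
  qed
  also have "\<dots> = ennreal (s powr (a - 1)) * (\<integral>\<^sup>+ u. ennreal (indicator {0<..} u * (u powr (a - 1) * exp (- s * u))) \<partial>lborel)"
    by (intro nn_integral_cmult) auto
  also have "ennreal s * (ennreal (s powr (a - 1)) * X) = ennreal (s powr a) * X" for X
    using assms by (simp add: mult.assoc[symmetric] ennreal_mult[symmetric] powr_mult_base)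
  finally have "ennreal (1 / s powr a) * ennreal (Gamma a) = ennreal (1 / s powr a) * (ennreal (s powr a) * (\<integral>\<^sup>+ u. ennreal (indicator {0<..} u * (u powr (a - 1) * exp (- s * u))) \<partial>lborel))"
    by simp
  also have "\<dots> = (\<integral>\<^sup>+ u. ennreal (indicator {0<..} u * (u powr (a - 1) * exp (- s * u))) \<partial>lborel)"
    using assms by (simp add: mult.assoc[symmetric] ennreal_mult[symmetric])
  finally show "(\<integral>\<^sup>+ u. ennreal (indicator {0<..} u * (u powr (a - 1) * exp (- s * u))) \<partial>lborel) = ennreal (Gamma a / s powr a)"
    using assms by (simp add: ennreal_mult[symmetric] Gamma_real_pos less_imp_le)
qed (use assms in \<open>auto simp: Gamma_real_pos less_imp_le\<close>)

text \<open>
  With \<open>v = sqrt u\<close> the exponent is \<open>-(v - c/v)\<^sup>2 - 2c\<close>.  The map \<open>w = v - c/v\<close> takes the half line to the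
  whole line, and the measure \<open>u powr (-1/2) du\<close> becomes \<open>1 + w/r(w)\<close> times Lebesgue measure.  The second
  summand is odd in \<open>w\<close> and contributes nothing, which leaves a Gaussian integral.
\<close>

lemma subordination_substitution:
  fixes c :: real
  assumes c: "c > 0"
  shows "has_bochner_integral lborel (\<lambda>u. indicator {0<..} u * (u powr (- 1 / 2) * exp (- u - c\<^sup>2 / u))) (sqrt pi * exp (- 2 * c))"
proof -
  define r where "r w = sqrt (w\<^sup>2 + 4 * c)" for w
  \<comment> \<open>The positive solution of \<open>v - c/v = w\<close>.\<close>
  define v where "v w = (w + r w) / 2" for w
  define v' where "v' w = (1 + w / r w) / 2" for w
  have r: "r w > 0" "\<bar>w\<bar> < r w" "(r w)\<^sup>2 = w\<^sup>2 + 4 * c" for w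
  proof -
    show "\<bar>w\<bar> < r w" unfolding r_def using c by (intro real_less_rsqrt) auto
    then show "r w > 0" by linarith
    show "(r w)\<^sup>2 = w\<^sup>2 + 4 * c" using c by (simp add: r_def add_nonneg_nonneg)
  qed
  have v: "v w > 0" for w using r(2)[of w] by (auto simp: v_def)
  have vw: "v w - c / v w = w" for w
  proof -
    have "v w * v w - c = w * v w"
      using r(3)[of w] by (simp add: v_def field_simps power2_eq_square)
    then show ?thesis using v[of w] by (simp add: field_simps)
  qed
  have ratio: "\<bar>w / r w\<bar> \<le> 1" for w using r(1,2)[of w] by (simp add: abs_divide)
  have v'_nonneg: "v' w \<ge> 0" for w using ratio[of w] unfolding abs_le_iff v'_def by auto
  have r_deriv: "(r has_real_derivative w / r w) (at w)" for w
  proof -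
    have "w\<^sup>2 + 4 * c > 0" using c by (simp add: add_nonneg_pos)
    then show ?thesis unfolding r_def by (auto intro!: derivative_eq_intros simp: field_simps)
  qed
  have v_deriv: "(v has_real_derivative v' w) (at w)" for w
    unfolding v_def[abs_def] v'_def by (auto intro!: derivative_eq_intros r_deriv)
  let ?f = "\<lambda>u. u powr (- 1 / 2) * exp (- u - c\<^sup>2 / u)"
  let ?g = "\<lambda>w. (v w)\<^sup>2" and ?g' = "\<lambda>w. 2 * v w * v' w"
  have fg: "?f (?g w) * ?g' w = exp (- 2 * c) * (exp (- w\<^sup>2) * (1 + w / r w))" for w
  proof -
    have "(v w - c / v w)\<^sup>2 = (v w)\<^sup>2 + c\<^sup>2 / (v w)\<^sup>2 - 2 * c"
      using v[of w] by (simp add: power2_diff power_divide)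
    then have e: "- (v w)\<^sup>2 - c\<^sup>2 / (v w)\<^sup>2 = - 2 * c + - w\<^sup>2" unfolding vw by simp
    have p: "((v w)\<^sup>2) powr (- 1 / 2) = 1 / v w"
      using v[of w] by (simp add: powr_minus_divide powr_half_sqrt)
    then show ?thesis
      unfolding p e exp_add v'_def using v[of w] by (simp add: field_simps)
  qed
  have r_meas [measurable]: "r \<in> borel_measurable borel" unfolding r_def by measurable
  have int1: "integrable lborel (\<lambda>w. exp (- w\<^sup>2) * (w / r w))"
  proof (rule Bochner_Integration.integrable_bound[OF integrable.intros[OF gaussian_integral]])
    have "norm (exp (- w\<^sup>2) * (w / r w)) \<le> norm (exp (- w\<^sup>2))" for w
    proof -
      have "norm (w / r w) \<le> 1" using ratio[of w] by (simp only: real_norm_def)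
      from mult_left_le[OF this norm_ge_zero] show ?thesis by (simp only: norm_mult)
    qed
    then show "AE w in lborel. norm (exp (- w\<^sup>2) * (w / r w)) \<le> norm (exp (- w\<^sup>2))" by (intro AE_I2)
    show "(\<lambda>w. exp (- w\<^sup>2) * (w / r w)) \<in> borel_measurable lborel" by measurable
  qed
  have odd: "(\<integral>w. exp (- w\<^sup>2) * (w / r w) \<partial>lborel) = 0"
    using lborel_integral_real_affine[of "-1" "\<lambda>w. exp (- w\<^sup>2) * (w / r w)" 0]
    by (simp add: r_def)
  have hb: "has_bochner_integral lborel (\<lambda>w. exp (- w\<^sup>2) * (1 + w / r w)) (sqrt pi)"
    using has_bochner_integral_add[OF gaussian_integral has_bochner_integral_integrable[OF int1]] odd
    by (simp add: ring_distribs)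
  have int2: "set_integrable lborel (einterval (-\<infinity>) \<infinity>) (\<lambda>w. ?f (?g w) * ?g' w)"
    unfolding fg set_integrable_def using hb by (auto simp: einterval_def has_bochner_integral_iff)
  have lim0: "((ereal \<circ> ?g \<circ> real_of_ereal) \<longlongrightarrow> 0) (at_right (-\<infinity>))"
  proof -
    have "(?g \<longlongrightarrow> 0) at_bot" unfolding v_def r_def using c by real_asymp
    then show ?thesis by (simp add: ereal_tendsto_simps zero_ereal_def)
  qed
  have limoo: "((ereal \<circ> ?g \<circ> real_of_ereal) \<longlongrightarrow> \<infinity>) (at_left \<infinity>)"
  proof -
    have "filterlim ?g at_top at_top" unfolding v_def r_def using c by real_asymp
    then show ?thesis by (simp add: ereal_tendsto_simps)
  qed
  have r_cont: "isCont r w" for w using r_deriv by (rule DERIV_isCont)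
  have v_cont: "isCont v w" for w using v_deriv by (rule DERIV_isCont)
  have g_deriv: "DERIV ?g w :> ?g' w" for w
    using DERIV_power[OF v_deriv, where n = 2] by (simp add: mult_ac)
  have f_cont: "isCont ?f (?g w)" for w
  proof -
    have "?g w > 0" using v[of w] by simp
    then show ?thesis by (intro continuous_intros) auto
  qed
  have g'_cont: "isCont ?g' w" for w
    unfolding v'_def using r(1)[of w] by (intro continuous_intros v_cont r_cont) auto
  have g'_nonneg: "0 \<le> ?g' w" for w using v[of w] v'_nonneg[of w] by simp
  have f_nonneg: "0 \<le> ?f (?g w)" for w by simp
  have oo: "(-\<infinity> :: ereal) < \<infinity>" by simp
  note subst = interval_integral_substitution_nonneg[where f = ?f and g = ?g and g' = ?g' and a = "-\<infinity>" and b = \<infinity> and A = 0 and B = \<infinity>,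
      OF oo g_deriv f_cont g'_cont f_nonneg g'_nonneg lim0 limoo int2]
  have "set_integrable lborel (einterval 0 \<infinity>) ?f" by (rule subst(1))
  moreover have "(LBINT u=0..\<infinity>. ?f u) = (LBINT w=-\<infinity>..\<infinity>. ?f (?g w) * ?g' w)" by (rule subst(2))
  moreover have "(LBINT w=-\<infinity>..\<infinity>. ?f (?g w) * ?g' w) = exp (- 2 * c) * sqrt pi"
    unfolding fg using hb
    by (simp add: interval_lebesgue_integral_def set_lebesgue_integral_def einterval_def has_bochner_integral_iff)
  moreover have "einterval 0 \<infinity> = {0 :: real<..}" by (auto simp: einterval_def)
  ultimately show ?thesis
    by (simp add: has_bochner_integral_iff set_integrable_def interval_lebesgue_integral_def set_lebesgue_integral_def mult.commute)
qed

lemma subordination: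
  fixes \<beta> :: real
  assumes "\<beta> \<ge> 0"
  shows "has_bochner_integral lborel (\<lambda>u. indicator {0<..} u * (u powr (- 1 / 2) * exp (- u - \<beta>\<^sup>2 / (4 * u)))) (sqrt pi * exp (- \<beta>))"
proof (cases "\<beta> = 0")
  case True
  then show ?thesis using gamma_integral_scaled[of "1 / 2" 1] by (simp add: Gamma_one_half_real)
next
  case False
  then show ?thesis using subordination_substitution[of "\<beta> / 2"] assms by (simp add: power_divide)
qed

definition nu_density :: "real ^ 'n \<Rightarrow> real" where
  "nu_density y = 2 / (sphere_area TYPE('n) * (1 + (norm y)\<^sup>2) powr ((real CARD('n) + 1) / 2))"

lemma nu_measure_eq: "nu_measure = density lborel (\<lambda>y. ennreal (nu_density y))"
  by (simp add: nu_measure_def nu_density_def)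

lemma sphere_area_pos: "sphere_area TYPE('n::finite) > 0"
  by (auto simp: sphere_area_def intro!: divide_pos_pos mult_pos_pos Gamma_real_pos)

lemma nu_density_pos: "nu_density y > 0"
proof -
  have "1 + (norm y)\<^sup>2 > 0" by (simp add: add_pos_nonneg)
  then show ?thesis by (auto simp: nu_density_def intro!: divide_pos_pos mult_pos_pos sphere_area_pos)
qed

lemma nu_density_measurable [measurable]: "nu_density \<in> borel_measurable borel"
  unfolding nu_density_def[abs_def] by measurable

text \<open>
  For \<open>a = (n + 1)/2\<close> these are the weights with which the Gaussians \<open>exp (-u|y|\<^sup>2)\<close> make up the density
  of \<open>\<nu>\<close>.
\<close>

definition subordinator :: "real \<Rightarrow> real \<Rightarrow> real" where
  "subordinator a u = indicator {0<..} u * (pi powr (- a) * u powr (a - 1) * exp (- u))"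

lemma subordinator_nonneg: "subordinator a u \<ge> 0"
  by (simp add: subordinator_def)

lemma subordinator_measurable [measurable]: "subordinator a \<in> borel_measurable borel"
  unfolding subordinator_def[abs_def] by measurable

lemma nu_density_mixture:
  fixes y :: "real ^ 'n"
  shows "has_bochner_integral lborel (\<lambda>u. subordinator ((real CARD('n) + 1) / 2) u * exp (- u * (norm y)\<^sup>2)) (nu_density y)"
proof -
  define a where "a = (real CARD('n) + 1) / 2"
  have a: "a > 0" by (simp add: a_def)
  have s: "1 + (norm y)\<^sup>2 > 0" by (simp add: add_pos_nonneg)
  have "has_bochner_integral lborel (\<lambda>u. pi powr (- a) * (indicator {0<..} u * (u powr (a - 1) * exp (- (1 + (norm y)\<^sup>2) * u))))
     (pi powr (- a) * (Gamma a / (1 + (norm y)\<^sup>2) powr a))"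
    by (intro has_bochner_integral_mult_right gamma_integral_scaled a s)
  moreover have "pi powr (- a) * (indicator {0<..} u * (u powr (a - 1) * exp (- (1 + (norm y)\<^sup>2) * u))) = subordinator a u * exp (- u * (norm y)\<^sup>2)" for u
    by (simp add: subordinator_def algebra_simps exp_add[symmetric])
  moreover have "pi powr (- a) * (Gamma a / (1 + (norm y)\<^sup>2) powr a) = nu_density y"
    using Gamma_real_pos[OF a] by (simp add: nu_density_def sphere_area_def flip: a_def) (simp add: powr_minus field_simps)
  ultimately show ?thesis by (simp add: a_def)
qed

text \<open>
  The powers of \<open>\<pi>\<close> and of \<open>u\<close> in the weight and in the Gaussian integral combine so that the dimension
  drops out of the result.
\<close>

lemma subordinator_gaussian:
  fixes \<xi> :: "real ^ 'n"
  defines "a \<equiv> (real CARD('n) + 1) / 2"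
  shows "integrable lborel (\<lambda>y. of_real (subordinator a u * exp (- u * (norm y)\<^sup>2)) * cis (\<xi> \<bullet> y))"
    and "(\<integral>y. of_real (subordinator a u * exp (- u * (norm y)\<^sup>2)) * cis (\<xi> \<bullet> y) \<partial>lborel) =
      of_real (1 / sqrt pi * (indicator {0<..} u * (u powr (- 1 / 2) * exp (- u - (norm \<xi>)\<^sup>2 / (4 * u)))))"
proof -
  show "integrable lborel (\<lambda>y. of_real (subordinator a u * exp (- u * (norm y)\<^sup>2)) * cis (\<xi> \<bullet> y))"
  proof (cases "u > 0")
    case True
    have "integrable lborel (\<lambda>y. of_real (subordinator a u) * (of_real (exp (- u * (norm y)\<^sup>2)) * cis (\<xi> \<bullet> y)))"
      by (intro integrable_mult_right gaussian_fourier_vec True)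
    then show ?thesis by (simp add: mult.assoc)
  qed (simp add: subordinator_def)
  show "(\<integral>y. of_real (subordinator a u * exp (- u * (norm y)\<^sup>2)) * cis (\<xi> \<bullet> y) \<partial>lborel) =
      of_real (1 / sqrt pi * (indicator {0<..} u * (u powr (- 1 / 2) * exp (- u - (norm \<xi>)\<^sup>2 / (4 * u)))))"
  proof (cases "u > 0")
    case True
    have "(\<integral>y. of_real (subordinator a u * exp (- u * (norm y)\<^sup>2)) * cis (\<xi> \<bullet> y) \<partial>lborel) =
      of_real (subordinator a u) * (\<integral>y. of_real (exp (- u * (norm y)\<^sup>2)) * cis (\<xi> \<bullet> y) \<partial>lborel)"
      by (subst integral_mult_right_zero[symmetric]) (simp add: mult.assoc)
    also have "\<dots> = of_real (subordinator a u * ((pi / u) powr (real CARD('n) / 2) * exp (- (norm \<xi>)\<^sup>2 / (4 * u))))"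
      unfolding gaussian_fourier_vec(2)[OF True] by simp
    also have "subordinator a u * ((pi / u) powr (real CARD('n) / 2) * exp (- (norm \<xi>)\<^sup>2 / (4 * u)))
      = (pi powr (- a) * pi powr (real CARD('n) / 2)) * (u powr (a - 1) * u powr (- (real CARD('n) / 2))) * (exp (- u) * exp (- (norm \<xi>)\<^sup>2 / (4 * u)))"
      using True by (simp add: subordinator_def powr_divide powr_minus field_simps)
    also have "pi powr (- a) * pi powr (real CARD('n) / 2) = 1 / sqrt pi"
      unfolding powr_add[symmetric] by (simp add: a_def powr_half_sqrt[symmetric] powr_minus_divide[symmetric] field_simps)
    also have "u powr (a - 1) * u powr (- (real CARD('n) / 2)) = u powr (- 1 / 2)"
      unfolding powr_add[symmetric] by (simp add: a_def field_simps)
    also have "exp (- u) * exp (- (norm \<xi>)\<^sup>2 / (4 * u)) = exp (- u - (norm \<xi>)\<^sup>2 / (4 * u))"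
      by (simp add: exp_add[symmetric])
    finally show ?thesis using True by simp
  qed (simp add: subordinator_def)
qed

text \<open>The Gaussian mixture turns the Fourier transform of the density into the subordination integral.\<close>

lemma nu_density_fourier:
  fixes \<xi> :: "real ^ 'n"
  shows "integrable lborel (\<lambda>y. of_real (nu_density y) * cis (\<xi> \<bullet> y))"
    and "(\<integral>y. of_real (nu_density y) * cis (\<xi> \<bullet> y) \<partial>lborel) = of_real (exp (- norm \<xi>))"
proof -
  define a where "a = (real CARD('n) + 1) / 2"
  let ?F = "\<lambda>u y. complex_of_real (subordinator a u * exp (- u * (norm y)\<^sup>2)) * cis (\<xi> \<bullet> y)"
  have int: "integrable (lborel \<Otimes>\<^sub>M lborel) (\<lambda>(u, y). ?F u y)"
  proof (rule lborel_pair.Fubini_integrable)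
    have [measurable]: "(\<lambda>y. cis (\<xi> \<bullet> y)) \<in> borel_measurable borel"
      unfolding cis_conv_exp by (intro borel_measurable_continuous_onI continuous_intros)
    show "(\<lambda>(u, y). ?F u y) \<in> borel_measurable (lborel \<Otimes>\<^sub>M lborel)" by measurable
    have norm: "norm (?F u y) = Re (of_real (subordinator a u * exp (- u * (norm y)\<^sup>2)) * cis (0 \<bullet> y))" for u y
      by (simp add: norm_mult subordinator_nonneg)
    have "(\<integral>y. norm (?F u y) \<partial>lborel) =
        1 / sqrt pi * (indicator {0<..} u * (u powr (- 1 / 2) * exp (- u - (norm (0 :: real ^ 'n))\<^sup>2 / (4 * u))))" for u
      unfolding norm unfolding a_def integral_Re[OF subordinator_gaussian(1)] subordinator_gaussian(2) Re_complex_of_real ..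
    moreover have "integrable lborel (\<lambda>u. 1 / sqrt pi * (indicator {0<..} u * (u powr (- 1 / 2) * exp (- u - 0\<^sup>2 / (4 * u)))))"
      using subordination[of 0] by (intro integrable_mult_right) (auto simp: has_bochner_integral_iff)
    ultimately show "integrable lborel (\<lambda>u. \<integral>y. norm (case (u, y) of (u, y) \<Rightarrow> ?F u y) \<partial>lborel)"
      by simp
    show "AE u in lborel. integrable lborel (\<lambda>y. case (u, y) of (u, y) \<Rightarrow> ?F u y)"
      using subordinator_gaussian(1)[of _ \<xi>] by (simp add: a_def)
  qed
  have inner: "(\<integral>u. ?F u y \<partial>lborel) = of_real (nu_density y) * cis (\<xi> \<bullet> y)" for y
  proof -
    have "has_bochner_integral lborel (\<lambda>u. ?F u y) (of_real (nu_density y) * cis (\<xi> \<bullet> y))"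
      unfolding a_def by (intro has_bochner_integral_mult_left has_bochner_integral_of_real nu_density_mixture)
    then show ?thesis by (simp add: has_bochner_integral_iff)
  qed
  show "integrable lborel (\<lambda>y. of_real (nu_density y) * cis (\<xi> \<bullet> y))"
    using lborel_pair.integrable_snd[OF int] unfolding inner .
  have "(\<integral>y. of_real (nu_density y) * cis (\<xi> \<bullet> y) \<partial>lborel) = (\<integral>u. (\<integral>y. ?F u y \<partial>lborel) \<partial>lborel)"
    using lborel_pair.Fubini_integral[OF int] unfolding inner .
  also have "\<dots> = (\<integral>u. of_real (1 / sqrt pi * (indicator {0<..} u * (u powr (- 1 / 2) * exp (- u - (norm \<xi>)\<^sup>2 / (4 * u))))) \<partial>lborel)"
    unfolding a_def subordinator_gaussian(2) ..
  also have "\<dots> = of_real (1 / sqrt pi * (sqrt pi * exp (- norm \<xi>)))"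
  proof -
    have "has_bochner_integral lborel (\<lambda>u. 1 / sqrt pi * (indicator {0<..} u * (u powr (- 1 / 2) * exp (- u - (norm \<xi>)\<^sup>2 / (4 * u)))))
        (1 / sqrt pi * (sqrt pi * exp (- norm \<xi>)))"
      by (rule has_bochner_integral_mult_right, rule subordination) simp
    from has_bochner_integral_of_real[OF this, where 'a = complex] show ?thesis
      by (simp only: has_bochner_integral_iff)
  qed
  finally show "(\<integral>y. of_real (nu_density y) * cis (\<xi> \<bullet> y) \<partial>lborel) = of_real (exp (- norm \<xi>))"
    by simp
qed

lemma nu_density_integrable: "integrable lborel nu_density" and nu_density_integral: "integral\<^sup>L lborel nu_density = 1"
proof -
  note 0 = nu_density_fourier[of 0]
  show "integrable lborel nu_density" using integrable_Re[OF 0(1)] by simp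
  show "integral\<^sup>L lborel nu_density = 1" using integral_Re[OF 0(1)] 0(2) by simp
qed

lemma prob_space_nu: "prob_space (nu_measure :: (real ^ 'n) measure)"
proof (rule prob_spaceI)
  have "emeasure (nu_measure :: (real ^ 'n) measure) (space nu_measure) = (\<integral>\<^sup>+ y. ennreal (nu_density (y :: real ^ 'n)) \<partial>lborel)"
    unfolding nu_measure_eq by (subst emeasure_density) auto
  also have "\<dots> = ennreal (integral\<^sup>L lborel (nu_density :: real ^ 'n \<Rightarrow> real))"
    by (intro nn_integral_eq_integral nu_density_integrable) (simp add: nu_density_pos less_imp_le)
  finally show "emeasure (nu_measure :: (real ^ 'n) measure) (space nu_measure) = 1" by (simp add: nu_density_integral)
qed

lemma integrable_cmult_iff:
  fixes f :: "'a \<Rightarrow> complex"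
  assumes c: "c \<noteq> 0"
  shows "integrable M (\<lambda>x. c * f x) \<longleftrightarrow> integrable M f"
proof
  assume "integrable M (\<lambda>x. c * f x)"
  then have "integrable M (\<lambda>x. inverse c * (c * f x))" by (rule integrable_mult_right)
  then show "integrable M f" using c by (simp add: mult.assoc[symmetric])
qed (rule integrable_mult_right)

lemma lborel_affine_vec:
  fixes F :: "'a::euclidean_space \<Rightarrow> complex"
  assumes c: "c \<noteq> 0" and F: "F \<in> borel_measurable borel"
  shows "integrable lborel (\<lambda>x. F (a + c *\<^sub>R x)) \<longleftrightarrow> integrable lborel F"
    and "(\<integral>x. F x \<partial>lborel) = \<bar>c\<bar> ^ DIM('a) *\<^sub>R (\<integral>x. F (a + c *\<^sub>R x) \<partial>lborel)"
proof -
  have T: "(\<lambda>x. a + c *\<^sub>R x) \<in> lborel \<rightarrow>\<^sub>M borel" by measurable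
  note eq = lborel_affine[OF c, of a]
  have "integrable lborel F \<longleftrightarrow> integrable (distr lborel borel (\<lambda>x. a + c *\<^sub>R x)) (\<lambda>x. \<bar>c\<bar> ^ DIM('a) *\<^sub>R F x)"
    by (subst eq, subst integrable_density) (use F in auto)
  also have "\<dots> \<longleftrightarrow> integrable lborel (\<lambda>x. F (a + c *\<^sub>R x))"
  proof -
    have "integrable (distr lborel borel (\<lambda>x. a + c *\<^sub>R x)) (\<lambda>x. \<bar>c\<bar> ^ DIM('a) *\<^sub>R F x)
        \<longleftrightarrow> integrable lborel (\<lambda>x. \<bar>c\<bar> ^ DIM('a) *\<^sub>R F (a + c *\<^sub>R x))"
      using F T by (subst integrable_distr_eq) auto
    also have "\<dots> \<longleftrightarrow> integrable lborel (\<lambda>x. F (a + c *\<^sub>R x))"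
      using integrable_scaleR_right[of "inverse (\<bar>c\<bar> ^ DIM('a))" lborel "\<lambda>x. \<bar>c\<bar> ^ DIM('a) *\<^sub>R F (a + c *\<^sub>R x)"] c
      by auto
    finally show ?thesis .
  qed
  finally show "integrable lborel (\<lambda>x. F (a + c *\<^sub>R x)) \<longleftrightarrow> integrable lborel F" ..
  have "(\<integral>x. F x \<partial>lborel) = (\<integral>x. \<bar>c\<bar> ^ DIM('a) *\<^sub>R F x \<partial>distr lborel borel (\<lambda>x. a + c *\<^sub>R x))"
    by (subst eq, subst integral_density) (use F in auto)
  also have "\<dots> = \<bar>c\<bar> ^ DIM('a) *\<^sub>R (\<integral>x. F (a + c *\<^sub>R x) \<partial>lborel)"
    using F T by (subst integral_distr) auto
  finally show "(\<integral>x. F x \<partial>lborel) = \<bar>c\<bar> ^ DIM('a) *\<^sub>R (\<integral>x. F (a + c *\<^sub>R x) \<partial>lborel)" .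
qed

lemma AE_lborel_affine:
  fixes a :: "'a::euclidean_space"
  assumes c: "c \<noteq> 0" and P: "AE x in lborel. P x"
  shows "AE x in lborel. P (a + c *\<^sub>R x)"
proof -
  have T: "(\<lambda>x. a + c *\<^sub>R x) \<in> lborel \<rightarrow>\<^sub>M borel" by measurable
  have "AE x in density (distr lborel borel (\<lambda>x. a + c *\<^sub>R x)) (\<lambda>_. \<bar>c\<bar> ^ DIM('a)). P x"
    using P by (subst (asm) lborel_affine[OF c, of a])
  then have "AE x in distr lborel borel (\<lambda>x. a + c *\<^sub>R x). P x"
    using c by (subst (asm) AE_density) auto
  from AE_distrD[OF T this] show ?thesis .
qed

section \<open>Fourier coefficients on the cube\<close>

lemma interval_character_integral:
  "has_bochner_integral lborel (\<lambda>x :: real. indicator {0..1} x *\<^sub>R cis (2 * pi * of_int k * x)) (if k = 0 then 1 else 0)"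
proof (cases "k = 0")
  case True
  have "has_bochner_integral lborel (\<lambda>x :: real. indicator {0..1} x *\<^sub>R (1 :: complex)) (of_real 1 - of_real 0)"
    by (rule has_bochner_integral_FTC_Icc) (auto intro!: derivative_eq_intros continuous_intros)
  with True show ?thesis by simp
next
  case False
  define a where "a = 2 * pi * of_int k * \<i>"
  have a: "a \<noteq> 0" using False by (simp add: a_def)
  have "has_bochner_integral lborel (\<lambda>x :: real. indicator {0..1} x *\<^sub>R exp (x *\<^sub>R a))
      (exp (1 *\<^sub>R a) * inverse a - exp (0 *\<^sub>R a) * inverse a)"
  proof (rule has_bochner_integral_FTC_Icc)
    fix x :: real
    have "((\<lambda>x. exp (x *\<^sub>R a) * inverse a) has_vector_derivative (exp (x *\<^sub>R a) * a) * inverse a) (at x within {0..1})"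
      by (rule has_vector_derivative_mult_left, rule exp_scaleR_has_vector_derivative_right)
    moreover have "(exp (x *\<^sub>R a) * a) * inverse a = exp (x *\<^sub>R a)"
      unfolding mult.assoc right_inverse[OF a] by (rule mult_1_right)
    ultimately show "((\<lambda>x. exp (x *\<^sub>R a) * inverse a) has_vector_derivative exp (x *\<^sub>R a)) (at x within {0..1})"
      by (simp only:)
  qed (auto intro!: continuous_intros)
  moreover have "exp (1 *\<^sub>R a) = 1"
    using exp_integer_2pi[of "of_int k"] by (simp add: a_def mult_ac)
  moreover have "exp (x *\<^sub>R a) = cis (2 * pi * of_int k * x)" for x
    by (simp add: a_def cis_conv_exp scaleR_conv_of_real mult_ac)
  ultimately show ?thesis using False by simp
qed

lemma indicator_cube: "indicator (cbox 0 1) x = (\<Prod>i\<in>UNIV. indicator {0..1} (x $ i :: real) :: real)"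
proof -
  have "x \<in> cbox 0 1 \<longleftrightarrow> (\<forall>i. x $ i \<in> {0..1})" by (auto simp: mem_box_cart)
  moreover have "(\<Prod>i\<in>UNIV. indicator {0..1} (x $ i) :: real) = (if \<forall>i. x $ i \<in> {0..1} then 1 else 0)"
    by (auto simp: indicator_def)
  ultimately show ?thesis by (simp add: indicator_def)
qed

lemma cube_character_integral:
  fixes m :: "int ^ 'n"
  shows "integrable lborel (\<lambda>x. indicator (cbox 0 1) x *\<^sub>R character m x)"
    and "(\<integral>x. indicator (cbox 0 1) x *\<^sub>R character m x \<partial>lborel) = (if m = 0 then 1 else 0)"
proof -
  let ?f = "\<lambda>i (x :: real). indicator {0..1} x *\<^sub>R cis (2 * pi * of_int (m $ i) * x)"
  have eq: "indicator (cbox 0 1) x *\<^sub>R character m x = (\<Prod>i\<in>UNIV. ?f i (x $ i))" for x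
  proof -
    have "character m x = (\<Prod>i\<in>UNIV. cis (2 * pi * of_int (m $ i) * x $ i))"
      unfolding character_def cis_conv_exp by (intro prod.cong) (simp_all add: mult_ac)
    then show ?thesis
      unfolding indicator_cube by (simp add: scaleR_conv_of_real prod.distrib)
  qed
  have f: "integrable lborel (?f i)" "integral\<^sup>L lborel (?f i) = (if m $ i = 0 then 1 else 0)" for i
    using interval_character_integral[of "m $ i"] by (simp_all add: has_bochner_integral_iff)
  show "integrable lborel (\<lambda>x. indicator (cbox 0 1) x *\<^sub>R character m x)"
    unfolding eq by (intro integral_lborel_vec_prod f)
  have "(\<integral>x. indicator (cbox 0 1) x *\<^sub>R character m x \<partial>lborel) = (\<Prod>i\<in>UNIV. if m $ i = 0 then 1 else 0)"
    unfolding eq by (subst integral_lborel_vec_prod(2)[OF f(1)]) (simp only: f(2))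
  then show "(\<integral>x. indicator (cbox 0 1) x *\<^sub>R character m x \<partial>lborel) = (if m = 0 then 1 else 0)"
    by (auto simp: vec_eq_iff)
qed

lemma cube_volume:
  "has_bochner_integral lborel (indicator (cbox 0 1 :: (real ^ 'n) set) :: _ \<Rightarrow> real) 1"
proof -
  have eq: "Re (indicator (cbox 0 1) y *\<^sub>R character 0 y) = indicator (cbox 0 1) y" for y :: "real ^ 'n"
    by (simp add: character_zero)
  note c = cube_character_integral[of "0 :: int ^ 'n"]
  from integrable_Re[OF c(1)] integral_Re[OF c(1)] c(2) show ?thesis
    unfolding eq has_bochner_integral_iff by (simp only: refl if_True one_complex.sel simp_thms)
qed

text \<open>
  The two sides differ by the integral of \<open>g\<close> against the difference of the indicators of two translates
  of the cube, and all Fourier coefficients of this difference vanish.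
\<close>

lemma cube_integral_shift:
  fixes g :: "real ^ 'n \<Rightarrow> complex"
  assumes g [measurable]: "g \<in> borel_measurable borel" and per: "\<And>x i. g (x + axis i 1) = g x"
    and bound: "\<And>x. norm (g x) \<le> C"
  shows "(\<integral>x. indicator (cbox 0 1) x *\<^sub>R g (x + a) \<partial>lborel) = (\<integral>x. indicator (cbox 0 1) x *\<^sub>R g x \<partial>lborel)"
proof -
  let ?I = "\<lambda>x :: real ^ 'n. complex_of_real (indicator (cbox 0 1) x)"
  let ?K = "\<lambda>x. ?I (x - a) - ?I x"
  have shift: "(\<integral>x. F (x - a) \<partial>lborel) = (\<integral>x. F x \<partial>lborel)" "integrable lborel (\<lambda>x. F (x - a)) \<longleftrightarrow> integrable lborel F"
    if "F \<in> borel_measurable borel" for F :: "real ^ 'n \<Rightarrow> complex"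
    using lborel_affine_vec[of 1 F "- a"] that by simp_all
  have I: "integrable lborel ?I" using cube_character_integral(1)[of 0] by (simp add: character_zero scaleR_conv_of_real)
  have Ia: "integrable lborel (\<lambda>x. ?I (x - a))" using I by (subst shift(2)) auto
  have split: "(\<integral>x. ?K x * h x \<partial>lborel) = (\<integral>x. indicator (cbox 0 1) x *\<^sub>R h (x + a) \<partial>lborel) - (\<integral>x. indicator (cbox 0 1) x *\<^sub>R h x \<partial>lborel)"
    if h [measurable]: "h \<in> borel_measurable borel" and D: "\<And>x. norm (h x) \<le> D" for h D
  proof -
    have "(\<integral>x. ?K x * h x \<partial>lborel) = (\<integral>x. ?I (x - a) * h (x - a + a) \<partial>lborel) - (\<integral>x. ?I x * h x \<partial>lborel)"
      using integrable_mult_bounded[OF I, of h D] integrable_mult_bounded[OF Ia, of h D] D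
      by (subst Bochner_Integration.integral_diff[symmetric]) (auto simp: left_diff_distrib)
    also have "(\<integral>x. ?I (x - a) * h (x - a + a) \<partial>lborel) = (\<integral>x. ?I x * h (x + a) \<partial>lborel)"
      by (rule shift(1)[of "\<lambda>x. ?I x * h (x + a)"]) measurable
    finally show ?thesis by (simp add: scaleR_conv_of_real)
  qed
  have "(\<integral>x. ?K x * g x \<partial>lborel) = 0"
  proof (rule fourier_uniqueness[OF _ _ g per])
    show "integrable lborel ?K" using I Ia by auto
    show "(\<integral>x. ?K x * character m x \<partial>lborel) = 0" for m
    proof -
      have "(\<integral>x. ?K x * character m x \<partial>lborel) = (\<integral>x. indicator (cbox 0 1) x *\<^sub>R character m (x + a) \<partial>lborel) - (\<integral>x. indicator (cbox 0 1) x *\<^sub>R character m x \<partial>lborel)"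
        by (rule split[of _ 1]) auto
      also have "(\<integral>x. indicator (cbox 0 1) x *\<^sub>R character m (x + a) \<partial>lborel) = (\<integral>x. (indicator (cbox 0 1) x *\<^sub>R character m x) * character m a \<partial>lborel)"
        by (simp add: character_plus)
      also have "\<dots> = (\<integral>x. indicator (cbox 0 1) x *\<^sub>R character m x \<partial>lborel) * character m a"
        by (rule integral_mult_left_zero)
      finally show ?thesis by (auto simp: cube_character_integral(2) character_zero)
    qed
    show "AE x in lborel. norm (g x) \<le> C" using bound by simp
  qed
  with split[OF g bound] show ?thesis by simp
qed

section \<open>The Poisson kernel\<close>

definition poisson_coeff :: "real \<Rightarrow> int ^ 'n \<Rightarrow> real" where
  "poisson_coeff t m = exp (- 2 * pi * t * norm (\<chi> i. real_of_int (m $ i)))"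

lemma summable_exp_abs_int:
  fixes c :: real
  assumes c: "c > 0"
  shows "(\<lambda>k :: int. exp (- c * \<bar>of_int k\<bar>)) summable_on UNIV"
proof -
  let ?f = "\<lambda>k :: int. exp (- c * \<bar>of_int k\<bar>)"
  have "summable (\<lambda>n. exp (- c) ^ n)" using c by (intro summable_geometric) auto
  moreover have "exp (- c) ^ n = exp (- c * real n)" for n by (simp add: exp_of_nat_mult[symmetric] mult.commute)
  ultimately have "(\<lambda>n. exp (- c * real n)) summable_on UNIV"
    by (subst summable_on_UNIV_nonneg_real_iff) auto
  then have "?f summable_on range int" "?f summable_on range (\<lambda>n. - int n)"
    by (subst summable_on_reindex; simp add: inj_on_def o_def)+
  moreover have "(UNIV :: int set) = range int \<union> (range (\<lambda>n. - int n) - range int)"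
    by (auto simp: image_iff) (metis int_cases2 add.inverse_inverse)
  ultimately show ?thesis
    by (metis Diff_disjoint Diff_subset summable_on_Un_disjoint summable_on_subset_banach)
qed

text \<open>
  The Euclidean norm is at least the mean of the absolute values of the coordinates, so the coefficients
  are dominated by a product of geometric series, one for each coordinate.
\<close>

lemma summable_poisson_coeff:
  assumes t: "t > 0"
  shows "(poisson_coeff t :: int ^ 'n \<Rightarrow> real) summable_on UNIV"
proof -
  define c where "c = 2 * pi * t / real CARD('n)"
  have c: "c > 0" using t by (simp add: c_def)
  have "Infinite_Set_Sum.abs_summable_on (\<lambda>k :: int. exp (- c * \<bar>of_int k\<bar>)) UNIV"
    unfolding abs_summable_equivalent[symmetric] using summable_exp_abs_int[OF c] by simp
  then have "Infinite_Set_Sum.abs_summable_on (\<lambda>g. \<Prod>i\<in>UNIV. exp (- c * \<bar>of_int (g i :: int)\<bar>)) (PiE (UNIV :: 'n set) (\<lambda>_. UNIV))"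
    by (intro abs_summable_on_prod_PiE) auto
  then have "(\<lambda>g. \<Prod>i\<in>UNIV. exp (- c * \<bar>of_int (g i :: int)\<bar>)) summable_on (UNIV :: ('n \<Rightarrow> int) set)"
    unfolding abs_summable_equivalent[symmetric] by (simp add: PiE_UNIV_domain abs_prod)
  moreover have "bij (vec_nth :: int ^ 'n \<Rightarrow> _)" by (metis bij_betw_def inj_on_def surj_def vec_lambda_beta vec_nth_inject ext)
  ultimately have 1: "(\<lambda>m :: int ^ 'n. \<Prod>i\<in>UNIV. exp (- c * \<bar>of_int (m $ i)\<bar>)) summable_on UNIV"
    by (subst summable_on_reindex_bij_betw[of vec_nth]) auto
  have bound: "poisson_coeff t m \<le> (\<Prod>i\<in>UNIV. exp (- c * \<bar>of_int (m $ i)\<bar>))" for m :: "int ^ 'n"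
  proof -
    let ?v = "\<chi> i. real_of_int (m $ i)"
    have "(\<Sum>i\<in>UNIV. \<bar>?v $ i\<bar>) \<le> (\<Sum>i\<in>(UNIV :: 'n set). norm ?v)"
      by (intro sum_mono component_le_norm_cart)
    then have "c * (\<Sum>i\<in>UNIV. \<bar>of_int (m $ i)\<bar>) \<le> c * (real CARD('n) * norm ?v)"
      using c by (intro mult_left_mono) auto
    also have "\<dots> = 2 * pi * t * norm ?v" by (simp add: c_def)
    finally show ?thesis
      by (simp add: poisson_coeff_def exp_sum[symmetric] sum_distrib_left sum_negf)
  qed
  show ?thesis
    by (rule summable_on_comparison_test[OF 1]) (use bound in \<open>auto simp: poisson_coeff_def\<close>)
qed

lemma poisson_kernel_uniform_limit:
  assumes t: "t > 0"
  shows "uniform_limit UNIV (\<lambda>A y. \<Sum>m\<in>A. of_real (poisson_coeff t m) * character m y) (poisson_kernel t)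
    (finite_subsets_at_top (UNIV :: (int ^ 'n) set))"
proof -
  have "uniform_limit UNIV (\<lambda>A y. \<Sum>m\<in>A. of_real (poisson_coeff t m) * character m y)
     (\<lambda>y. \<Sum>\<^sub>\<infinity>m\<in>UNIV. of_real (poisson_coeff t m) * character m y) (finite_subsets_at_top (UNIV :: (int ^ 'n) set))"
    by (rule Weierstrass_m_test_general[OF _ summable_poisson_coeff[OF t]]) (simp add: norm_mult poisson_coeff_def)
  then show ?thesis
    by (simp add: poisson_kernel_def[abs_def] poisson_coeff_def)
qed

lemma continuous_poisson_kernel:
  assumes t: "t > 0"
  shows "continuous_on UNIV (poisson_kernel t)"
  by (rule uniform_limit_theorem[OF _ poisson_kernel_uniform_limit[OF t]])
     (auto intro!: always_eventually continuous_intros)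

lemma poisson_kernel_measurable:
  "t > 0 \<Longrightarrow> poisson_kernel t \<in> borel_measurable borel"
  by (intro borel_measurable_continuous_onI continuous_poisson_kernel)

lemma cube_integrable_continuous:
  fixes f :: "real ^ 'n \<Rightarrow> complex"
  assumes "continuous_on UNIV f"
  shows "integrable lborel (\<lambda>x. indicator (cbox 0 1) x *\<^sub>R f x)"
  using assms by (intro borel_integrable_compact) (auto intro: continuous_on_subset)

text \<open>
  The series converges uniformly, so it can be integrated term by term.  The integrals of the finite
  partial sums are eventually constant along the net of finite sets.
\<close>

lemma poisson_kernel_fourier:
  fixes k :: "int ^ 'n"
  assumes t: "t > 0"
  shows "(\<integral>y. indicator (cbox 0 1) y *\<^sub>R (poisson_kernel t y * character k y) \<partial>lborel) = of_real (poisson_coeff t k)"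
proof (rule tendsto_unique[OF finite_subsets_at_top_neq_bot])
  let ?p = "\<lambda>A y. \<Sum>m\<in>A. of_real (poisson_coeff t m) * character m y"
  let ?I = "\<lambda>f. \<integral>y. indicator (cbox 0 1) y *\<^sub>R (f y * character k y) \<partial>lborel"
  have neg: "poisson_coeff t (- k) = poisson_coeff t k"
  proof -
    have "(\<chi> i. real_of_int ((- k) $ i)) = - (\<chi> i. real_of_int (k $ i))" by (simp add: vec_eq_iff)
    then show ?thesis unfolding poisson_coeff_def by (metis norm_minus_cancel)
  qed
  show "((\<lambda>A. ?I (?p A)) \<longlongrightarrow> of_real (poisson_coeff t k)) (finite_subsets_at_top UNIV)"
  proof (rule tendsto_eventually, rule eventually_finite_subsets_at_top[THEN iffD2], intro exI[of _ "{- k}"] conjI allI impI)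
    fix A :: "(int ^ 'n) set" assume "finite A \<and> {- k} \<subseteq> A \<and> A \<subseteq> UNIV"
    then have A: "finite A" "- k \<in> A" by auto
    have "?I (?p A) = (\<integral>y. (\<Sum>m\<in>A. of_real (poisson_coeff t m) * (indicator (cbox 0 1) y *\<^sub>R character (m + k) y)) \<partial>lborel)"
      by (simp add: sum_distrib_right sum_distrib_left scaleR_sum_right character_add mult_ac)
    also have "\<dots> = (\<Sum>m\<in>A. of_real (poisson_coeff t m) * (\<integral>y. indicator (cbox 0 1) y *\<^sub>R character (m + k) y \<partial>lborel))"
      by (subst Bochner_Integration.integral_sum) (intro integrable_mult_right cube_character_integral, simp only: integral_mult_right_zero)
    also have "\<dots> = (\<Sum>m\<in>A. if m = - k then of_real (poisson_coeff t m) else 0)"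
      by (intro sum.cong) (auto simp: cube_character_integral(2) add_eq_0_iff2)
    also have "\<dots> = of_real (poisson_coeff t k)" using A neg by simp
    finally show "?I (?p A) = of_real (poisson_coeff t k)" .
  qed auto
  show "((\<lambda>A. ?I (?p A)) \<longlongrightarrow> ?I (poisson_kernel t)) (finite_subsets_at_top UNIV)"
  proof (rule tendstoI)
    fix e :: real assume e: "e > 0"
    have "\<forall>\<^sub>F A in finite_subsets_at_top (UNIV :: (int ^ 'n) set). \<forall>y\<in>UNIV. dist (?p A y) (poisson_kernel t y) < e / 2"
      using poisson_kernel_uniform_limit[OF t] e by (intro uniform_limitD) auto
    then show "\<forall>\<^sub>F A in finite_subsets_at_top UNIV. dist (?I (?p A)) (?I (poisson_kernel t)) < e"
    proof eventually_elim
      case (elim A)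
      have int: "integrable lborel (\<lambda>y. indicator (cbox 0 1) y *\<^sub>R (?p A y * character k y))"
        "integrable lborel (\<lambda>y. indicator (cbox 0 1) y *\<^sub>R (poisson_kernel t y * character k y))"
        by (intro cube_integrable_continuous continuous_intros continuous_poisson_kernel t)+
      have one: "(\<integral>y. indicator (cbox 0 1) (y :: real ^ 'n) \<partial>lborel) = (1 :: real)" "integrable lborel (indicator (cbox 0 1 :: (real ^ 'n) set) :: _ \<Rightarrow> real)"
        using cube_volume[where 'n = 'n] by (simp_all only: has_bochner_integral_iff)
      have "dist (?I (?p A)) (?I (poisson_kernel t)) = norm (\<integral>y. indicator (cbox 0 1) y *\<^sub>R (?p A y * character k y) - indicator (cbox 0 1) y *\<^sub>R (poisson_kernel t y * character k y) \<partial>lborel)"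
        using int by (simp add: dist_norm)
      also have "\<dots> \<le> (\<integral>y. norm (indicator (cbox 0 1) y *\<^sub>R (?p A y * character k y) - indicator (cbox 0 1) y *\<^sub>R (poisson_kernel t y * character k y)) \<partial>lborel)"
        by (rule integral_norm_bound)
      also have "\<dots> \<le> (\<integral>y. e / 2 * indicator (cbox 0 1) (y :: real ^ 'n) \<partial>lborel)"
      proof (rule integral_mono)
        show "norm (indicator (cbox 0 1) y *\<^sub>R (?p A y * character k y) - indicator (cbox 0 1) y *\<^sub>R (poisson_kernel t y * character k y)) \<le> e / 2 * indicator (cbox 0 1) y" for y
          using elim[rule_format, of y]
          by (auto simp: indicator_def dist_norm norm_mult left_diff_distrib[symmetric])
      qed (use int one in auto)
      also have "\<dots> = e / 2" using one by simp
      finally show ?case using e by linarith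
    qed
  qed
qed

text \<open>
  Poisson summation: the measure \<open>\<nu>\<close> dilated by \<open>t\<close> and the Poisson kernel on the cube have the
  same Fourier coefficients.
\<close>

lemma poisson_integral_eq:
  fixes g :: "real ^ 'n \<Rightarrow> complex"
  assumes t: "t > 0" and g [measurable]: "g \<in> borel_measurable borel" and per: "\<And>x i. g (x + axis i 1) = g x"
    and bound: "AE x in lborel. norm (g x) \<le> C"
  shows "(LINT y|nu_measure. g (t *\<^sub>R y)) = (LINT y:cbox 0 1|lborel. poisson_kernel t y * g y)"
proof -
  note [measurable] = poisson_kernel_measurable[OF t]
  \<comment> \<open>The density of the dilated measure and the kernel restricted to the cube.\<close>
  let ?d = "\<lambda>z :: real ^ 'n. complex_of_real (t powr - real CARD('n) * nu_density ((1 / t) *\<^sub>R z))"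
  let ?q = "\<lambda>z :: real ^ 'n. indicator (cbox 0 1) z *\<^sub>R poisson_kernel t z"
  let ?K = "\<lambda>z. ?d z - ?q z"
  have scale: "(\<integral>z. ?d z * h z \<partial>lborel) = (\<integral>y. of_real (nu_density y) * h (t *\<^sub>R y) \<partial>lborel)"
    "integrable lborel (\<lambda>z. ?d z * h z) \<longleftrightarrow> integrable lborel (\<lambda>y. of_real (nu_density y) * h (t *\<^sub>R y))"
    if [measurable]: "h \<in> borel_measurable borel" for h
  proof -
    have 1: "?d (0 + t *\<^sub>R y) * h (0 + t *\<^sub>R y) = of_real (t powr - real CARD('n)) * (of_real (nu_density y) * h (t *\<^sub>R y))" for y
      using t by simp
    have 2: "t ^ CARD('n) * t powr - real CARD('n) = 1"
      using t by (simp add: powr_minus powr_realpow)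
    have meas: "(\<lambda>z. ?d z * h z) \<in> borel_measurable borel" by measurable
    show "(\<integral>z. ?d z * h z \<partial>lborel) = (\<integral>y. of_real (nu_density y) * h (t *\<^sub>R y) \<partial>lborel)"
    proof -
      have scalar: "t ^ CARD('n) *\<^sub>R (of_real (t powr - real CARD('n)) * X) = X" for X :: complex
        using arg_cong[OF 2, of "\<lambda>r. of_real r * X"] by (simp add: scaleR_conv_of_real)
      have "(\<integral>z. ?d z * h z \<partial>lborel) = \<bar>t\<bar> ^ DIM(real ^ 'n) *\<^sub>R (\<integral>y. ?d (0 + t *\<^sub>R y) * h (0 + t *\<^sub>R y) \<partial>lborel)"
        using t by (intro lborel_affine_vec(2)[OF _ meas]) simp
      also have "\<bar>t\<bar> ^ DIM(real ^ 'n) = t ^ CARD('n)" using t by simp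
      finally show ?thesis unfolding 1 integral_mult_right_zero scalar .
    qed
    show "integrable lborel (\<lambda>z. ?d z * h z) \<longleftrightarrow> integrable lborel (\<lambda>y. of_real (nu_density y) * h (t *\<^sub>R y))"
    proof -
      have c: "complex_of_real (t powr - real CARD('n)) \<noteq> 0" using t by simp
      have "integrable lborel (\<lambda>y. ?d (0 + t *\<^sub>R y) * h (0 + t *\<^sub>R y)) \<longleftrightarrow> integrable lborel (\<lambda>z. ?d z * h z)"
        using t by (intro lborel_affine_vec(1)[OF _ meas]) simp
      then show ?thesis unfolding 1 integrable_cmult_iff[OF c] ..
    qed
  qed
  have d_int: "integrable lborel ?d"
    using scale(2)[of "\<lambda>_. 1"] integrable_of_real[OF nu_density_integrable] by simp
  have q_int: "integrable lborel ?q"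
    by (intro cube_integrable_continuous continuous_poisson_kernel t)
  have K_int: "integrable lborel ?K" using d_int q_int by (rule Bochner_Integration.integrable_diff)
  have split: "(\<integral>z. ?K z * h z \<partial>lborel) = (\<integral>y. of_real (nu_density y) * h (t *\<^sub>R y) \<partial>lborel) - (\<integral>z. ?q z * h z \<partial>lborel)"
    if h: "h \<in> borel_measurable borel" and B: "AE z in lborel. norm (h z) \<le> B" for h B
    unfolding left_diff_distrib scale(1)[OF h, symmetric]
    by (intro Bochner_Integration.integral_diff integrable_mult_bounded[OF d_int _ B] integrable_mult_bounded[OF q_int _ B]) (simp_all add: h)
  have "(\<integral>z. ?K z * g z \<partial>lborel) = 0"
  proof (rule fourier_uniqueness[OF K_int _ g per bound])
    fix m :: "int ^ 'n"
    let ?v = "\<chi> i. real_of_int (m $ i)"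
    have ch: "character m (t *\<^sub>R y) = cis (((2 * pi * t) *\<^sub>R ?v) \<bullet> y)" for y
      by (simp add: character_eq_cis inner_vec_def sum_distrib_left mult_ac)
    have "(\<integral>y. of_real (nu_density y) * character m (t *\<^sub>R y) \<partial>lborel) = of_real (poisson_coeff t m)"
      unfolding ch nu_density_fourier(2) using t by (simp add: poisson_coeff_def)
    moreover have "(\<integral>z. ?q z * character m z \<partial>lborel) = of_real (poisson_coeff t m)"
      using poisson_kernel_fourier[OF t, of m] by simp
    ultimately show "(\<integral>z. ?K z * character m z \<partial>lborel) = 0"
      by (subst split[of _ 1]) auto
  qed
  moreover have "(LINT y|nu_measure. g (t *\<^sub>R y)) = (\<integral>y. of_real (nu_density y) * g (t *\<^sub>R y) \<partial>lborel)"
  proof -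
    have "(\<lambda>y. g (t *\<^sub>R y)) \<in> borel_measurable lborel" by measurable
    moreover have "AE y in lborel. 0 \<le> nu_density (y :: real ^ 'n)"
      using nu_density_pos by (intro AE_I2 less_imp_le)
    ultimately show ?thesis
      unfolding nu_measure_eq by (subst integral_density) (simp_all add: scaleR_conv_of_real)
  qed
  ultimately show ?thesis
    using split[OF g bound] by (simp add: set_lebesgue_integral_def)
qed

section \<open>Weak* topologies\<close>

lemma topspace_weak_star_topology:
  assumes "predual A \<noteq> {}"
  shows "topspace (weak_star_topology A) = carrier A"
proof -
  obtain \<omega> where \<omega>: "\<omega> \<in> predual A" using assms by auto
  have "carrier A \<in> {{x \<in> carrier A. \<omega> x \<in> V} |\<omega> V. \<omega> \<in> predual A \<and> open V}"
    using \<omega> by (intro CollectI exI[of _ \<omega>] exI[of _ UNIV]) auto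
  then show ?thesis unfolding weak_star_topology_def topology_generated_by_topspace by auto
qed

lemma continuous_map_predual:
  assumes "\<omega> \<in> predual A"
  shows "continuous_map (weak_star_topology A) euclidean \<omega>"
proof -
  have top: "topspace (weak_star_topology A) = carrier A"
    using assms by (intro topspace_weak_star_topology) auto
  have "openin (weak_star_topology A) {x \<in> carrier A. \<omega> x \<in> V}" if "open V" for V
    unfolding weak_star_topology_def using assms that by (intro topology_generated_by_Basis) blast
  then show ?thesis unfolding continuous_map_def top by auto
qed

text \<open>
  A map with a preadjoint is normal: preimages of subbasic open sets are subbasic open.
\<close>

lemma normal_mapI:
  assumes A: "predual A \<noteq> {}" and B: "predual B \<noteq> {}" and \<Phi>: "\<Phi> \<in> carrier A \<rightarrow> carrier B"
    and dual: "\<And>\<omega>. \<omega> \<in> predual B \<Longrightarrow> \<exists>\<omega>'\<in>predual A. \<forall>x\<in>carrier A. \<omega> (\<Phi> x) = \<omega>' x"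
  shows "normal_map A B \<Phi>"
  unfolding normal_map_def weak_star_topology_def[of B]
proof (rule continuous_on_generated_topo)
  show "\<Phi> ` topspace (weak_star_topology A) \<subseteq> \<Union> {{x \<in> carrier B. \<omega> x \<in> V} |\<omega> V. \<omega> \<in> predual B \<and> open V}"
    using topspace_weak_star_topology[OF B] \<Phi>
    unfolding topspace_weak_star_topology[OF A] weak_star_topology_def topology_generated_by_topspace by auto
  fix U assume "U \<in> {{x \<in> carrier B. \<omega> x \<in> V} |\<omega> V. \<omega> \<in> predual B \<and> open V}"
  then obtain \<omega> V where U: "U = {x \<in> carrier B. \<omega> x \<in> V}" "\<omega> \<in> predual B" "open V" by auto
  from dual[OF U(2)] obtain \<omega>' where \<omega>': "\<omega>' \<in> predual A" "\<And>x. x \<in> carrier A \<Longrightarrow> \<omega> (\<Phi> x) = \<omega>' x" by auto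
  have "\<Phi> -` U \<inter> topspace (weak_star_topology A) = {x \<in> carrier A. \<omega>' x \<in> V}"
    unfolding topspace_weak_star_topology[OF A] U(1) using \<omega>'(2) \<Phi> by auto
  also have "openin (weak_star_topology A) \<dots>"
    unfolding weak_star_topology_def using \<omega>' U(3) by (intro topology_generated_by_Basis) blast
  finally show "openin (weak_star_topology A) (\<Phi> -` U \<inter> topspace (weak_star_topology A))" .
qed

text \<open>Finitely many functionals describe the basic weak* neighbourhoods.\<close>

lemma weak_star_closureI:
  assumes A: "predual A \<noteq> {}" and x: "x \<in> carrier A" and S: "S \<subseteq> carrier A"
    and approx: "\<And>W e. finite W \<Longrightarrow> W \<subseteq> predual A \<Longrightarrow> e > 0 \<Longrightarrow> \<exists>y\<in>S. \<forall>\<omega>\<in>W. norm (\<omega> y - \<omega> x) < (e :: real)"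
  shows "x \<in> (weak_star_topology A) closure_of S"
  unfolding in_closure_of topspace_weak_star_topology[OF A]
proof (intro conjI x allI impI)
  fix T assume "x \<in> T \<and> openin (weak_star_topology A) T"
  then have "generate_topology_on {{x \<in> carrier A. \<omega> x \<in> V} |\<omega> V. \<omega> \<in> predual A \<and> open V} T" and xT: "x \<in> T"
    unfolding weak_star_topology_def by (auto dest: openin_topology_generated_by)
  then have "\<exists>W e. finite W \<and> W \<subseteq> predual A \<and> e > 0 \<and> {y \<in> carrier A. \<forall>\<omega>\<in>W. norm (\<omega> y - \<omega> x) < (e :: real)} \<subseteq> T"
  proof (induction rule: generate_topology_on.induct)
    case (Int a b)
    then obtain W e W' e' where 1: "finite W" "W \<subseteq> predual A" "e > 0" "{y \<in> carrier A. \<forall>\<omega>\<in>W. norm (\<omega> y - \<omega> x) < (e :: real)} \<subseteq> a"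
      and 2: "finite W'" "W' \<subseteq> predual A" "e' > 0" "{y \<in> carrier A. \<forall>\<omega>\<in>W'. norm (\<omega> y - \<omega> x) < (e' :: real)} \<subseteq> b"
      by auto
    have "{y \<in> carrier A. \<forall>\<omega>\<in>W \<union> W'. norm (\<omega> y - \<omega> x) < min e e'} \<subseteq> a \<inter> b"
      using 1(4) 2(4) by auto
    with 1 2 show ?case by (intro exI[of _ "W \<union> W'"] exI[of _ "min e e'"]) auto
  next
    case (UN K)
    then obtain k where "k \<in> K" "x \<in> k" by auto
    with UN.IH[OF this] show ?case by blast
  next
    case (Basis s)
    then obtain \<omega> V where s: "s = {x \<in> carrier A. \<omega> x \<in> V}" "\<omega> \<in> predual A" "open V" by auto
    with Basis(2) obtain e where "e > 0" "\<And>z. dist z (\<omega> x) < e \<Longrightarrow> z \<in> V"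
      unfolding open_dist by auto
    with s show ?case by (intro exI[of _ "{\<omega>}"] exI[of _ e]) (auto simp: dist_norm)
  qed auto
  then obtain W e where W: "finite W" "W \<subseteq> predual A" "e > 0" "{y \<in> carrier A. \<forall>\<omega>\<in>W. norm (\<omega> y - \<omega> x) < (e :: real)} \<subseteq> T"
    by auto
  from approx[OF W(1-3)] W(4) S show "\<exists>y. y \<in> S \<and> y \<in> T" by blast
qed

section \<open>Calculus of classes\<close>

locale pointwise_domain =
  fixes X :: "'a function_domain"
  assumes invariant_const: "(\<lambda>_. c) \<in> invariant X"
    and invariant_combine: "f \<in> invariant X \<Longrightarrow> g \<in> invariant X \<Longrightarrow> (\<lambda>x. \<phi> (f x) (g x)) \<in> invariant X"
    and dom_sets: "dom X \<in> sets (meas X)"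
begin

lemma bounded_functionsI:
  "f \<in> borel_measurable (meas X) \<Longrightarrow> f \<in> invariant X \<Longrightarrow> AE x in meas X. norm (f x) \<le> C \<Longrightarrow> f \<in> bounded_functions X"
  by (auto simp: bounded_functions_def)

lemma bounded_functionsD:
  assumes "f \<in> bounded_functions X"
  shows "f \<in> borel_measurable (meas X)" "f \<in> invariant X" "\<exists>C. AE x in meas X. norm (f x) \<le> C"
  using assms by (auto simp: bounded_functions_def)

lemma bounded_const: "(\<lambda>_. c) \<in> bounded_functions X"
  by (rule bounded_functionsI[of _ "norm c"]) (auto intro: invariant_const)

lemma bounded_mult:
  assumes "f \<in> bounded_functions X" "g \<in> bounded_functions X"
  shows "(\<lambda>x. f x * g x) \<in> bounded_functions X"
proof -
  note [measurable] = assms[THEN bounded_functionsD(1)]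
  from assms[THEN bounded_functionsD(3)] obtain C D
    where "AE x in meas X. norm (f x) \<le> C" "AE x in meas X. norm (g x) \<le> D" by auto
  then have "AE x in meas X. norm (f x * g x) \<le> C * D"
  proof eventually_elim
    case (elim x)
    then show ?case
      unfolding norm_mult by (intro mult_mono) (auto intro: order_trans[OF norm_ge_zero])
  qed
  moreover have "(\<lambda>x. f x * g x) \<in> invariant X"
    using invariant_combine[OF assms[THEN bounded_functionsD(2)], of "(*)"] by simp
  ultimately show ?thesis by (intro bounded_functionsI) simp_all
qed

lemma bounded_add:
  assumes "f \<in> bounded_functions X" "g \<in> bounded_functions X"
  shows "(\<lambda>x. f x + g x) \<in> bounded_functions X"
proof -
  note [measurable] = assms[THEN bounded_functionsD(1)]
  from assms[THEN bounded_functionsD(3)] obtain C D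
    where "AE x in meas X. norm (f x) \<le> C" "AE x in meas X. norm (g x) \<le> D" by auto
  then have "AE x in meas X. norm (f x + g x) \<le> C + D"
    by eventually_elim (rule norm_triangle_mono)
  moreover have "(\<lambda>x. f x + g x) \<in> invariant X"
    using invariant_combine[OF assms[THEN bounded_functionsD(2)], of "(+)"] by simp
  ultimately show ?thesis by (intro bounded_functionsI) simp_all
qed

lemma bounded_scale: "f \<in> bounded_functions X \<Longrightarrow> (\<lambda>x. c * f x) \<in> bounded_functions X"
  by (rule bounded_mult[OF bounded_const])

lemma bounded_cnj:
  assumes "f \<in> bounded_functions X"
  shows "(\<lambda>x. cnj (f x)) \<in> bounded_functions X"
proof -
  have "(\<lambda>x. cnj (f x)) \<in> borel_measurable (meas X)"
    using bounded_functionsD(1)[OF assms] by (intro borel_measurable_continuous_on[of cnj] continuous_intros)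
  moreover obtain C where "AE x in meas X. norm (cnj (f x)) \<le> C"
    using bounded_functionsD(3)[OF assms] by auto
  ultimately show ?thesis
    using invariant_combine[OF bounded_functionsD(2)[OF assms] bounded_functionsD(2)[OF assms], of "\<lambda>x _. cnj x"]
    by (intro bounded_functionsI)
qed

lemma equiv_ae_rel: "equiv (bounded_functions X) (ae_rel X)"
proof (rule equivI)
  show "trans (ae_rel X)"
  proof (rule transI)
    fix f g h assume fg: "(f, g) \<in> ae_rel X" "(g, h) \<in> ae_rel X"
    then have "AE x in meas X. f x = g x" "AE x in meas X. g x = h x" by (auto simp: ae_rel_def)
    then have "AE x in meas X. f x = h x" by eventually_elim simp
    with fg show "(f, h) \<in> ae_rel X" by (auto simp: ae_rel_def)
  qed
  show "sym (ae_rel X)"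
    by (rule symI) (auto simp: ae_rel_def eq_commute)
qed (auto simp: ae_rel_def refl_on_def)

lemma ae_class_eq_iff:
  assumes "f \<in> bounded_functions X" "g \<in> bounded_functions X"
  shows "ae_class X f = ae_class X g \<longleftrightarrow> (AE x in meas X. f x = g x)"
  using assms by (subst eq_equiv_class_iff[OF equiv_ae_rel]) (auto simp: ae_rel_def)

lemma in_ae_class_iff:
  "f' \<in> ae_class X f \<longleftrightarrow> f \<in> bounded_functions X \<and> f' \<in> bounded_functions X \<and> (AE x in meas X. f x = f' x)"
  by (simp add: ae_rel_def)

lemma self_in_ae_class: "f \<in> bounded_functions X \<Longrightarrow> f \<in> ae_class X f"
  by (simp add: ae_rel_def)

text \<open>
  The operations on classes are unions over representatives; this lemma collapses such a union as soon
  as its members agree.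
\<close>

lemma UN_ae_class:
  assumes "f \<in> bounded_functions X"
    and "\<And>f'. f' \<in> bounded_functions X \<Longrightarrow> AE x in meas X. f x = f' x \<Longrightarrow> H f' = H f"
  shows "(\<Union>f'\<in>ae_class X f. H f') = H f"
proof -
  have "H f' = H f" if "f' \<in> ae_class X f" for f'
    using that assms(2) unfolding in_ae_class_iff by blast
  then show ?thesis by (intro UN_constant_eq[OF self_in_ae_class[OF assms(1)]] ballI)
qed

lemma carrier_Linfty: "carrier (Linfty X) = bounded_functions X // ae_rel X"
  by (simp add: Linfty_def)

lemma ae_class_in_carrier: "f \<in> bounded_functions X \<Longrightarrow> ae_class X f \<in> carrier (Linfty X)"
  unfolding carrier_Linfty by (rule quotientI)

lemma carrier_cases:
  assumes "F \<in> carrier (Linfty X)"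
  obtains f where "f \<in> bounded_functions X" "F = ae_class X f"
  using assms unfolding carrier_Linfty by (rule quotientE) auto

lemma UN_ae_class_pair:
  assumes f: "f \<in> bounded_functions X" and g: "g \<in> bounded_functions X"
    and bounded: "\<And>f g. f \<in> bounded_functions X \<Longrightarrow> g \<in> bounded_functions X \<Longrightarrow> (\<lambda>x. \<phi> (f x) (g x)) \<in> bounded_functions X"
  shows "(\<Union>f'\<in>ae_class X f. \<Union>g'\<in>ae_class X g. ae_class X (\<lambda>x. \<phi> (f' x) (g' x))) = ae_class X (\<lambda>x. \<phi> (f x) (g x))"
proof -
  have "(\<Union>f'\<in>ae_class X f. \<Union>g'\<in>ae_class X g. ae_class X (\<lambda>x. \<phi> (f' x) (g' x))) = (\<Union>g'\<in>ae_class X g. ae_class X (\<lambda>x. \<phi> (f x) (g' x)))"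
  proof (rule UN_ae_class[OF f])
    fix f' assume f': "f' \<in> bounded_functions X" "AE x in meas X. f x = f' x"
    show "(\<Union>g'\<in>ae_class X g. ae_class X (\<lambda>x. \<phi> (f' x) (g' x))) = (\<Union>g'\<in>ae_class X g. ae_class X (\<lambda>x. \<phi> (f x) (g' x)))"
    proof (rule SUP_cong)
      fix g' assume "g' \<in> ae_class X g"
      then have g': "g' \<in> bounded_functions X" by (simp add: ae_rel_def)
      show "ae_class X (\<lambda>x. \<phi> (f' x) (g' x)) = ae_class X (\<lambda>x. \<phi> (f x) (g' x))"
        using f'(2) by (subst ae_class_eq_iff[OF bounded[OF f'(1) g'] bounded[OF f g']]) (elim eventually_mono, simp)
    qed simp
  qed
  also have "\<dots> = ae_class X (\<lambda>x. \<phi> (f x) (g x))"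
  proof (rule UN_ae_class[OF g])
    fix g' assume g': "g' \<in> bounded_functions X" "AE x in meas X. g x = g' x"
    show "ae_class X (\<lambda>x. \<phi> (f x) (g' x)) = ae_class X (\<lambda>x. \<phi> (f x) (g x))"
      using g'(2) by (subst ae_class_eq_iff[OF bounded[OF f g'(1)] bounded[OF f g]]) (elim eventually_mono, simp)
  qed
  finally show ?thesis .
qed

lemma mult_ae_class:
  assumes f: "f \<in> bounded_functions X" and g: "g \<in> bounded_functions X"
  shows "ae_class X f \<otimes>\<^bsub>Linfty X\<^esub> ae_class X g = ae_class X (\<lambda>x. f x * g x)"
  using UN_ae_class_pair[OF f g bounded_mult] by (simp add: Linfty_def)

lemma add_ae_class:
  assumes f: "f \<in> bounded_functions X" and g: "g \<in> bounded_functions X"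
  shows "ae_class X f \<oplus>\<^bsub>Linfty X\<^esub> ae_class X g = ae_class X (\<lambda>x. f x + g x)"
  using UN_ae_class_pair[OF f g bounded_add] by (simp add: Linfty_def)

lemma smult_ae_class:
  assumes f: "f \<in> bounded_functions X"
  shows "c \<odot>\<^bsub>Linfty X\<^esub> ae_class X f = ae_class X (\<lambda>x. c * f x)"
proof -
  have "(\<Union>f'\<in>ae_class X f. ae_class X (\<lambda>x. c * f' x)) = ae_class X (\<lambda>x. c * f x)"
  proof (rule UN_ae_class[OF f])
    fix f' assume f': "f' \<in> bounded_functions X" "AE x in meas X. f x = f' x"
    show "ae_class X (\<lambda>x. c * f' x) = ae_class X (\<lambda>x. c * f x)"
      using f'(2) by (subst ae_class_eq_iff[OF bounded_scale[OF f'(1)] bounded_scale[OF f]]) (elim eventually_mono, simp)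
  qed
  then show ?thesis by (simp add: Linfty_def)
qed

lemma adj_ae_class:
  assumes f: "f \<in> bounded_functions X"
  shows "adj (Linfty X) (ae_class X f) = ae_class X (\<lambda>x. cnj (f x))"
proof -
  have "(\<Union>f'\<in>ae_class X f. ae_class X (\<lambda>x. cnj (f' x))) = ae_class X (\<lambda>x. cnj (f x))"
  proof (rule UN_ae_class[OF f])
    fix f' assume f': "f' \<in> bounded_functions X" "AE x in meas X. f x = f' x"
    show "ae_class X (\<lambda>x. cnj (f' x)) = ae_class X (\<lambda>x. cnj (f x))"
      using f'(2) by (subst ae_class_eq_iff[OF bounded_cnj[OF f'(1)] bounded_cnj[OF f]]) (elim eventually_mono, simp)
  qed
  then show ?thesis by (simp add: Linfty_def)
qed

lemma one_Linfty: "\<one>\<^bsub>Linfty X\<^esub> = ae_class X (\<lambda>_. 1)"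
  and zero_Linfty: "\<zero>\<^bsub>Linfty X\<^esub> = ae_class X (\<lambda>_. 0)"
  and tr_Linfty: "tr (Linfty X) = pairing X (\<lambda>_. 1)"
  and predual_Linfty: "predual (Linfty X) = {pairing X h |h. h \<in> borel_measurable (meas X) \<and> h \<in> invariant X \<and>
                               set_integrable (meas X) (dom X) h}"
  by (simp_all add: Linfty_def)

lemma predual_nonempty: "predual (Linfty X) \<noteq> {}"
proof -
  have "pairing X (\<lambda>_. 0) \<in> predual (Linfty X)"
    unfolding predual_Linfty using invariant_const[of 0]
    by (intro CollectI exI[of _ "\<lambda>_. 0"]) (auto simp: set_integrable_def)
  then show ?thesis by auto
qed

lemma pairing_ae_class:
  assumes f: "f \<in> bounded_functions X" and h [measurable]: "h \<in> borel_measurable (meas X)"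
  shows "pairing X h (ae_class X f) = (LINT x:dom X|meas X. h x * f x)"
proof -
  note [measurable] = dom_sets
    have "(LINT x:dom X|meas X. h x * f' x) = (LINT x:dom X|meas X. h x * f x)" if "f' \<in> ae_class X f" for f'
    proof -
      from that f have [measurable]: "f \<in> borel_measurable (meas X)" "f' \<in> borel_measurable (meas X)"
        and ae: "AE x in meas X. f x = f' x"
        by (auto simp: ae_rel_def dest: bounded_functionsD)
      show ?thesis
        unfolding set_lebesgue_integral_def by (rule integral_cong_AE) (use ae in auto)
    qed
  then have "(\<lambda>f. LINT x:dom X|meas X. h x * f x) ` ae_class X f = (\<lambda>_. LINT x:dom X|meas X. h x * f x) ` ae_class X f"
    by (rule image_cong[OF refl])
  also have "\<dots> = {LINT x:dom X|meas X. h x * f x}"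
    using self_in_ae_class[OF f] by (subst image_constant) auto
  finally show ?thesis unfolding pairing_def by (simp only: the_elem_eq)
qed

lemma positive_cases:
  assumes "F \<in> positive_elements (Linfty X)"
  obtains f where "f \<in> bounded_functions X" "F = ae_class X (\<lambda>x. cnj (f x) * f x)"
proof -
  from assms obtain G where G: "G \<in> carrier (Linfty X)" "F = adj (Linfty X) G \<otimes>\<^bsub>Linfty X\<^esub> G"
    by (auto simp: positive_elements_def)
  from G(1) obtain f where f: "f \<in> bounded_functions X" "G = ae_class X f" by (rule carrier_cases)
  then show ?thesis
    using that[of f] G(2) by (simp add: adj_ae_class mult_ae_class bounded_cnj)
qed

lemma positiveI: "f \<in> bounded_functions X \<Longrightarrow> ae_class X (\<lambda>x. cnj (f x) * f x) \<in> positive_elements (Linfty X)"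
  unfolding positive_elements_def
  by (intro CollectI exI[of _ "ae_class X f"]) (simp add: adj_ae_class mult_ae_class bounded_cnj ae_class_in_carrier)

end

text \<open>The embedding and the automorphisms of the dilation are both given by composition with a point map.\<close>

lemma unital_star_hom_composition:
  assumes X: "pointwise_domain X" and Y: "pointwise_domain Y"
    and bounded: "\<And>f. f \<in> bounded_functions X \<Longrightarrow> (\<lambda>y. f (\<theta> y)) \<in> bounded_functions Y"
    and \<Phi>: "\<And>f. f \<in> bounded_functions X \<Longrightarrow> \<Phi> (ae_class X f) = ae_class Y (\<lambda>y. f (\<theta> y))"
  shows "unital_star_hom (Linfty X) (Linfty Y) \<Phi>"
proof -
  interpret X: pointwise_domain X by fact
  interpret Y: pointwise_domain Y by fact
  have maps: "\<Phi> F \<in> carrier (Linfty Y)" if "F \<in> carrier (Linfty X)" for F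
    using that by (elim X.carrier_cases) (simp add: \<Phi> bounded Y.ae_class_in_carrier)
  have add: "\<Phi> (F \<oplus>\<^bsub>Linfty X\<^esub> G) = \<Phi> F \<oplus>\<^bsub>Linfty Y\<^esub> \<Phi> G"
    if "F \<in> carrier (Linfty X)" "G \<in> carrier (Linfty X)" for F G
    using that by (elim X.carrier_cases) (simp add: X.add_ae_class \<Phi> Y.add_ae_class bounded X.bounded_add)
  have mult: "\<Phi> (F \<otimes>\<^bsub>Linfty X\<^esub> G) = \<Phi> F \<otimes>\<^bsub>Linfty Y\<^esub> \<Phi> G"
    if "F \<in> carrier (Linfty X)" "G \<in> carrier (Linfty X)" for F G
    using that by (elim X.carrier_cases) (simp add: X.mult_ae_class \<Phi> Y.mult_ae_class bounded X.bounded_mult)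
  have smult: "\<Phi> (c \<odot>\<^bsub>Linfty X\<^esub> F) = c \<odot>\<^bsub>Linfty Y\<^esub> \<Phi> F" if "F \<in> carrier (Linfty X)" for c F
    using that by (elim X.carrier_cases) (simp add: X.smult_ae_class \<Phi> Y.smult_ae_class bounded X.bounded_scale)
  have adj: "\<Phi> (adj (Linfty X) F) = adj (Linfty Y) (\<Phi> F)" if "F \<in> carrier (Linfty X)" for F
    using that by (elim X.carrier_cases) (simp add: X.adj_ae_class \<Phi> Y.adj_ae_class bounded X.bounded_cnj)
  have one: "\<Phi> \<one>\<^bsub>Linfty X\<^esub> = \<one>\<^bsub>Linfty Y\<^esub>"
    by (simp add: X.one_Linfty Y.one_Linfty \<Phi> X.bounded_const)
  show ?thesis
    unfolding unital_star_hom_def linear_map_def ring_hom_def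
    using maps add mult smult adj one by auto
qed

section \<open>The torus times the probability space\<close>

lemma torus_simps [simp]:
  "meas torus = lborel" "dom torus = cbox 0 1" "f \<in> invariant torus \<longleftrightarrow> (\<forall>x i. f (x + axis i 1) = f x)"
  by (simp_all add: torus_def)

lemma nu_domain_simps [simp]:
  "meas nu_domain = nu_measure" "dom nu_domain = UNIV" "invariant nu_domain = UNIV"
  by (simp_all add: nu_domain_def)

lemma sets_nu [simp, measurable_cong]: "sets nu_measure = sets borel" and space_nu [simp]: "space nu_measure = UNIV"
  by (simp_all add: nu_measure_def)

abbreviation torus_nu :: "((real ^ 'n) \<times> (real ^ 'n)) function_domain" where
  "torus_nu \<equiv> product_domain torus nu_domain"

abbreviation \<mu> :: "((real ^ 'n) \<times> (real ^ 'n)) measure" where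
  "\<mu> \<equiv> lborel \<Otimes>\<^sub>M nu_measure"

lemma torus_nu_simps [simp]:
  "meas torus_nu = \<mu>" "dom torus_nu = cbox 0 1 \<times> UNIV"
  "g \<in> invariant torus_nu \<longleftrightarrow> (\<forall>x i y. g (x + axis i 1, y) = g (x, y))"
  by (auto simp: product_domain_def)

interpretation nu: prob_space "nu_measure :: (real ^ 'n) measure"
  by (rule prob_space_nu)

interpretation torus_pair: pair_sigma_finite "lborel :: (real ^ 'n) measure" "nu_measure :: (real ^ 'n) measure"
  ..

interpretation torus: pointwise_domain "torus :: (real ^ 'n) function_domain"
  by unfold_locales auto

interpretation nu_domain: pointwise_domain "nu_domain :: (real ^ 'n) function_domain"
  by unfold_locales auto

interpretation torus_nu: pointwise_domain "torus_nu :: ((real ^ 'n) \<times> (real ^ 'n)) function_domain"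
proof
  have "cbox 0 1 \<times> UNIV \<in> sets (\<mu> :: ((real ^ 'n) \<times> (real ^ 'n)) measure)"
    by (intro pair_measureI) auto
  then show "dom torus_nu \<in> sets (meas (torus_nu :: ((real ^ 'n) \<times> (real ^ 'n)) function_domain))"
    by simp
qed auto

lemma bounded_torus_iff:
  "f \<in> bounded_functions torus \<longleftrightarrow>
    f \<in> borel_measurable borel \<and> (\<forall>x i. f (x + axis i 1) = f x) \<and> (\<exists>C. AE x in lborel. norm (f x) \<le> C)"
  unfolding bounded_functions_def torus_simps by simp

lemma bounded_nu_iff:
  "f \<in> bounded_functions nu_domain \<longleftrightarrow> f \<in> borel_measurable borel \<and> (\<exists>C. AE y in nu_measure. norm (f y) \<le> C)"
  unfolding bounded_functions_def nu_domain_simps measurable_cong_sets[OF sets_nu refl] by simp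

lemma bounded_torus_nu_iff:
  "g \<in> bounded_functions torus_nu \<longleftrightarrow>
    g \<in> borel_measurable \<mu> \<and> (\<forall>x i y. g (x + axis i 1, y) = g (x, y)) \<and>
    (\<exists>C. AE z in \<mu>. norm (g z) \<le> C)"
  unfolding bounded_functions_def torus_nu_simps mem_Collect_eq ..

lemmas torus_class_eq_iff = torus.ae_class_eq_iff[unfolded torus_simps]
lemmas torus_nu_class_eq_iff = torus_nu.ae_class_eq_iff[unfolded torus_nu_simps]

lemma AE_torus_fst:
  fixes Q :: "real ^ 'n \<Rightarrow> bool"
  assumes "AE x in lborel. Q x"
  shows "AE z in \<mu>. Q (fst z)"
proof -
  from assms obtain N where N: "{x. \<not> Q x} \<subseteq> N" "N \<in> null_sets lborel"
    by (auto elim: AE_E simp: null_sets_def)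
  have "N \<times> UNIV \<in> null_sets \<mu>"
    using N(2) nu.emeasure_pair_measure_Times[of N lborel UNIV] unfolding null_sets_def by auto
  then show ?thesis by (rule AE_I') (use N(1) in auto)
qed

lemma AE_torus_snd:
  fixes Q :: "real ^ 'n \<Rightarrow> bool"
  assumes "AE y in nu_measure. Q y"
  shows "AE z in (\<mu> :: ((real ^ 'n) \<times> (real ^ 'n)) measure). Q (snd z)"
proof -
  from assms obtain N where N: "{x. \<not> Q x} \<subseteq> N" "N \<in> null_sets (nu_measure :: (real ^ 'n) measure)"
    by (auto elim!: AE_E simp: null_sets_def)
  have "UNIV \<times> N \<in> null_sets ((\<mu> :: ((real ^ 'n) \<times> (real ^ 'n)) measure))"
    using N(2) nu.emeasure_pair_measure_Times[of UNIV lborel N] unfolding null_sets_def by auto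
  then show ?thesis by (rule AE_I') (use N(1) in auto)
qed

lemma bounded_lift_fst:
  assumes f: "f \<in> bounded_functions torus"
  shows "(\<lambda>z. f (fst z)) \<in> bounded_functions torus_nu"
proof -
  have [measurable]: "f \<in> borel_measurable borel" using f unfolding bounded_torus_iff by auto
  obtain C where "AE x in lborel. norm (f x) \<le> C" using f unfolding bounded_torus_iff by auto
  from AE_torus_fst[OF this] show ?thesis
    using f unfolding bounded_torus_nu_iff bounded_torus_iff by auto
qed

lemma bounded_lift_snd:
  assumes f: "f \<in> bounded_functions nu_domain"
  shows "(\<lambda>z. f (snd z)) \<in> bounded_functions torus_nu"
proof -
  have [measurable]: "f \<in> borel_measurable borel" using f unfolding bounded_nu_iff by auto
  obtain C where "AE x in nu_measure. norm (f x) \<le> C" using f unfolding bounded_nu_iff by auto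
  moreover have "(\<lambda>z. f (snd z)) \<in> borel_measurable \<mu>"
    using f unfolding bounded_nu_iff measurable_cong_sets[OF sets_nu refl, symmetric]
    by (intro measurable_compose[OF measurable_snd]) simp
  ultimately show ?thesis
    using AE_torus_snd[of "\<lambda>y. norm (f y) \<le> C"] unfolding bounded_torus_nu_iff by auto
qed

lemma bounded_tensor:
  "f \<in> bounded_functions torus \<Longrightarrow> g \<in> bounded_functions nu_domain \<Longrightarrow> (\<lambda>(x, y). f x * g y) \<in> bounded_functions torus_nu"
  using torus_nu.bounded_mult[OF bounded_lift_fst bounded_lift_snd] by (simp add: case_prod_unfold)

section \<open>Averaging over the probability space\<close>

definition nu_mean :: "((real ^ 'n) \<times> (real ^ 'n) \<Rightarrow> complex) \<Rightarrow> real ^ 'n \<Rightarrow> complex" where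
  "nu_mean g x = (LINT y|nu_measure. g (x, y))"

lemma nu_mean_measurable:
  assumes [measurable]: "g \<in> borel_measurable \<mu>"
  shows "nu_mean g \<in> borel_measurable borel"
proof -
  have "(\<lambda>x. LINT y|nu_measure. g (x, y)) \<in> borel_measurable lborel"
    by (intro nu.borel_measurable_lebesgue_integral) simp
  then show ?thesis by (simp add: nu_mean_def[abs_def])
qed

lemma bounded_sections:
  assumes g: "g \<in> bounded_functions torus_nu"
  obtains C where "AE x in lborel. (AE y in nu_measure. norm (g (x, y)) \<le> C) \<and> integrable nu_measure (\<lambda>y. g (x, y))"
proof -
  have [measurable]: "g \<in> borel_measurable \<mu>"
    using g unfolding bounded_torus_nu_iff by auto
  obtain C where "AE z in \<mu>. norm (g z) \<le> C"
    using g unfolding bounded_torus_nu_iff by auto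
  from torus_pair.AE_pair[OF this]
  have "AE x in lborel. (AE y in nu_measure. norm (g (x, y)) \<le> C) \<and> integrable nu_measure (\<lambda>y. g (x, y))"
  proof eventually_elim
    case (elim x)
    then show ?case by (auto intro!: nu.integrable_const_bound[of _ C])
  qed
  then show ?thesis by (rule that)
qed

lemma bounded_nu_mean:
  assumes g: "g \<in> bounded_functions torus_nu"
  shows "nu_mean g \<in> bounded_functions torus"
proof -
  obtain C where "AE x in lborel. (AE y in nu_measure. norm (g (x, y)) \<le> C) \<and> integrable nu_measure (\<lambda>y. g (x, y))"
    by (rule bounded_sections[OF g])
  then have "AE x in lborel. norm (nu_mean g x) \<le> C"
  proof eventually_elim
    case (elim x)
    have "norm (nu_mean g x) \<le> (LINT y|nu_measure. norm (g (x, y)))"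
      unfolding nu_mean_def by (rule integral_norm_bound)
    also have "\<dots> \<le> C" using elim by (intro nu.integral_le_const) auto
    finally show ?case .
  qed
  moreover have "nu_mean g \<in> borel_measurable borel"
    using g unfolding bounded_torus_nu_iff by (intro nu_mean_measurable) simp
  ultimately show ?thesis
    using g unfolding bounded_torus_iff bounded_torus_nu_iff by (auto simp: nu_mean_def)
qed

lemma nu_mean_cong_AE:
  assumes g: "g \<in> bounded_functions torus_nu" and g': "g' \<in> bounded_functions torus_nu"
    and eq: "AE z in \<mu>. g z = g' z"
  shows "AE x in lborel. nu_mean g x = nu_mean g' x"
proof -
  have [measurable]: "g \<in> borel_measurable \<mu>" "g' \<in> borel_measurable \<mu>"
    using g g' unfolding bounded_torus_nu_iff by auto
  from torus_pair.AE_pair[OF eq] show ?thesis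
  proof eventually_elim
    case (elim x)
    then show ?case unfolding nu_mean_def by (intro integral_cong_AE) auto
  qed
qed

lemma nu_mean_lift_fst: "nu_mean (\<lambda>z. f (fst z)) x = f x"
  by (simp add: nu_mean_def nu.prob_space[simplified])

lemma nu_mean_mult_fst: "nu_mean (\<lambda>z. f (fst z) * g z) x = f x * nu_mean g x"
  "nu_mean (\<lambda>z. g z * f (fst z)) x = nu_mean g x * f x"
  by (simp_all add: nu_mean_def)

lemma nu_mean_integral:
  assumes k: "set_integrable \<mu> (cbox 0 1 \<times> UNIV) k"
  shows "set_integrable lborel (cbox 0 1) (nu_mean k)"
    and "(LINT z:cbox 0 1 \<times> UNIV|\<mu>. k z) = (LINT x:cbox 0 1|lborel. nu_mean k x)"
proof -
  let ?K = "\<lambda>z. indicator (cbox 0 1 \<times> UNIV) z *\<^sub>R k z"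
  have K: "integrable \<mu> ?K" using k by (simp add: set_integrable_def)
  have sec: "(LINT y|nu_measure. ?K (x, y)) = indicator (cbox 0 1) x *\<^sub>R nu_mean k x" for x
  proof -
    have "?K (x, y) = indicator (cbox 0 1) x *\<^sub>R k (x, y)" for y by (simp add: indicator_def)
    then show ?thesis by (simp only: nu_mean_def integral_scaleR_right)
  qed
  show "set_integrable lborel (cbox 0 1) (nu_mean k)"
    using torus_pair.integrable_fst'[OF K] by (simp add: sec set_integrable_def)
  show "(LINT z:cbox 0 1 \<times> UNIV|\<mu>. k z) = (LINT x:cbox 0 1|lborel. nu_mean k x)"
    using torus_pair.integral_fst'[OF K] by (simp add: sec set_lebesgue_integral_def)
qed

lemma set_integrable_lift_fst:
  fixes h :: "real ^ 'n \<Rightarrow> complex"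
  assumes h: "set_integrable lborel (cbox 0 1) h"
  shows "set_integrable \<mu> (cbox 0 1 \<times> UNIV) (\<lambda>z. h (fst z))"
proof -
  let ?h = "\<lambda>x. indicator (cbox 0 1) x *\<^sub>R h x"
  have h': "integrable lborel ?h" using h by (simp add: set_integrable_def)
  have "?h \<in> borel_measurable lborel" using h' by (rule borel_measurable_integrable)
  from measurable_compose[OF measurable_fst this]
  have "(\<lambda>z. ?h (fst z)) \<in> borel_measurable \<mu>" .
  then have "integrable \<mu> (\<lambda>z. ?h (fst z))"
    using integrable_norm[OF h'] by (intro torus_pair.Fubini_integrable) (simp_all add: nu.prob_space[simplified])
  moreover have "?h (fst z) = indicator (cbox 0 1 \<times> UNIV) z *\<^sub>R h (fst z)" for z :: "(real ^ 'n) \<times> (real ^ 'n)"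
    by (auto simp: indicator_def mem_Times_iff)
  ultimately show ?thesis by (simp add: set_integrable_def)
qed

lemma set_integrable_mult_bounded:
  fixes h g :: "'a \<Rightarrow> complex"
  assumes h: "set_integrable M A h" and g: "g \<in> borel_measurable M" and C: "AE x in M. norm (g x) \<le> C"
  shows "set_integrable M A (\<lambda>x. h x * g x)"
  using integrable_mult_bounded[OF h[unfolded set_integrable_def] g C] by (simp add: set_integrable_def)

section \<open>Translations of the torus by the fibre coordinate\<close>

text \<open>
  The point map behind the group \<open>U\<close>.
\<close>

definition shear :: "real \<Rightarrow> (real ^ 'n) \<times> (real ^ 'n) \<Rightarrow> (real ^ 'n) \<times> (real ^ 'n)" where
  "shear t z = (fst z - t *\<^sub>R snd z, snd z)"

lemma shear_shear: "shear s (shear t z) = shear (s + t) z" and shear_0 [simp]: "shear 0 z = z"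
  and snd_shear [simp]: "snd (shear t z) = snd z"
  by (simp_all add: shear_def algebra_simps)

lemma shear_measurable [measurable]: "shear t \<in> \<mu> \<rightarrow>\<^sub>M \<mu>"
proof -
  have "(\<lambda>z :: (real ^ 'n) \<times> (real ^ 'n). fst z - t *\<^sub>R snd z) \<in> \<mu> \<rightarrow>\<^sub>M lborel"
    by measurable
  then show ?thesis unfolding shear_def[abs_def] by (intro measurable_Pair measurable_snd'') auto
qed

lemma nn_integral_shear:
  assumes [measurable]: "f \<in> borel_measurable \<mu>"
  shows "(\<integral>\<^sup>+ z. f (shear t z) \<partial>\<mu>) = (\<integral>\<^sup>+ z. f z \<partial>\<mu>)"
proof -
  have "(\<integral>\<^sup>+ x. f (x - t *\<^sub>R y, y) \<partial>lborel) = (\<integral>\<^sup>+ x. f (x, y) \<partial>lborel)" for y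
  proof -
    have "(\<integral>\<^sup>+ x. f (x, y) \<partial>lborel) = (\<integral>\<^sup>+ x. f (x, y) \<partial>distr lborel borel ((+) (- t *\<^sub>R y)))"
      unfolding lborel_distr_plus ..
    also have "\<dots> = (\<integral>\<^sup>+ x. f (x - t *\<^sub>R y, y) \<partial>lborel)"
      by (subst nn_integral_distr) (auto simp: algebra_simps)
    finally show ?thesis ..
  qed
  then show ?thesis
    by (subst (1 2) torus_pair.nn_integral_snd[symmetric]) (simp_all add: shear_def)
qed

lemma AE_shear:
  fixes Q :: "(real ^ 'n) \<times> (real ^ 'n) \<Rightarrow> bool"
  assumes "AE z in \<mu>. Q z"
  shows "AE z in \<mu>. Q (shear t z)"
proof -
  have eq: "distr \<mu> \<mu> (shear t) = \<mu>"
  proof (rule measure_eqI)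
    fix A assume A': "A \<in> sets (distr \<mu> \<mu> (shear t))"
    then have A: "A \<in> sets \<mu>" by simp
    have "emeasure (distr \<mu> \<mu> (shear t)) A =
        (\<integral>\<^sup>+ z. indicator A z \<partial>distr \<mu> \<mu> (shear t))"
      using A' by (rule nn_integral_indicator[symmetric])
    also have "\<dots> = (\<integral>\<^sup>+ z. indicator A (shear t z) \<partial>\<mu>)"
      by (intro nn_integral_distr shear_measurable borel_measurable_indicator A')
    also have "\<dots> = (\<integral>\<^sup>+ z. indicator A z \<partial>\<mu>)"
      using A by (intro nn_integral_shear borel_measurable_indicator)
    also have "\<dots> = emeasure \<mu> A"
      using A by (rule nn_integral_indicator)
    finally show "emeasure (distr \<mu> \<mu> (shear t)) A = emeasure \<mu> A" .
  qed simp
  have "AE z in distr \<mu> \<mu> (shear t). Q z"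
    unfolding eq by (rule assms)
  then show ?thesis by (rule AE_distrD[OF shear_measurable])
qed

lemma bounded_shear:
  assumes g: "g \<in> bounded_functions torus_nu"
  shows "(\<lambda>z. g (shear t z)) \<in> bounded_functions torus_nu"
proof -
  have [measurable]: "g \<in> borel_measurable \<mu>"
    using g unfolding bounded_torus_nu_iff by auto
  obtain C where "AE z in \<mu>. norm (g z) \<le> C"
    using g unfolding bounded_torus_nu_iff by auto
  from AE_shear[OF this] have "AE z in \<mu>. norm (g (shear t z)) \<le> C" .
  moreover have "g (shear t (x + axis i 1, y)) = g (shear t (x, y))" for x i y
  proof -
    have "shear t (x + axis i 1, y) = (x - t *\<^sub>R y + axis i 1, y)" by (simp add: shear_def)
    then have "g (shear t (x + axis i 1, y)) = g (x - t *\<^sub>R y + axis i 1, y)" by (rule arg_cong)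
    also have "\<dots> = g (x - t *\<^sub>R y, y)" using g unfolding bounded_torus_nu_iff by blast
    finally show ?thesis by (simp add: shear_def)
  qed
  moreover have "(\<lambda>z. g (shear t z)) \<in> borel_measurable \<mu>" by measurable
  ultimately show ?thesis unfolding bounded_torus_nu_iff by blast
qed

text \<open>
  The cube is not invariant under translations; only the image of this measure in the torus is.
  Invariance is therefore stated for its image under the torus coordinates.
\<close>

definition cube_nu :: "((real ^ 'n) \<times> (real ^ 'n)) measure" where
  "cube_nu = density \<mu> (\<lambda>z. ennreal (indicator (cbox 0 1 \<times> UNIV) z))"

lemma cube_UNIV_sets [measurable]: "cbox 0 1 \<times> UNIV \<in> sets \<mu>"
  using torus_nu.dom_sets by simp

lemma sets_cube_nu [simp, measurable_cong]: "sets cube_nu = sets \<mu>"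
  and space_cube_nu [simp]: "space cube_nu = UNIV"
  by (simp_all add: cube_nu_def space_pair_measure)

lemma integral_cube_nu:
  fixes f :: "_ \<Rightarrow> 'b::{banach, second_countable_topology}"
  assumes "f \<in> borel_measurable \<mu>"
  shows "integral\<^sup>L cube_nu f = (LINT z:cbox 0 1 \<times> UNIV|\<mu>. f z)"
    and "integrable cube_nu f \<longleftrightarrow> set_integrable \<mu> (cbox 0 1 \<times> UNIV) f"
  unfolding cube_nu_def set_lebesgue_integral_def set_integrable_def
  using assms by (subst integral_density integrable_density; simp)+

lemma AE_cube_nu: "AE z in \<mu>. Q z \<Longrightarrow> AE z in cube_nu. Q z"
  unfolding cube_nu_def by (subst AE_density) auto

lemma nn_integral_cube_shift:
  fixes B :: "(real ^ 'n) set"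
  assumes B [measurable]: "B \<in> sets borel" and per: "\<And>x i. x + axis i 1 \<in> B \<longleftrightarrow> x \<in> B"
  shows "(\<integral>\<^sup>+ x. indicator (cbox 0 1) x * indicator B (x + a) \<partial>lborel) = (\<integral>\<^sup>+ x. indicator (cbox 0 1) x * indicator B x \<partial>lborel)"
proof -
  have eq: "(\<integral>\<^sup>+ x. indicator (cbox 0 1) x * indicator B (x + b) \<partial>lborel) = ennreal (\<integral>x. indicator (cbox 0 1) x * indicator B (x + b) \<partial>lborel)" for b
  proof -
    have "integrable lborel (\<lambda>x. indicator (cbox 0 1) x * indicator B (x + b) :: real)"
    proof (rule Bochner_Integration.integrable_bound)
      show "integrable lborel (indicator (cbox 0 1 :: (real ^ 'n) set) :: _ \<Rightarrow> real)"
        using cube_volume unfolding has_bochner_integral_iff by blast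
    qed (auto simp: indicator_def)
    then have "(\<integral>\<^sup>+ x. ennreal (indicator (cbox 0 1) x * indicator B (x + b)) \<partial>lborel) = ennreal (\<integral>x. indicator (cbox 0 1) x * indicator B (x + b) \<partial>lborel)"
      by (intro nn_integral_eq_integral) auto
    then show ?thesis by (simp add: ennreal_mult ennreal_indicator)
  qed
  have cplx: "complex_of_real (\<integral>x. indicator (cbox 0 1) x * indicator B (x + b) \<partial>lborel) = (\<integral>x. indicator (cbox 0 1) x *\<^sub>R indicator B (x + b) \<partial>lborel)" for b
    unfolding integral_complex_of_real[symmetric]
    by (intro Bochner_Integration.integral_cong) (auto simp: indicator_def)
  have "(\<integral>x. indicator (cbox 0 1) x *\<^sub>R indicator B (x + a) \<partial>lborel) = (\<integral>x. indicator (cbox 0 1) x *\<^sub>R (indicator B x :: complex) \<partial>lborel)"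
    by (rule cube_integral_shift[of _ 1]) (use per in \<open>auto simp: indicator_def\<close>)
  then have "complex_of_real (\<integral>x. indicator (cbox 0 1) x * indicator B (x + a) \<partial>lborel) = complex_of_real (\<integral>x. indicator (cbox 0 1) x * indicator B (x + 0) \<partial>lborel)"
    unfolding cplx[of a] cplx[of 0] unfolding add_0_right .
  then show ?thesis using eq[of a] eq[of 0] by simp
qed

lemma shear_coords_measurable:
  "(\<lambda>z. (torus_coords (fst (shear t z)), snd z)) \<in> \<mu> \<rightarrow>\<^sub>M borel"
proof -
  have "(\<lambda>z :: (real ^ 'n) \<times> (real ^ 'n). fst z - t *\<^sub>R snd z) \<in> \<mu> \<rightarrow>\<^sub>M borel"
    by measurable
  then have "(\<lambda>z. torus_coords (fst (shear t z))) \<in> \<mu> \<rightarrow>\<^sub>M borel"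
    unfolding shear_def fst_conv by (rule measurable_compose[OF _ torus_coords_measurable])
  moreover have "snd \<in> (\<mu> :: ((real ^ 'n) \<times> (real ^ 'n)) measure) \<rightarrow>\<^sub>M borel"
    using measurable_snd[of "lborel :: (real ^ 'n) measure" "nu_measure :: (real ^ 'n) measure"]
    unfolding measurable_cong_sets[OF refl sets_nu] .
  ultimately show ?thesis
    unfolding borel_prod[symmetric] by (rule measurable_Pair)
qed

text \<open>
  For fixed second coordinate this is the translation invariance of the integral over the cube, and
  Fubini's theorem puts the fibres together.
\<close>

lemma distr_cube_nu_shear:
  "distr cube_nu borel (\<lambda>z. (torus_coords (fst (shear t z)), snd z)) =
   distr cube_nu borel (\<lambda>z :: (real ^ 'n) \<times> (real ^ 'n). (torus_coords (fst z), snd z))"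
proof (rule measure_eqI)
  let ?q = "\<lambda>t (z :: (real ^ 'n) \<times> (real ^ 'n)). (torus_coords (fst (shear t z)), snd z)"
  have q [measurable]: "?q t \<in> \<mu> \<rightarrow>\<^sub>M borel" for t
    by (rule shear_coords_measurable)
  fix A assume "A \<in> sets (distr cube_nu borel (?q t))"
  then have A [measurable]: "A \<in> sets borel" by simp
  have "emeasure (distr cube_nu borel (?q t)) A =
      (\<integral>\<^sup>+ y. (\<integral>\<^sup>+ x. indicator (cbox 0 1) x * indicator {x. (torus_coords x, y) \<in> A} x \<partial>lborel) \<partial>nu_measure)" for t
  proof -
    have "emeasure (distr cube_nu borel (?q t)) A = (\<integral>\<^sup>+ z. indicator A (?q t z) \<partial>cube_nu)"
      by (subst nn_integral_indicator[symmetric], simp, subst nn_integral_distr) auto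
    also have "\<dots> = (\<integral>\<^sup>+ z. indicator (cbox 0 1 \<times> UNIV) z * indicator A (?q t z) \<partial>\<mu>)"
      unfolding cube_nu_def by (subst nn_integral_density) (auto simp: ennreal_indicator)
    also have "\<dots> = (\<integral>\<^sup>+ y. (\<integral>\<^sup>+ x. indicator (cbox 0 1) x * indicator {x. (torus_coords x, y) \<in> A} (x + - t *\<^sub>R y) \<partial>lborel) \<partial>nu_measure)"
      by (subst torus_pair.nn_integral_snd[symmetric]) (auto simp: shear_def indicator_def intro!: nn_integral_cong)
    also have "\<dots> = (\<integral>\<^sup>+ y. (\<integral>\<^sup>+ x. indicator (cbox 0 1) x * indicator {x. (torus_coords x, y) \<in> A} x \<partial>lborel) \<partial>nu_measure)"
    proof (rule nn_integral_cong, rule nn_integral_cube_shift)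
      fix y :: "real ^ 'n"
      have "(\<lambda>x. (torus_coords x, y)) \<in> borel_measurable borel"
        by (intro borel_measurable_continuous_onI continuous_intros)
      from measurable_sets_borel[OF this A] show "{x. (torus_coords x, y) \<in> A} \<in> sets borel"
        by (simp add: vimage_def)
      show "x + axis i 1 \<in> {x. (torus_coords x, y) \<in> A} \<longleftrightarrow> x \<in> {x. (torus_coords x, y) \<in> A}" for x i
      proof -
        have "cis (2 * pi * (x + axis i 1) $ j) = cis (2 * pi * x $ j)" for j
          by (simp add: axis_def distrib_left cis_mult[symmetric] del: cis_mult)
        then have "torus_coords (x + axis i 1) = torus_coords x" by (simp add: torus_coords_def)
        then show ?thesis by simp
      qed
    qed
    finally show ?thesis .
  qed
  from this[of t] this[of 0]
  show "emeasure (distr cube_nu borel (?q t)) A = emeasure (distr cube_nu borel (\<lambda>z :: (real ^ 'n) \<times> (real ^ 'n). (torus_coords (fst z), snd z))) A"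
    by simp
qed simp

lemma integral_shear:
  fixes k :: "(real ^ 'n) \<times> (real ^ 'n) \<Rightarrow> 'b::{banach, second_countable_topology}"
  assumes k: "k \<in> borel_measurable \<mu>" and per: "\<And>x i y. k (x + axis i 1, y) = k (x, y)"
  shows "(\<integral>z. k (shear t z) \<partial>cube_nu) = (\<integral>z. k z \<partial>cube_nu)"
    and "integrable cube_nu (\<lambda>z. k (shear t z)) \<longleftrightarrow> integrable cube_nu k"
proof -
  let ?q = "\<lambda>t (z :: (real ^ 'n) \<times> (real ^ 'n)). (torus_coords (fst (shear t z)), snd z)"
  let ?G = "\<lambda>(w, y). k (torus_point w, y)"
  have "(\<lambda>z. (torus_point (fst z), snd z)) \<in> borel \<Otimes>\<^sub>M borel \<rightarrow>\<^sub>M \<mu>"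
    by measurable
  from measurable_compose[OF this k] have G [measurable]: "?G \<in> borel_measurable borel"
    by (simp add: borel_prod case_prod_unfold)
  have q: "?q t \<in> cube_nu \<rightarrow>\<^sub>M borel" for t
    unfolding measurable_cong_sets[OF sets_cube_nu refl] by (rule shear_coords_measurable)
  have kG: "k (shear t z) = ?G (?q t z)" for t z
    using periodic_torus_point[of "\<lambda>x. k (x, snd z)" "fst (shear t z)", OF per] by (simp add: shear_def)
  have 1: "(\<integral>z. k (shear t z) \<partial>cube_nu) = (\<integral>w. ?G w \<partial>distr cube_nu borel (?q t))" for t
    unfolding kG by (rule integral_distr[symmetric, OF q G])
  have 2: "integrable cube_nu (\<lambda>z. k (shear t z)) \<longleftrightarrow> integrable (distr cube_nu borel (?q t)) ?G" for t
    unfolding kG by (rule integrable_distr_eq[symmetric, OF q G])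
  have eq: "distr cube_nu borel (?q t) = distr cube_nu borel (?q 0)"
    using distr_cube_nu_shear[of t] by simp
  show "(\<integral>z. k (shear t z) \<partial>cube_nu) = (\<integral>z. k z \<partial>cube_nu)"
    using 1[of t] 1[of 0] unfolding eq by simp
  show "integrable cube_nu (\<lambda>z. k (shear t z)) \<longleftrightarrow> integrable cube_nu k"
    using 2[of t] 2[of 0] unfolding eq by simp
qed

section \<open>Density of the elementary tensors\<close>

context pointwise_domain
begin

lemma linear_span_carrier:
  assumes S: "S \<subseteq> carrier (Linfty X)" and F: "F \<in> linear_span (Linfty X) S"
  shows "F \<in> carrier (Linfty X)"
  using F
proof induction
  case zero
  then show ?case by (simp add: zero_Linfty ae_class_in_carrier bounded_const)
next
  case (add s v c)
  from add(1) S have "s \<in> carrier (Linfty X)" by auto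
  from this add.IH show ?case
    by (elim carrier_cases) (simp add: smult_ae_class add_ae_class bounded_scale bounded_add ae_class_in_carrier)
qed

lemma linear_span_add:
  assumes S: "S \<subseteq> carrier (Linfty X)"
    and F: "F \<in> linear_span (Linfty X) S" and G: "G \<in> linear_span (Linfty X) S"
  shows "F \<oplus>\<^bsub>Linfty X\<^esub> G \<in> linear_span (Linfty X) S"
  using F
proof induction
  case zero
  have "\<zero>\<^bsub>Linfty X\<^esub> \<oplus>\<^bsub>Linfty X\<^esub> G = G"
    using linear_span_carrier[OF S G] by (elim carrier_cases) (simp add: zero_Linfty add_ae_class bounded_const)
  then show ?case using G by simp
next
  case (add s v c)
  from add(1) S have "s \<in> carrier (Linfty X)" by auto
  from this linear_span_carrier[OF S add(2)] linear_span_carrier[OF S G]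
  have "(c \<odot>\<^bsub>Linfty X\<^esub> s \<oplus>\<^bsub>Linfty X\<^esub> v) \<oplus>\<^bsub>Linfty X\<^esub> G = c \<odot>\<^bsub>Linfty X\<^esub> s \<oplus>\<^bsub>Linfty X\<^esub> (v \<oplus>\<^bsub>Linfty X\<^esub> G)"
    by (elim carrier_cases) (simp add: smult_ae_class add_ae_class bounded_scale bounded_add add.assoc)
  then show ?case using linear_span.add[OF add(1) add.IH] by simp
qed

lemma linear_span_smult:
  assumes S: "S \<subseteq> carrier (Linfty X)" and F: "F \<in> linear_span (Linfty X) S"
  shows "d \<odot>\<^bsub>Linfty X\<^esub> F \<in> linear_span (Linfty X) S"
  using F
proof induction
  case zero
  have "d \<odot>\<^bsub>Linfty X\<^esub> \<zero>\<^bsub>Linfty X\<^esub> = \<zero>\<^bsub>Linfty X\<^esub>"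
    by (simp add: zero_Linfty smult_ae_class bounded_const)
  then show ?case by (simp add: linear_span.zero)
next
  case (add s v c)
  from add(1) S have "s \<in> carrier (Linfty X)" by auto
  from this linear_span_carrier[OF S add(2)]
  have "d \<odot>\<^bsub>Linfty X\<^esub> (c \<odot>\<^bsub>Linfty X\<^esub> s \<oplus>\<^bsub>Linfty X\<^esub> v) = (d * c) \<odot>\<^bsub>Linfty X\<^esub> s \<oplus>\<^bsub>Linfty X\<^esub> (d \<odot>\<^bsub>Linfty X\<^esub> v)"
    by (elim carrier_cases) (simp add: smult_ae_class add_ae_class bounded_scale bounded_add mult.assoc distrib_left)
  then show ?case using linear_span.add[OF add(1) add.IH] by simp
qed

lemma linear_span_superset:
  assumes S: "S \<subseteq> carrier (Linfty X)" and s: "s \<in> S"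
  shows "s \<in> linear_span (Linfty X) S"
proof -
  have "s \<in> carrier (Linfty X)" using S s by auto
  then have "1 \<odot>\<^bsub>Linfty X\<^esub> s \<oplus>\<^bsub>Linfty X\<^esub> \<zero>\<^bsub>Linfty X\<^esub> = s"
    by (elim carrier_cases) (simp add: zero_Linfty smult_ae_class add_ae_class bounded_const)
  moreover have "1 \<odot>\<^bsub>Linfty X\<^esub> s \<oplus>\<^bsub>Linfty X\<^esub> \<zero>\<^bsub>Linfty X\<^esub> \<in> linear_span (Linfty X) S"
    by (intro linear_span.add s linear_span.zero)
  ultimately show ?thesis by simp
qed

end

lemma tensor_ae_class:
  assumes f: "f \<in> bounded_functions torus" and g: "g \<in> bounded_functions nu_domain"
  shows "tensor torus nu_domain (ae_class torus f) (ae_class nu_domain g) = ae_class torus_nu (\<lambda>(x, y). f x * g y)"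
proof -
  have "(\<Union>f'\<in>ae_class torus f. \<Union>g'\<in>ae_class nu_domain g. ae_class torus_nu (\<lambda>(x, y). f' x * g' y))
      = (\<Union>g'\<in>ae_class nu_domain g. ae_class torus_nu (\<lambda>(x, y). f x * g' y))"
  proof (rule torus.UN_ae_class[OF f])
    fix f' assume f': "f' \<in> bounded_functions torus" and "AE x in meas torus. f x = f' x"
    then have ae: "AE x in lborel. f x = f' x" unfolding torus_simps by simp
    show "(\<Union>g'\<in>ae_class nu_domain g. ae_class torus_nu (\<lambda>(x, y). f' x * g' y)) = (\<Union>g'\<in>ae_class nu_domain g. ae_class torus_nu (\<lambda>(x, y). f x * g' y))"
    proof (rule SUP_cong)
      fix g' assume "g' \<in> ae_class nu_domain g"
      then have g': "g' \<in> bounded_functions nu_domain" by (simp add: ae_rel_def)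
      show "ae_class torus_nu (\<lambda>(x, y). f' x * g' y) = ae_class torus_nu (\<lambda>(x, y). f x * g' y)"
        using AE_torus_fst[OF ae]
        by (subst torus_nu_class_eq_iff[OF bounded_tensor[OF f' g'] bounded_tensor[OF f g']])
           (elim eventually_mono, simp add: case_prod_unfold)
    qed simp
  qed
  also have "\<dots> = ae_class torus_nu (\<lambda>(x, y). f x * g y)"
  proof (rule nu_domain.UN_ae_class[OF g])
    fix g' assume g': "g' \<in> bounded_functions nu_domain" and "AE y in meas nu_domain. g y = g' y"
    then have ae: "AE y in nu_measure. g y = g' y" unfolding nu_domain_simps by simp
    show "ae_class torus_nu (\<lambda>(x, y). f x * g' y) = ae_class torus_nu (\<lambda>(x, y). f x * g y)"
      using AE_torus_snd[OF ae]
      by (subst torus_nu_class_eq_iff[OF bounded_tensor[OF f g'] bounded_tensor[OF f g]])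
         (elim eventually_mono, simp add: case_prod_unfold)
  qed
  finally show ?thesis by (simp add: tensor_def)
qed

text \<open>
  Unlike \<open>torus_point\<close>, this representative modulo the integers fixes almost every point of the cube.  A
  function composed with it is periodic and unchanged on the fundamental domain.
\<close>

definition unit_cell :: "real ^ 'n \<Rightarrow> real ^ 'n" where
  "unit_cell x = (\<chi> i. frac (x $ i))"

lemma unit_cell_periodic: "unit_cell (x + axis i 1) = unit_cell x"
proof -
  have "frac (x $ j + 1) = frac (x $ j)" for j by (simp add: frac_def)
  then show ?thesis by (auto simp: unit_cell_def vec_eq_iff axis_def)
qed

lemma unit_cell_measurable [measurable]: "unit_cell \<in> borel_measurable borel"
proof (rule borel_measurable_vecI)
  fix i
  have [measurable]: "(\<lambda>x :: real ^ 'n. x $ i) \<in> borel_measurable borel"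
    by (intro borel_measurable_continuous_onI continuous_intros)
  show "(\<lambda>x :: real ^ 'n. unit_cell x $ i) \<in> borel_measurable borel"
    unfolding unit_cell_def frac_def by simp
qed

lemma AE_cube_unit_cell: "AE x in lborel. x \<in> cbox 0 1 \<longrightarrow> unit_cell (x :: real ^ 'n) = x"
proof (rule AE_I')
  have "negligible (frontier (cbox 0 1 :: (real ^ 'n) set))" by (intro negligible_convex_frontier convex_box)
  moreover have "frontier (cbox 0 1 :: (real ^ 'n) set) \<in> sets borel" by (intro borel_closed frontier_closed)
  ultimately show "frontier (cbox 0 1 :: (real ^ 'n) set) \<in> null_sets lborel"
    by (simp add: negligible_iff_null_sets null_sets_completion_iff)
  show "{x \<in> space lborel. \<not> (x \<in> cbox 0 1 \<longrightarrow> unit_cell x = x)} \<subseteq> frontier (cbox 0 1 :: (real ^ 'n) set)"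
  proof
    fix x :: "real ^ 'n" assume "x \<in> {x \<in> space lborel. \<not> (x \<in> cbox 0 1 \<longrightarrow> unit_cell x = x)}"
    then have x: "x \<in> cbox 0 1" "unit_cell x \<noteq> x" by auto
    have "unit_cell x = x" if "x \<in> box 0 1"
      using that by (auto simp: unit_cell_def vec_eq_iff mem_box_cart frac_eq intro: less_imp_le)
    with x show "x \<in> frontier (cbox 0 1)" by (auto simp: frontier_def)
  qed
qed

definition elementary_tensors :: "((real ^ 'n) \<times> (real ^ 'n) \<Rightarrow> complex) set set" where
  "elementary_tensors = {tensor torus nu_domain F G |F G. F \<in> carrier (Linfty torus) \<and> G \<in> carrier (Linfty nu_domain)}"

lemma elementary_tensors_carrier: "elementary_tensors \<subseteq> carrier (Linfty torus_nu)"
proof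
  fix T assume "T \<in> (elementary_tensors :: ((real ^ 'n) \<times> (real ^ 'n) \<Rightarrow> complex) set set)"
  then obtain F G where FG: "F \<in> carrier (Linfty torus)" "G \<in> carrier (Linfty nu_domain)" and T: "T = tensor torus nu_domain F G"
    unfolding elementary_tensors_def by blast
  obtain f where f: "f \<in> bounded_functions torus" "F = ae_class torus f" using FG(1) by (rule torus.carrier_cases)
  obtain g where g: "g \<in> bounded_functions nu_domain" "G = ae_class nu_domain g" using FG(2) by (rule nu_domain.carrier_cases)
  show "T \<in> carrier (Linfty torus_nu)"
    unfolding T f(2) g(2) tensor_ae_class[OF f(1) g(1)] by (intro torus_nu.ae_class_in_carrier bounded_tensor f(1) g(1))
qed

lemma tensor_in_elementary_tensors:
  assumes f: "f \<in> bounded_functions torus" and g: "g \<in> bounded_functions nu_domain"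
  shows "ae_class torus_nu (\<lambda>(x, y). f x * g y) \<in> elementary_tensors"
  unfolding elementary_tensors_def tensor_ae_class[OF f g, symmetric]
  using torus.ae_class_in_carrier[OF f] nu_domain.ae_class_in_carrier[OF g] by blast

text \<open>
  With respect to a finite measure that is absolutely continuous and lives on the fundamental
  domain, a measurable rectangle agrees with the tensor of a periodised indicator and an indicator.
\<close>

lemma tensors_L1_dense:
  fixes M :: "((real ^ 'n) \<times> (real ^ 'n)) measure"
  assumes M: "finite_measure M" and sets_M: "sets M = sets \<mu>"
    and ac: "\<And>Q. AE z in \<mu>. fst z \<in> cbox 0 1 \<longrightarrow> Q z \<Longrightarrow> AE z in M. Q z"
    and g: "g \<in> bounded_functions torus_nu"
  shows "L1_approximable M {v \<in> bounded_functions torus_nu. ae_class torus_nu v \<in> linear_span (Linfty torus_nu) elementary_tensors} g"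
proof -
  interpret finite_measure M by fact
  let ?V = "{v \<in> bounded_functions torus_nu. ae_class torus_nu v \<in> linear_span (Linfty torus_nu) elementary_tensors} :: ((real ^ 'n) \<times> (real ^ 'n) \<Rightarrow> complex) set"
  have sp: "space M = UNIV" using sets_eq_imp_space_eq[OF sets_M] by (simp add: space_pair_measure)
  have int: "integrable M v" if v: "v \<in> bounded_functions torus_nu" for v
  proof -
    obtain C where C: "AE z in \<mu>. norm (v z) \<le> C"
      using v unfolding bounded_torus_nu_iff by auto
    have "AE z in M. norm (v z) \<le> C"
      by (rule ac) (use C in \<open>elim eventually_mono, simp\<close>)
    moreover have "v \<in> borel_measurable M"
      using v unfolding bounded_torus_nu_iff measurable_cong_sets[OF sets_M refl] by simp
    ultimately show ?thesis by (intro integrable_const_bound)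
  qed
  have tensor_V: "(\<lambda>(x, y). f x * h y) \<in> ?V" if "f \<in> bounded_functions torus" "h \<in> bounded_functions nu_domain" for f h
    using bounded_tensor[OF that] torus_nu.linear_span_superset[OF elementary_tensors_carrier tensor_in_elementary_tensors[OF that]]
    by simp
  have exact: "L1_approximable M ?V f" if "v \<in> ?V" "AE z in M. f z = v z" "f \<in> borel_measurable M" for f v
    unfolding L1_approximable_def
  proof (intro allI impI bexI[OF _ that(1)])
    fix e :: real assume e: "e > 0"
    have "(\<integral>z. norm (f z - v z) \<partial>M) = (\<integral>z. 0 \<partial>M)"
      using that int[of v] by (intro integral_cong_AE) auto
    with e show "(\<integral>z. norm (f z - v z) \<partial>M) < e" by simp
  qed
  let ?G = "{a \<times> b |a b. a \<in> sets (lborel :: (real ^ 'n) measure) \<and> b \<in> sets (nu_measure :: (real ^ 'n) measure)}"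
  show ?thesis
  proof (rule L1_dense_of_generator[OF M, where G = ?G])
    show "sets M = sigma_sets (space M) ?G"
      unfolding sets_M sp sets_pair_measure by simp
    show "Int_stable ?G" by (rule Int_stable_pair_measure_generator)
    show "integrable M v" if "v \<in> ?V" for v using that int by simp
    show "(\<lambda>x. v x + w x) \<in> ?V" if "v \<in> ?V" "w \<in> ?V" for v w
      using that torus_nu.bounded_add[of v w] torus_nu.add_ae_class[of v w]
        torus_nu.linear_span_add[OF elementary_tensors_carrier, of "ae_class torus_nu v" "ae_class torus_nu w"]
      by simp
    show "(\<lambda>x. c * v x) \<in> ?V" if "v \<in> ?V" for c v
      using that torus_nu.bounded_scale[of v c] torus_nu.smult_ae_class[of v c]
        torus_nu.linear_span_smult[OF elementary_tensors_carrier, of "ae_class torus_nu v" c]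
      by simp
    show "L1_approximable M ?V (\<lambda>_. 1)"
    proof (rule exact[OF tensor_V])
      show "(\<lambda>_. 1) \<in> bounded_functions torus" by (rule torus.bounded_const)
      show "(\<lambda>_. 1) \<in> bounded_functions nu_domain" by (rule nu_domain.bounded_const)
    qed auto
    show "L1_approximable M ?V (indicator A)" if "A \<in> ?G" for A
    proof -
      from that obtain a b where A: "A = a \<times> b" and a: "a \<in> sets (lborel :: (real ^ 'n) measure)" and b: "b \<in> sets (nu_measure :: (real ^ 'n) measure)" by auto
      have meas: "indicator A \<in> borel_measurable M"
        using a b unfolding A by (intro borel_measurable_indicator) (simp only: sets_M pair_measureI)
      show ?thesis
      proof (rule exact[OF tensor_V _ meas])
        show "(\<lambda>x. indicator a (unit_cell x)) \<in> bounded_functions torus"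
          unfolding bounded_torus_iff
        proof (intro conjI exI[of _ 1])
          have [measurable]: "a \<in> sets borel" using a by simp
          show "(\<lambda>x. indicator a (unit_cell x)) \<in> borel_measurable borel" by measurable
        qed (auto simp: unit_cell_periodic indicator_def)
        show "indicator b \<in> bounded_functions nu_domain"
          unfolding bounded_nu_iff using b by (intro conjI exI[of _ 1]) (auto simp: indicator_def)
        show "AE z in M. (indicator A z :: complex) = (case z of (x, y) \<Rightarrow> indicator a (unit_cell x) * indicator b y)"
        proof (rule ac)
          show "AE z in \<mu>. fst z \<in> cbox 0 1 \<longrightarrow>
              (indicator A z :: complex) = (case z of (x, y) \<Rightarrow> indicator a (unit_cell x) * indicator b y)"
            using AE_torus_fst[OF AE_cube_unit_cell]
            by eventually_elim (auto simp: A indicator_def)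
        qed
      qed
    qed
  qed (use g int in \<open>auto simp: sp\<close>)
qed

text \<open>
  The finitely many densities of a basic neighbourhood are dominated by the sum \<open>H\<close> of their absolute
  values.  Approximation in \<open>L\<^sup>1\<close> with respect to \<open>H d\<mu>\<close> controls all of them at once.
\<close>

lemma tensors_weak_star_dense:
  "weak_star_topology (Linfty torus_nu) closure_of linear_span (Linfty torus_nu) elementary_tensors =
   carrier (Linfty (torus_nu :: ((real ^ 'n) \<times> (real ^ 'n)) function_domain))"
proof (rule antisym)
  let ?L = "Linfty (torus_nu :: ((real ^ 'n) \<times> (real ^ 'n)) function_domain)"
  let ?P = "(\<mu> :: ((real ^ 'n) \<times> (real ^ 'n)) measure)"
  show "weak_star_topology ?L closure_of linear_span ?L elementary_tensors \<subseteq> carrier ?L"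
    using closure_of_subset_topspace[of "weak_star_topology ?L"]
    unfolding topspace_weak_star_topology[OF torus_nu.predual_nonempty] .
  show "carrier ?L \<subseteq> weak_star_topology ?L closure_of linear_span ?L elementary_tensors"
  proof
    fix F assume F: "F \<in> carrier ?L"
    then obtain g where g: "g \<in> bounded_functions torus_nu" and Fg: "F = ae_class torus_nu g"
      by (rule torus_nu.carrier_cases)
    show "F \<in> weak_star_topology ?L closure_of linear_span ?L elementary_tensors"
    proof (rule weak_star_closureI[OF torus_nu.predual_nonempty F])
      show "linear_span ?L elementary_tensors \<subseteq> carrier ?L"
        using torus_nu.linear_span_carrier[OF elementary_tensors_carrier] by blast
      fix W and e :: real assume W: "finite W" "W \<subseteq> predual ?L" and e: "e > 0"
      have "\<exists>h. \<omega> = pairing torus_nu h \<and> h \<in> borel_measurable ?P \<and> set_integrable ?P (cbox 0 1 \<times> UNIV) h" if "\<omega> \<in> W" for \<omega>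
        using W(2) that unfolding torus_nu.predual_Linfty torus_nu_simps by blast
      then obtain h where h: "\<And>\<omega>. \<omega> \<in> W \<Longrightarrow> \<omega> = pairing torus_nu (h \<omega>)"
        and h_meas: "\<And>\<omega>. \<omega> \<in> W \<Longrightarrow> h \<omega> \<in> borel_measurable ?P"
        and h_int: "\<And>\<omega>. \<omega> \<in> W \<Longrightarrow> set_integrable ?P (cbox 0 1 \<times> UNIV) (h \<omega>)" by metis
      define H where "H z = (\<Sum>\<omega>\<in>W. norm (indicator (cbox 0 1 \<times> UNIV) z *\<^sub>R h \<omega> z))" for z
      have H_int: "integrable ?P H"
        unfolding H_def using h_int by (intro Bochner_Integration.integrable_sum integrable_norm) (simp add: set_integrable_def)
      then have H_meas [measurable]: "H \<in> borel_measurable ?P" by (rule borel_measurable_integrable)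
      have H_nonneg: "H z \<ge> 0" for z unfolding H_def by (intro sum_nonneg) simp
      have H_0: "H z = 0" if "fst z \<notin> cbox 0 1" for z
        using that unfolding H_def by (intro sum.neutral) (auto simp: indicator_def mem_Times_iff)
      define M where "M = density ?P (\<lambda>z. ennreal (H z))"
      have "finite_measure M"
      proof (rule finite_measureI)
        have "emeasure M (space M) = (\<integral>\<^sup>+ z. ennreal (H z) \<partial>?P)"
          unfolding M_def space_density by (subst emeasure_density[OF _ sets.top]) (auto intro!: nn_integral_cong)
        also have "\<dots> = ennreal (integral\<^sup>L ?P H)"
          by (rule nn_integral_eq_integral[OF H_int]) (simp add: H_nonneg)
        finally show "emeasure M (space M) \<noteq> \<infinity>" by simp
      qed
      have sets_M: "sets M = sets ?P" by (simp add: M_def)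
      have "L1_approximable M {v \<in> bounded_functions torus_nu. ae_class torus_nu v \<in> linear_span ?L elementary_tensors} g"
      proof (rule tensors_L1_dense[OF \<open>finite_measure M\<close> sets_M _ g])
        fix Q assume Q: "AE z in ?P. fst z \<in> cbox 0 1 \<longrightarrow> Q z"
        have "AE z in ?P. 0 < ennreal (H z) \<longrightarrow> Q z"
          using Q
        proof eventually_elim
          case (elim z)
          then show ?case using H_0[of z] by auto
        qed
        then show "AE z in M. Q z" unfolding M_def by (subst AE_density) auto
      qed
      with e obtain v where v: "v \<in> bounded_functions torus_nu" "ae_class torus_nu v \<in> linear_span ?L elementary_tensors"
        and close: "(\<integral>z. norm (g z - v z) \<partial>M) < e"
        unfolding L1_approximable_def by blast
      show "\<exists>y\<in>linear_span ?L elementary_tensors. \<forall>\<omega>\<in>W. norm (\<omega> y - \<omega> F) < e"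
      proof (intro bexI[OF _ v(2)] ballI)
        fix \<omega> assume \<omega>: "\<omega> \<in> W"
        let ?h = "\<lambda>z. indicator (cbox 0 1 \<times> UNIV) z *\<^sub>R h \<omega> z"
        have val: "\<omega> (ae_class torus_nu u) = (\<integral>z. ?h z * u z \<partial>?P)" and prod_int: "integrable ?P (\<lambda>z. ?h z * u z)"
          if u: "u \<in> bounded_functions torus_nu" for u
        proof -
          have "\<omega> (ae_class torus_nu u) = pairing torus_nu (h \<omega>) (ae_class torus_nu u)"
            using h[OF \<omega>] by metis
          also have "\<dots> = (\<integral>z. ?h z * u z \<partial>?P)"
            using torus_nu.pairing_ae_class[OF u, of "h \<omega>"] h_meas[OF \<omega>]
            unfolding torus_nu_simps set_lebesgue_integral_def by simp
          finally show "\<omega> (ae_class torus_nu u) = (\<integral>z. ?h z * u z \<partial>?P)" .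
          obtain C where "AE z in ?P. norm (u z) \<le> C" "u \<in> borel_measurable ?P"
            using u unfolding bounded_torus_nu_iff by auto
          from set_integrable_mult_bounded[OF h_int[OF \<omega>] this(2,1)]
          show "integrable ?P (\<lambda>z. ?h z * u z)" by (simp add: set_integrable_def)
        qed
        have [measurable]: "g \<in> borel_measurable ?P" "v \<in> borel_measurable ?P"
          using g v(1) unfolding bounded_torus_nu_iff by auto
        have vg_meas: "(\<lambda>z. norm (g z - v z)) \<in> borel_measurable ?P" by measurable
        have diff: "integrable ?P (\<lambda>z. ?h z * (v z - g z))"
          using prod_int[OF v(1)] prod_int[OF g] by (simp add: right_diff_distrib)
        have M_int: "integrable ?P (\<lambda>z. H z *\<^sub>R norm (g z - v z))"
        proof -
          obtain C D where "AE z in ?P. norm (g z) \<le> C" "AE z in ?P. norm (v z) \<le> D"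
            using g v(1) unfolding bounded_torus_nu_iff by auto
          then have dominated: "AE z in ?P. norm (H z *\<^sub>R norm (g z - v z)) \<le> norm ((C + D) * H z)"
          proof eventually_elim
            case (elim z)
            have "norm (g z - v z) \<le> C + D" using elim norm_triangle_ineq4[of "g z" "v z"] by linarith
            then have "H z * norm (g z - v z) \<le> H z * (C + D)" using H_nonneg by (intro mult_left_mono)
            also have "\<dots> \<le> norm ((C + D) * H z)" by (simp add: mult.commute)
            finally show ?case using H_nonneg[of z] by (simp add: abs_mult)
          qed
          have "integrable ?P (\<lambda>z. (C + D) * H z)" using H_int by (rule integrable_mult_right)
          moreover have "(\<lambda>z. H z *\<^sub>R norm (g z - v z)) \<in> borel_measurable ?P" using vg_meas by measurable
          ultimately show ?thesis using dominated by (rule Bochner_Integration.integrable_bound)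
        qed
        have "norm (\<omega> (ae_class torus_nu v) - \<omega> F) = norm (\<integral>z. ?h z * (v z - g z) \<partial>?P)"
          unfolding Fg val[OF v(1)] val[OF g] right_diff_distrib
          by (subst Bochner_Integration.integral_diff[OF prod_int[OF v(1)] prod_int[OF g]]) simp
        also have "\<dots> \<le> (\<integral>z. norm (?h z * (v z - g z)) \<partial>?P)" by (rule integral_norm_bound)
        also have "\<dots> \<le> (\<integral>z. H z *\<^sub>R norm (g z - v z) \<partial>?P)"
        proof (rule integral_mono[OF integrable_norm[OF diff] M_int])
          fix z
          have "norm (?h z) \<le> H z"
            unfolding H_def using \<omega> W(1) by (intro member_le_sum[where f = "\<lambda>\<omega>. norm (indicator (cbox 0 1 \<times> UNIV) z *\<^sub>R h \<omega> z)"]) auto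
          then have "norm (?h z) * norm (v z - g z) \<le> H z * norm (v z - g z)" by (intro mult_right_mono) auto
          then show "norm (?h z * (v z - g z)) \<le> H z *\<^sub>R norm (g z - v z)"
            by (simp add: norm_mult norm_minus_commute)
        qed
        also have "\<dots> = (\<integral>z. norm (g z - v z) \<partial>M)"
          unfolding M_def using vg_meas H_nonneg by (subst integral_density) auto
        finally show "norm (\<omega> (ae_class torus_nu v) - \<omega> F) < e" using close by linarith
      qed
    qed
  qed
qed

lemma N_algebra_eq: "N_algebra = Linfty torus_nu"
  unfolding N_algebra_def vn_tensor_def Let_def
  unfolding tensors_weak_star_dense[unfolded elementary_tensors_def] by (simp add: Linfty_def)

section \<open>The embedding\<close>

lemma J_map_ae_class:
  assumes f: "f \<in> bounded_functions torus"
  shows "J_map (ae_class torus f) = ae_class torus_nu (\<lambda>z. f (fst z))"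
  unfolding J_map_def nu_algebra_def nu_domain.one_Linfty tensor_ae_class[OF f nu_domain.bounded_const]
  by (simp add: case_prod_unfold)

lemma J_star_monomorphism:
  "unital_star_monomorphism (Linfty torus) (Linfty torus_nu) (J_map :: (real ^ 'n \<Rightarrow> complex) set \<Rightarrow> _)"
  unfolding unital_star_monomorphism_def
proof
  show "unital_star_hom (Linfty torus) (Linfty torus_nu) (J_map :: (real ^ 'n \<Rightarrow> complex) set \<Rightarrow> _)"
    by (rule unital_star_hom_composition[OF torus.pointwise_domain_axioms torus_nu.pointwise_domain_axioms
          bounded_lift_fst J_map_ae_class])
  show "inj_on J_map (carrier (Linfty (torus :: (real ^ 'n) function_domain)))"
  proof (rule inj_onI)
    fix F G :: "(real ^ 'n \<Rightarrow> complex) set"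
    assume F: "F \<in> carrier (Linfty torus)" and G: "G \<in> carrier (Linfty torus)" and eq: "J_map F = J_map G"
    obtain f where f: "f \<in> bounded_functions torus" "F = ae_class torus f" using F by (rule torus.carrier_cases)
    obtain g where g: "g \<in> bounded_functions torus" "G = ae_class torus g" using G by (rule torus.carrier_cases)
    have "AE z in \<mu>. f (fst z) = g (fst z)"
      using eq unfolding f(2) g(2) J_map_ae_class[OF f(1)] J_map_ae_class[OF g(1)]
        torus_nu_class_eq_iff[OF bounded_lift_fst[OF f(1)] bounded_lift_fst[OF g(1)]] .
    from nu_mean_cong_AE[OF bounded_lift_fst[OF f(1)] bounded_lift_fst[OF g(1)] this]
    have "AE x in lborel. f x = g x" unfolding nu_mean_lift_fst .
    then show "F = G" unfolding f(2) g(2) torus_class_eq_iff[OF f(1) g(1)] .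
  qed
qed

lemma torus_predualE:
  assumes "\<omega> \<in> predual (Linfty torus)"
  obtains h where "\<omega> = pairing torus h" "h \<in> borel_measurable borel" "\<forall>x i. h (x + axis i 1) = h x"
    "set_integrable lborel (cbox 0 1) h"
  using assms unfolding torus.predual_Linfty torus_simps by auto

lemma torus_predualI:
  assumes "h \<in> borel_measurable borel" "\<And>x i. h (x + axis i 1) = h x" "set_integrable lborel (cbox 0 1) h"
  shows "pairing torus h \<in> predual (Linfty torus)"
  unfolding torus.predual_Linfty torus_simps using assms by auto

lemma torus_nu_predualE:
  assumes "\<omega> \<in> predual (Linfty torus_nu)"
  obtains h where "\<omega> = pairing torus_nu h" "h \<in> borel_measurable \<mu>"
    "\<forall>x i y. h (x + axis i 1, y) = h (x, y)" "set_integrable \<mu> (cbox 0 1 \<times> UNIV) h"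
  using assms unfolding torus_nu.predual_Linfty torus_nu_simps by blast

lemma torus_nu_predualI:
  assumes "h \<in> borel_measurable \<mu>"
    "\<And>x i y. h (x + axis i 1, y) = h (x, y)" "set_integrable \<mu> (cbox 0 1 \<times> UNIV) h"
  shows "pairing torus_nu h \<in> predual (Linfty torus_nu)"
  unfolding torus_nu.predual_Linfty torus_nu_simps using assms by blast

lemma torus_pairing:
  assumes "f \<in> bounded_functions torus" "h \<in> borel_measurable borel"
  shows "pairing torus h (ae_class torus f) = (LINT x:cbox 0 1|lborel. h x * f x)"
  using torus.pairing_ae_class[OF assms(1), of h] assms(2) by simp

lemma torus_nu_pairing:
  assumes "g \<in> bounded_functions torus_nu" "h \<in> borel_measurable \<mu>"
  shows "pairing torus_nu h (ae_class torus_nu g) = (LINT z:cbox 0 1 \<times> UNIV|\<mu>. h z * g z)"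
  using torus_nu.pairing_ae_class[OF assms(1), of h] assms(2) by simp

text \<open>The predual maps of the embedding and of the expectation are averaging and lifting of densities.\<close>

lemma pairing_J_map:
  fixes f :: "real ^ 'n \<Rightarrow> complex"
  assumes f: "f \<in> bounded_functions torus" and h: "h \<in> borel_measurable \<mu>"
    and int: "set_integrable \<mu> (cbox 0 1 \<times> UNIV) h"
  shows "pairing torus_nu h (J_map (ae_class torus f)) = pairing torus (nu_mean h) (ae_class torus f)"
proof -
  from bounded_lift_fst[OF f] obtain C where C: "(\<lambda>z. f (fst z)) \<in> borel_measurable \<mu>"
    "AE z in \<mu>. norm (f (fst z)) \<le> C" unfolding bounded_torus_nu_iff by auto
  have "pairing torus_nu h (J_map (ae_class torus f)) = (LINT x:cbox 0 1|lborel. nu_mean (\<lambda>z. h z * f (fst z)) x)"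
    unfolding J_map_ae_class[OF f] torus_nu_pairing[OF bounded_lift_fst[OF f] h]
    by (rule nu_mean_integral(2)[OF set_integrable_mult_bounded[OF int C]])
  then show ?thesis unfolding nu_mean_mult_fst torus_pairing[OF f nu_mean_measurable[OF h]] .
qed

lemma J_normal:
  "normal_map (Linfty torus) (Linfty torus_nu) (J_map :: (real ^ 'n \<Rightarrow> complex) set \<Rightarrow> _)"
proof (rule normal_mapI[OF torus.predual_nonempty torus_nu.predual_nonempty])
  show "J_map \<in> carrier (Linfty (torus :: (real ^ 'n) function_domain)) \<rightarrow> carrier (Linfty torus_nu)"
    using J_star_monomorphism unfolding unital_star_monomorphism_def unital_star_hom_def linear_map_def by blast
  fix \<omega> assume "\<omega> \<in> predual (Linfty (torus_nu :: ((real ^ 'n) \<times> (real ^ 'n)) function_domain))"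
  then obtain h where h: "\<omega> = pairing torus_nu h" "h \<in> borel_measurable \<mu>"
    "\<forall>x i y. h (x + axis i 1, y) = h (x, y)" "set_integrable \<mu> (cbox 0 1 \<times> UNIV) h"
    by (rule torus_nu_predualE)
  show "\<exists>\<omega>'\<in>predual (Linfty torus). \<forall>F\<in>carrier (Linfty torus). \<omega> (J_map F) = \<omega>' F"
  proof (intro bexI ballI)
    show "pairing torus (nu_mean h) \<in> predual (Linfty torus)"
      using h(3) by (intro torus_predualI nu_mean_measurable[OF h(2)] nu_mean_integral(1)[OF h(4)]) (simp add: nu_mean_def)
    fix F assume "F \<in> carrier (Linfty (torus :: (real ^ 'n) function_domain))"
    then obtain f where f: "f \<in> bounded_functions torus" "F = ae_class torus f" by (rule torus.carrier_cases)
    show "\<omega> (J_map F) = pairing torus (nu_mean h) F"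
      unfolding h(1) f(2) by (rule pairing_J_map[OF f(1) h(2) h(4)])
  qed
qed

lemma cube_integrable_const: "set_integrable lborel (cbox 0 1 :: (real ^ 'n) set) (\<lambda>_. 1 :: complex)"
  using cube_integrable_continuous[of "\<lambda>_. 1"] by (simp add: set_integrable_def)

lemma J_trace_preserving:
  "trace_preserving (Linfty torus) (Linfty torus_nu) (J_map :: (real ^ 'n \<Rightarrow> complex) set \<Rightarrow> _)"
  unfolding trace_preserving_def
proof
  fix F assume "F \<in> carrier (Linfty (torus :: (real ^ 'n) function_domain))"
  then obtain f where f: "f \<in> bounded_functions torus" "F = ae_class torus f" by (rule torus.carrier_cases)
  have "nu_mean (\<lambda>_. 1) = (\<lambda>x :: real ^ 'n. 1)" using nu_mean_lift_fst[of "\<lambda>_. 1"] by auto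
  then show "tr (Linfty torus_nu) (J_map F) = tr (Linfty torus) F"
    unfolding torus_nu.tr_Linfty torus.tr_Linfty f(2)
    using pairing_J_map[OF f(1) _ set_integrable_lift_fst[OF cube_integrable_const]] by simp
qed

section \<open>The conditional expectation\<close>

definition nu_expectation :: "((real ^ 'n) \<times> (real ^ 'n) \<Rightarrow> complex) set \<Rightarrow> (real ^ 'n \<Rightarrow> complex) set" where
  "nu_expectation = restrict (\<lambda>G. \<Union>g\<in>G. ae_class torus (nu_mean g)) (carrier (Linfty torus_nu))"

lemma nu_expectation_ae_class:
  assumes g: "g \<in> bounded_functions torus_nu"
  shows "nu_expectation (ae_class torus_nu g) = ae_class torus (nu_mean g)"
proof -
  have "(\<Union>g\<in>ae_class torus_nu g. ae_class torus (nu_mean g)) = ae_class torus (nu_mean g)"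
  proof (rule torus_nu.UN_ae_class[OF g])
    fix g' assume g': "g' \<in> bounded_functions torus_nu" and "AE z in meas torus_nu. g z = g' z"
    then have "AE z in \<mu>. g z = g' z" unfolding torus_nu_simps by simp
    from nu_mean_cong_AE[OF g g' this] show "ae_class torus (nu_mean g') = ae_class torus (nu_mean g)"
      by (subst torus_class_eq_iff[OF bounded_nu_mean[OF g'] bounded_nu_mean[OF g]]) (elim eventually_mono, simp)
  qed
  then show ?thesis
    unfolding nu_expectation_def using torus_nu.ae_class_in_carrier[OF g] by simp
qed

lemma nu_mean_add:
  assumes g: "g \<in> bounded_functions torus_nu" and g': "g' \<in> bounded_functions torus_nu"
  shows "AE x in lborel. nu_mean (\<lambda>z. g z + g' z) x = nu_mean g x + nu_mean g' x"
proof -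
  obtain C where C: "AE x in lborel. (AE y in nu_measure. norm (g (x, y)) \<le> C) \<and> integrable nu_measure (\<lambda>y. g (x, y))"
    by (rule bounded_sections[OF g])
  obtain D where D: "AE x in lborel. (AE y in nu_measure. norm (g' (x, y)) \<le> D) \<and> integrable nu_measure (\<lambda>y. g' (x, y))"
    by (rule bounded_sections[OF g'])
  from C D show ?thesis by eventually_elim (simp add: nu_mean_def)
qed

lemma nu_expectation_linear: "linear_map (Linfty torus_nu) (Linfty torus) nu_expectation"
  unfolding linear_map_def
proof (intro conjI ballI allI funcsetI)
  fix F :: "((real ^ 'n) \<times> (real ^ 'n) \<Rightarrow> complex) set"
  assume F: "F \<in> carrier (Linfty torus_nu)"
  obtain f where f: "f \<in> bounded_functions torus_nu" "F = ae_class torus_nu f" using F by (rule torus_nu.carrier_cases)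
  show "nu_expectation F \<in> carrier (Linfty torus)"
    unfolding f(2) nu_expectation_ae_class[OF f(1)] by (intro torus.ae_class_in_carrier bounded_nu_mean f(1))
  have "nu_mean (\<lambda>z. c * f z) = (\<lambda>x. c * nu_mean f x)" for c by (simp add: nu_mean_def[abs_def])
  then show "nu_expectation (c \<odot>\<^bsub>Linfty torus_nu\<^esub> F) = c \<odot>\<^bsub>Linfty torus\<^esub> nu_expectation F" for c
    unfolding f(2) torus_nu.smult_ae_class[OF f(1)] nu_expectation_ae_class[OF f(1)]
      nu_expectation_ae_class[OF torus_nu.bounded_scale[OF f(1)]] torus.smult_ae_class[OF bounded_nu_mean[OF f(1)]]
    by (simp only:)
  fix G :: "((real ^ 'n) \<times> (real ^ 'n) \<Rightarrow> complex) set"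
  assume G: "G \<in> carrier (Linfty torus_nu)"
  obtain g where g: "g \<in> bounded_functions torus_nu" "G = ae_class torus_nu g" using G by (rule torus_nu.carrier_cases)
  show "nu_expectation (F \<oplus>\<^bsub>Linfty torus_nu\<^esub> G) = nu_expectation F \<oplus>\<^bsub>Linfty torus\<^esub> nu_expectation G"
    unfolding f(2) g(2) torus_nu.add_ae_class[OF f(1) g(1)] nu_expectation_ae_class[OF f(1)] nu_expectation_ae_class[OF g(1)]
      nu_expectation_ae_class[OF torus_nu.bounded_add[OF f(1) g(1)]] torus.add_ae_class[OF bounded_nu_mean[OF f(1)] bounded_nu_mean[OF g(1)]]
      torus_class_eq_iff[OF bounded_nu_mean[OF torus_nu.bounded_add[OF f(1) g(1)]] torus.bounded_add[OF bounded_nu_mean[OF f(1)] bounded_nu_mean[OF g(1)]]]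
    by (rule nu_mean_add[OF f(1) g(1)])
qed

lemma nu_mean_square: "nu_mean (\<lambda>z. cnj (g z) * g z) x = of_real (LINT y|nu_measure. (norm (g (x, y)))\<^sup>2)"
proof -
  have "cnj (g (x, y)) * g (x, y) = of_real ((norm (g (x, y)))\<^sup>2)" for y
    by (simp only: complex_norm_square mult.commute)
  then show ?thesis unfolding nu_mean_def by (simp only: integral_complex_of_real)
qed

text \<open>
  Positive elements are of the form \<open>a\<^sup>* a\<close>, so a square root of the average of \<open>|g|\<^sup>2\<close> has to be exhibited.
\<close>

lemma nu_expectation_positive:
  assumes "F \<in> positive_elements (Linfty torus_nu)"
  shows "nu_expectation F \<in> positive_elements (Linfty torus)"
proof -
  obtain g where g: "g \<in> bounded_functions torus_nu" and F: "F = ae_class torus_nu (\<lambda>z. cnj (g z) * g z)"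
    using assms by (rule torus_nu.positive_cases)
  let ?k = "\<lambda>z. cnj (g z) * g z"
  have k: "?k \<in> bounded_functions torus_nu" by (intro torus_nu.bounded_mult torus_nu.bounded_cnj g)
  define a where "a x = complex_of_real (sqrt (Re (nu_mean ?k x)))" for x
  have "cnj (a x) * a x = nu_mean ?k x" for x
  proof -
    have "Re (nu_mean ?k x) \<ge> 0" unfolding nu_mean_square by simp
    then have "cnj (a x) * a x = of_real (Re (nu_mean ?k x))"
      unfolding a_def complex_cnj_complex_of_real of_real_mult[symmetric] by (simp only: real_sqrt_mult_self abs_of_nonneg)
    then show ?thesis unfolding nu_mean_square by (simp only: Re_complex_of_real)
  qed
  moreover have "a \<in> bounded_functions torus"
  proof -
    from bounded_nu_mean[OF k] obtain C where m [measurable]: "nu_mean ?k \<in> borel_measurable borel"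
      and per: "\<And>x i. nu_mean ?k (x + axis i 1) = nu_mean ?k x" and C: "AE x in lborel. norm (nu_mean ?k x) \<le> C"
      unfolding bounded_torus_iff by auto
    have "AE x in lborel. norm (a x) \<le> sqrt C"
      using C
    proof eventually_elim
      case (elim x)
      have "Re (nu_mean ?k x) \<ge> 0" unfolding nu_mean_square by simp
      moreover have "Re (nu_mean ?k x) \<le> C" using elim complex_Re_le_cmod order_trans by blast
      ultimately show ?case by (simp add: a_def)
    qed
    moreover have "a \<in> borel_measurable borel" unfolding a_def[abs_def] by measurable
    ultimately show ?thesis unfolding bounded_torus_iff by (auto simp: a_def per)
  qed
  ultimately show ?thesis
    using torus.positiveI[of a] unfolding F nu_expectation_ae_class[OF k] by (simp only:)
qed

lemma nu_expectation_faithful: "faithful_map (Linfty torus_nu) (Linfty torus) nu_expectation"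
  unfolding faithful_map_def
proof (intro ballI impI)
  fix F :: "((real ^ 'n) \<times> (real ^ 'n) \<Rightarrow> complex) set"
  assume "F \<in> positive_elements (Linfty torus_nu)" and zero: "nu_expectation F = \<zero>\<^bsub>Linfty torus\<^esub>"
  then obtain g where g: "g \<in> bounded_functions torus_nu" and F: "F = ae_class torus_nu (\<lambda>z. cnj (g z) * g z)"
    by (rule_tac torus_nu.positive_cases)
  let ?k = "\<lambda>z. cnj (g z) * g z"
  have k: "?k \<in> bounded_functions torus_nu" by (intro torus_nu.bounded_mult torus_nu.bounded_cnj g)
  have [measurable]: "g \<in> borel_measurable \<mu>" using g unfolding bounded_torus_nu_iff by simp
  have 0: "AE x in lborel. nu_mean ?k x = 0"
    using zero unfolding F nu_expectation_ae_class[OF k] torus.zero_Linfty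
      torus_class_eq_iff[OF bounded_nu_mean[OF k] torus.bounded_const] .
  obtain C where C: "AE x in lborel. (AE y in nu_measure. norm (?k (x, y)) \<le> C) \<and> integrable nu_measure (\<lambda>y. ?k (x, y))"
    by (rule bounded_sections[OF k])
  have "AE x in lborel. AE y in nu_measure. g (x, y) = 0"
    using 0 C
  proof eventually_elim
    case (elim x)
    have "integrable nu_measure (\<lambda>y. norm (?k (x, y)))" using elim(2) by (intro integrable_norm) blast
    moreover have "norm (?k (x, y)) = (norm (g (x, y)))\<^sup>2" for y by (simp add: norm_mult power2_eq_square)
    ultimately have int: "integrable nu_measure (\<lambda>y. (norm (g (x, y)))\<^sup>2)" by simp
    have "(LINT y|nu_measure. (norm (g (x, y)))\<^sup>2) = 0" using elim(1) unfolding nu_mean_square of_real_eq_0_iff .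
    then show "AE y in nu_measure. g (x, y) = 0"
      using integral_nonneg_eq_0_iff_AE[OF int] by simp
  qed
  then have "AE z in \<mu>. g z = 0"
    by (intro torus_pair.AE_pair_measure) measurable
  then have "AE z in \<mu>. ?k z = 0" by eventually_elim simp
  then show "F = \<zero>\<^bsub>Linfty torus_nu\<^esub>"
    unfolding F torus_nu.zero_Linfty torus_nu_class_eq_iff[OF k torus_nu.bounded_const] .
qed

lemma pairing_nu_expectation:
  fixes h :: "real ^ 'n \<Rightarrow> complex"
  assumes g: "g \<in> bounded_functions torus_nu" and h: "h \<in> borel_measurable borel" and int: "set_integrable lborel (cbox 0 1) h"
  shows "pairing torus h (nu_expectation (ae_class torus_nu g)) = pairing torus_nu (\<lambda>z. h (fst z)) (ae_class torus_nu g)"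
proof -
  from g obtain C where C: "g \<in> borel_measurable \<mu>"
    "AE z in \<mu>. norm (g z) \<le> C" unfolding bounded_torus_nu_iff by auto
  have "(\<lambda>z. h (fst z)) \<in> borel_measurable \<mu>"
    using h by measurable
  from torus_nu_pairing[OF g this]
  have "pairing torus_nu (\<lambda>z. h (fst z)) (ae_class torus_nu g) = (LINT x:cbox 0 1|lborel. nu_mean (\<lambda>z. h (fst z) * g z) x)"
    using nu_mean_integral(2)[OF set_integrable_mult_bounded[OF set_integrable_lift_fst[OF int] C]] by simp
  then show ?thesis
    unfolding nu_mean_mult_fst nu_expectation_ae_class[OF g] torus_pairing[OF bounded_nu_mean[OF g] h] by simp
qed

lemma nu_expectation_normal:
  "normal_map (Linfty torus_nu) (Linfty torus) (nu_expectation :: ((real ^ 'n) \<times> (real ^ 'n) \<Rightarrow> complex) set \<Rightarrow> _)"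
proof (rule normal_mapI[OF torus_nu.predual_nonempty torus.predual_nonempty])
  show "nu_expectation \<in> carrier (Linfty torus_nu) \<rightarrow> carrier (Linfty (torus :: (real ^ 'n) function_domain))"
    using nu_expectation_linear unfolding linear_map_def by blast
  fix \<omega> assume "\<omega> \<in> predual (Linfty (torus :: (real ^ 'n) function_domain))"
  then obtain h where h: "\<omega> = pairing torus h" "h \<in> borel_measurable borel" "\<forall>x i. h (x + axis i 1) = h x"
    "set_integrable lborel (cbox 0 1) h"
    by (rule torus_predualE)
  show "\<exists>\<omega>'\<in>predual (Linfty torus_nu). \<forall>F\<in>carrier (Linfty torus_nu). \<omega> (nu_expectation F) = \<omega>' F"
  proof (intro bexI ballI)
    have "(\<lambda>z. h (fst z)) \<in> borel_measurable \<mu>"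
      using h(2) by measurable
    then show "pairing torus_nu (\<lambda>z. h (fst z)) \<in> predual (Linfty torus_nu)"
      using h(3) by (intro torus_nu_predualI set_integrable_lift_fst[OF h(4)]) simp_all
    fix F assume "F \<in> carrier (Linfty (torus_nu :: ((real ^ 'n) \<times> (real ^ 'n)) function_domain))"
    then obtain g where g: "g \<in> bounded_functions torus_nu" "F = ae_class torus_nu g" by (rule torus_nu.carrier_cases)
    show "\<omega> (nu_expectation F) = pairing torus_nu (\<lambda>z. h (fst z)) F"
      unfolding h(1) g(2) by (rule pairing_nu_expectation[OF g(1) h(2) h(4)])
  qed
qed

lemma nu_expectation_trace_preserving:
  "trace_preserving (Linfty torus_nu) (Linfty torus) (nu_expectation :: ((real ^ 'n) \<times> (real ^ 'n) \<Rightarrow> complex) set \<Rightarrow> _)"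
  unfolding trace_preserving_def
proof
  fix F assume "F \<in> carrier (Linfty (torus_nu :: ((real ^ 'n) \<times> (real ^ 'n)) function_domain))"
  then obtain g where g: "g \<in> bounded_functions torus_nu" "F = ae_class torus_nu g" by (rule torus_nu.carrier_cases)
  show "tr (Linfty torus) (nu_expectation F) = tr (Linfty torus_nu) F"
    unfolding torus_nu.tr_Linfty torus.tr_Linfty g(2)
    by (rule pairing_nu_expectation[OF g(1) _ cube_integrable_const]) simp
qed

lemma nu_expectation_J_map:
  assumes f: "f \<in> bounded_functions torus"
  shows "nu_expectation (J_map (ae_class torus f)) = ae_class torus f"
  unfolding J_map_ae_class[OF f] nu_expectation_ae_class[OF bounded_lift_fst[OF f]] nu_mean_lift_fst ..

lemma nu_expectation_bimodule:
  assumes a: "a \<in> bounded_functions torus" and b: "b \<in> bounded_functions torus" and g: "g \<in> bounded_functions torus_nu"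
  shows "nu_expectation (J_map (ae_class torus a) \<otimes>\<^bsub>Linfty torus_nu\<^esub> ae_class torus_nu g \<otimes>\<^bsub>Linfty torus_nu\<^esub> J_map (ae_class torus b))
    = ae_class torus a \<otimes>\<^bsub>Linfty torus\<^esub> nu_expectation (ae_class torus_nu g) \<otimes>\<^bsub>Linfty torus\<^esub> ae_class torus b"
proof -
  note ab = bounded_lift_fst[OF a] bounded_lift_fst[OF b]
  note ag = torus_nu.bounded_mult[OF ab(1) g]
  note am = torus.bounded_mult[OF a bounded_nu_mean[OF g]]
  have "nu_mean (\<lambda>z. a (fst z) * g z * b (fst z)) = (\<lambda>x. a x * nu_mean g x * b x)"
    using nu_mean_mult_fst(2)[of "\<lambda>z. a (fst z) * g z" b] nu_mean_mult_fst(1)[of a g] by (intro ext) (simp only:)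
  then show ?thesis
    unfolding J_map_ae_class[OF a] J_map_ae_class[OF b] torus_nu.mult_ae_class[OF ab(1) g] torus_nu.mult_ae_class[OF ag ab(2)]
      nu_expectation_ae_class[OF torus_nu.bounded_mult[OF ag ab(2)]] nu_expectation_ae_class[OF g]
      torus.mult_ae_class[OF a bounded_nu_mean[OF g]] torus.mult_ae_class[OF am b]
    by (simp only:)
qed

lemma is_E_map_nu_expectation: "is_E_map (nu_expectation :: ((real ^ 'n) \<times> (real ^ 'n) \<Rightarrow> complex) set \<Rightarrow> _)"
  unfolding is_E_map_def N_algebra_eq torus_algebra_def nu_algebra_def conditional_expectation_def
proof (intro conjI ballI)
  show "nu_expectation \<in> extensional (carrier (Linfty torus_nu))" by (simp add: nu_expectation_def)
  show "linear_map (Linfty torus_nu) (Linfty torus) nu_expectation" by (rule nu_expectation_linear)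
  show "nu_expectation F \<in> positive_elements (Linfty torus)" if "F \<in> positive_elements (Linfty torus_nu)"
    for F :: "((real ^ 'n) \<times> (real ^ 'n) \<Rightarrow> complex) set"
    using that by (rule nu_expectation_positive)
  show "trace_preserving (Linfty torus_nu) (Linfty torus) nu_expectation" by (rule nu_expectation_trace_preserving)
  show "normal_map (Linfty torus_nu) (Linfty torus) nu_expectation" by (rule nu_expectation_normal)
  show "faithful_map (Linfty torus_nu) (Linfty torus) nu_expectation" by (rule nu_expectation_faithful)
  fix F :: "(real ^ 'n \<Rightarrow> complex) set" assume "F \<in> carrier (Linfty torus)"
  then obtain f where f: "f \<in> bounded_functions torus" "F = ae_class torus f" by (rule torus.carrier_cases)
  show "nu_expectation (J_map F) = F" unfolding f(2) by (rule nu_expectation_J_map[OF f(1)])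
  {
    fix G :: "(real ^ 'n \<Rightarrow> complex) set" assume "G \<in> carrier (Linfty torus)"
    then obtain b where b: "b \<in> bounded_functions torus" "G = ae_class torus b" by (rule torus.carrier_cases)
    fix H :: "((real ^ 'n) \<times> (real ^ 'n) \<Rightarrow> complex) set" assume "H \<in> carrier (Linfty torus_nu)"
    then obtain g where g: "g \<in> bounded_functions torus_nu" "H = ae_class torus_nu g" by (rule torus_nu.carrier_cases)
    show "nu_expectation (J_map F \<otimes>\<^bsub>Linfty torus_nu\<^esub> H \<otimes>\<^bsub>Linfty torus_nu\<^esub> J_map G) = F \<otimes>\<^bsub>Linfty torus\<^esub> nu_expectation H \<otimes>\<^bsub>Linfty torus\<^esub> G"
      unfolding f(2) b(2) g(2) by (rule nu_expectation_bimodule[OF f(1) b(1) g(1)])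
  }
  fix G :: "(real ^ 'n \<Rightarrow> complex) set" assume "G \<in> carrier (Linfty nu_domain)"
  then obtain g where g: "g \<in> bounded_functions nu_domain" "G = ae_class nu_domain g" by (rule nu_domain.carrier_cases)
  have "nu_mean (\<lambda>(x, y). f x * g y) = (\<lambda>x. (LINT y|nu_measure. g y) * f x)"
    by (simp add: nu_mean_def[abs_def] mult.commute)
  moreover have "tr (Linfty nu_domain) G = (LINT y|nu_measure. g y)"
    unfolding nu_domain.tr_Linfty g(2) using nu_domain.pairing_ae_class[OF g(1), of "\<lambda>_. 1"]
    by (simp add: set_lebesgue_integral_def)
  ultimately show "nu_expectation (tensor torus nu_domain F G) = tr (Linfty nu_domain) G \<odot>\<^bsub>Linfty torus\<^esub> F"
    unfolding f(2) g(2) tensor_ae_class[OF f(1) g(1)] nu_expectation_ae_class[OF bounded_tensor[OF f(1) g(1)]]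
      torus.smult_ae_class[OF f(1)] by (simp only:)
qed

section \<open>Uniqueness of the conditional expectation\<close>

text \<open>
  Countably many integer translates of the cube cover the space.
\<close>

lemma AE_periodic:
  fixes Q :: "real ^ 'n \<Rightarrow> bool"
  assumes per: "\<And>x i. Q (x + axis i 1) = Q x" and ae: "AE x in lborel. x \<in> cbox 0 1 \<longrightarrow> Q x"
  shows "AE x in lborel. Q x"
proof -
  let ?S = "range (\<lambda>m :: 'n \<Rightarrow> int. \<chi> i. real_of_int (m i))"
  have "AE x in lborel. x + a \<in> cbox 0 1 \<longrightarrow> Q (x + a)" for a :: "real ^ 'n"
    using AE_lborel_affine[of 1 "\<lambda>x. x \<in> cbox 0 1 \<longrightarrow> Q x" a] ae by (simp add: add.commute)
  moreover have "countable ?S" by (intro countable_image) simp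
  ultimately have "AE x in lborel. \<forall>a\<in>?S. x + a \<in> cbox 0 1 \<longrightarrow> Q (x + a)"
    by (subst AE_ball_countable) auto
  then show ?thesis
  proof eventually_elim
    case (elim x)
    let ?m = "\<lambda>i. - \<lfloor>x $ i\<rfloor>"
    let ?a = "\<chi> i. real_of_int (?m i)"
    have "x + ?a \<in> cbox 0 1"
      by (auto simp: mem_box_cart) linarith
    moreover have "?a \<in> ?S" by (rule range_eqI[of _ _ ?m]) simp
    ultimately have "Q (x + ?a)" using elim by blast
    moreover have "Q (x + ?a) = Q x" by (rule periodic_integer_shift[OF per]) simp
    ultimately show ?case by simp
  qed
qed

lemma bounded_set_integrable_cube:
  assumes f: "f \<in> bounded_functions torus"
  shows "set_integrable lborel (cbox 0 1) f"
proof -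
  from f obtain C where "f \<in> borel_measurable lborel" "AE x in lborel. norm (f x) \<le> C" unfolding bounded_torus_iff by auto
  from set_integrable_mult_bounded[OF cube_integrable_const this] show ?thesis by simp
qed

text \<open>
  The cube has finite volume, so the conjugate of the bounded function \<open>f - g\<close> is itself an admissible
  density; its pairing with \<open>f - g\<close> is the integral of \<open>|f - g|\<^sup>2\<close>.
\<close>

lemma torus_predual_separates:
  fixes F G :: "(real ^ 'n \<Rightarrow> complex) set"
  assumes F: "F \<in> carrier (Linfty torus)" and G: "G \<in> carrier (Linfty torus)"
    and eq: "\<And>\<omega>. \<omega> \<in> predual (Linfty torus) \<Longrightarrow> \<omega> F = \<omega> G"
  shows "F = G"
proof -
  obtain f where f: "f \<in> bounded_functions torus" "F = ae_class torus f" using F by (rule torus.carrier_cases)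
  obtain g where g: "g \<in> bounded_functions torus" "G = ae_class torus g" using G by (rule torus.carrier_cases)
  define d where "d x = f x + (-1) * g x" for x
  have d: "d \<in> bounded_functions torus"
    unfolding d_def[abs_def] by (intro torus.bounded_add torus.bounded_scale f g)
  let ?h = "\<lambda>x. cnj (d x)"
  have h: "?h \<in> bounded_functions torus" by (rule torus.bounded_cnj[OF d])
  then have h_meas: "?h \<in> borel_measurable borel" and h_per: "\<And>x i. ?h (x + axis i 1) = ?h x"
    unfolding bounded_torus_iff by auto
  have "pairing torus ?h \<in> predual (Linfty torus)"
    by (intro torus_predualI h_meas h_per bounded_set_integrable_cube h)
  from eq[OF this] have eq': "(LINT x:cbox 0 1|lborel. ?h x * f x) = (LINT x:cbox 0 1|lborel. ?h x * g x)"
    unfolding f(2) g(2) torus_pairing[OF f(1) h_meas] torus_pairing[OF g(1) h_meas] .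
  have int: "set_integrable lborel (cbox 0 1) (\<lambda>x. ?h x * u x)" if "u \<in> bounded_functions torus" for u
    by (intro bounded_set_integrable_cube torus.bounded_mult h that)
  have "(LINT x:cbox 0 1|lborel. ?h x * f x - ?h x * g x) = 0"
    using eq' by (subst set_integral_diff(2)[OF int[OF f(1)] int[OF g(1)]]) simp
  moreover have "?h x * f x - ?h x * g x = of_real ((norm (d x))\<^sup>2)" for x
  proof -
    have "?h x * f x - ?h x * g x = d x * cnj (d x)" by (simp add: d_def algebra_simps)
    then show ?thesis by (simp only: complex_norm_square)
  qed
  ultimately have "(\<integral>x. complex_of_real (indicator (cbox 0 1) x * (norm (d x))\<^sup>2) \<partial>lborel) = 0"
    by (simp add: set_lebesgue_integral_def scaleR_conv_of_real)
  then have 0: "(\<integral>x. indicator (cbox 0 1) x * (norm (d x))\<^sup>2 \<partial>lborel) = 0"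
    unfolding integral_complex_of_real of_real_eq_0_iff .
  have "integrable lborel (\<lambda>x. norm (indicator (cbox 0 1) x *\<^sub>R (?h x * d x)))"
    using int[OF d] unfolding set_integrable_def by (rule integrable_norm)
  moreover have norm_eq: "norm (indicator (cbox 0 1) x *\<^sub>R (?h x * d x)) = indicator (cbox 0 1) x * (norm (d x))\<^sup>2" for x
    by (simp add: norm_mult power2_eq_square)
  ultimately have "integrable lborel (\<lambda>x. indicator (cbox 0 1) x * (norm (d x))\<^sup>2)" by (simp only:)
  from integral_nonneg_eq_0_iff_AE[OF this] 0
  have "AE x in lborel. indicator (cbox 0 1) x * (norm (d x))\<^sup>2 = 0" by simp
  then have "AE x in lborel. x \<in> cbox 0 1 \<longrightarrow> f x = g x"
    by eventually_elim (auto simp: d_def)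
  then have "AE x in lborel. f x = g x"
  proof (rule AE_periodic[rotated])
    show "(f (x + axis i 1) = g (x + axis i 1)) = (f x = g x)" for x i
      using f(1) g(1) unfolding bounded_torus_iff by simp
  qed
  then show ?thesis unfolding f(2) g(2) torus_class_eq_iff[OF f(1) g(1)] .
qed

lemma is_E_mapD:
  fixes E :: "((real ^ 'n) \<times> (real ^ 'n) \<Rightarrow> complex) set \<Rightarrow> (real ^ 'n \<Rightarrow> complex) set"
  assumes "is_E_map E"
  shows "E \<in> extensional (carrier (Linfty torus_nu))"
    and "F \<in> carrier (Linfty torus_nu) \<Longrightarrow> E F \<in> carrier (Linfty torus)"
    and "F \<in> carrier (Linfty torus_nu) \<Longrightarrow> G \<in> carrier (Linfty torus_nu) \<Longrightarrow>
      E (F \<oplus>\<^bsub>Linfty torus_nu\<^esub> G) = E F \<oplus>\<^bsub>Linfty torus\<^esub> E G"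
    and "F \<in> carrier (Linfty torus_nu) \<Longrightarrow> E (c \<odot>\<^bsub>Linfty torus_nu\<^esub> F) = c \<odot>\<^bsub>Linfty torus\<^esub> E F"
    and "normal_map (Linfty torus_nu) (Linfty torus) E"
    and "A \<in> carrier (Linfty torus) \<Longrightarrow> B \<in> carrier (Linfty nu_domain) \<Longrightarrow>
      E (tensor torus nu_domain A B) = tr (Linfty nu_domain) B \<odot>\<^bsub>Linfty torus\<^esub> A"
proof -
  note E = assms[unfolded is_E_map_def conditional_expectation_def N_algebra_eq torus_algebra_def nu_algebra_def]
  show "E \<in> extensional (carrier (Linfty torus_nu))" "normal_map (Linfty torus_nu) (Linfty torus) E"
    using E by simp_all
  show "A \<in> carrier (Linfty torus) \<Longrightarrow> B \<in> carrier (Linfty nu_domain) \<Longrightarrow>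
      E (tensor torus nu_domain A B) = tr (Linfty nu_domain) B \<odot>\<^bsub>Linfty torus\<^esub> A"
    using E by simp
  have lin: "linear_map (Linfty torus_nu) (Linfty torus) E" using E by simp
  show "F \<in> carrier (Linfty torus_nu) \<Longrightarrow> E F \<in> carrier (Linfty torus)"
    "F \<in> carrier (Linfty torus_nu) \<Longrightarrow> G \<in> carrier (Linfty torus_nu) \<Longrightarrow>
      E (F \<oplus>\<^bsub>Linfty torus_nu\<^esub> G) = E F \<oplus>\<^bsub>Linfty torus\<^esub> E G"
    "F \<in> carrier (Linfty torus_nu) \<Longrightarrow> E (c \<odot>\<^bsub>Linfty torus_nu\<^esub> F) = c \<odot>\<^bsub>Linfty torus\<^esub> E F"
    using lin unfolding linear_map_def by (simp_all add: Pi_iff)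
qed

text \<open>
  The values on elementary tensors are prescribed, so two candidates agree on a weak* dense subspace.
  Normality extends this to the whole algebra after composing with any functional of the predual, and
  these functionals separate points.
\<close>

lemma is_E_map_unique:
  fixes E' :: "((real ^ 'n) \<times> (real ^ 'n) \<Rightarrow> complex) set \<Rightarrow> (real ^ 'n \<Rightarrow> complex) set"
  assumes E: "is_E_map E" and E': "is_E_map E'"
  shows "E' = E"
proof (rule extensionalityI)
  let ?L = "Linfty (torus_nu :: ((real ^ 'n) \<times> (real ^ 'n)) function_domain)"
  let ?M = "Linfty (torus :: (real ^ 'n) function_domain)"
  show "E \<in> extensional (carrier ?L)" "E' \<in> extensional (carrier ?L)"
    by (rule is_E_mapD(1)[OF E], rule is_E_mapD(1)[OF E'])
  fix F assume F: "F \<in> carrier ?L"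
  have span: "E' G = E G" if "G \<in> linear_span ?L elementary_tensors" for G
    using that
  proof induction
    case zero
    have zero_eq: "\<zero>\<^bsub>?L\<^esub> = 0 \<odot>\<^bsub>?L\<^esub> \<one>\<^bsub>?L\<^esub>"
      by (simp add: torus_nu.zero_Linfty torus_nu.one_Linfty torus_nu.smult_ae_class torus_nu.bounded_const)
    have one: "\<one>\<^bsub>?L\<^esub> \<in> carrier ?L"
      by (simp add: torus_nu.one_Linfty torus_nu.ae_class_in_carrier torus_nu.bounded_const)
    have vanish: "E'' (0 \<odot>\<^bsub>?L\<^esub> \<one>\<^bsub>?L\<^esub>) = \<zero>\<^bsub>?M\<^esub>" if "is_E_map E''" for E''
    proof -
      note lin = is_E_mapD(4)[OF that one, of 0] is_E_mapD(2)[OF that one]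
      from lin(2) obtain f where "f \<in> bounded_functions torus" "E'' \<one>\<^bsub>?L\<^esub> = ae_class torus f" by (rule torus.carrier_cases)
      then show ?thesis unfolding lin(1) by (simp add: torus.smult_ae_class torus.zero_Linfty)
    qed
    show ?case unfolding zero_eq vanish[OF E] vanish[OF E'] ..
  next
    case (add s v c)
    have s: "s \<in> carrier ?L" using add(1) elementary_tensors_carrier by blast
    have v: "v \<in> carrier ?L" by (rule torus_nu.linear_span_carrier[OF elementary_tensors_carrier add(2)])
    have cs: "c \<odot>\<^bsub>?L\<^esub> s \<in> carrier ?L"
      using s by (elim torus_nu.carrier_cases) (simp add: torus_nu.smult_ae_class torus_nu.ae_class_in_carrier torus_nu.bounded_scale)
    have lin: "E'' (c \<odot>\<^bsub>?L\<^esub> s \<oplus>\<^bsub>?L\<^esub> v) = c \<odot>\<^bsub>?M\<^esub> E'' s \<oplus>\<^bsub>?M\<^esub> E'' v" if "is_E_map E''" for E''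
      unfolding is_E_mapD(3)[OF that cs v] is_E_mapD(4)[OF that s] ..
    have "E' s = E s"
      using add(1) is_E_mapD(6)[OF E] is_E_mapD(6)[OF E'] unfolding elementary_tensors_def by auto
    then show ?case unfolding lin[OF E] lin[OF E'] add.IH by simp
  qed
  show "E' F = E F"
  proof (rule torus_predual_separates)
    show "E' F \<in> carrier ?M" "E F \<in> carrier ?M" by (rule is_E_mapD(2)[OF E' F], rule is_E_mapD(2)[OF E F])
    fix \<omega> assume \<omega>: "\<omega> \<in> predual ?M"
    have cont: "continuous_map (weak_star_topology ?L) euclidean (\<omega> \<circ> E'')" if "is_E_map E''" for E''
      using is_E_mapD(5)[OF that] unfolding normal_map_def
      by (rule continuous_map_compose[OF _ continuous_map_predual[OF \<omega>]])
    have "(\<omega> \<circ> E') F = (\<omega> \<circ> E) F"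
    proof (rule forall_in_closure_of_eq[OF _ _ cont[OF E'] cont[OF E]])
      show "F \<in> weak_star_topology ?L closure_of linear_span ?L elementary_tensors"
        unfolding tensors_weak_star_dense by (rule F)
      show "Hausdorff_space (euclidean :: complex topology)" by (rule Hausdorff_space_euclidean)
    qed (simp add: span)
    then show "\<omega> (E' F) = \<omega> (E F)" by simp
  qed
qed

lemma E_map_eq: "E_map = nu_expectation"
  unfolding E_map_def
  by (rule the_equality) (rule is_E_map_nu_expectation, erule is_E_map_unique[OF is_E_map_nu_expectation])

section \<open>The group\<close>

lemma U_map_ae_class:
  assumes g: "g \<in> bounded_functions torus_nu"
  shows "U_map t (ae_class torus_nu g) = ae_class torus_nu (\<lambda>z. g (shear t z))"
proof -
  have "(\<Union>g\<in>ae_class torus_nu g. ae_class torus_nu (\<lambda>z. g (shear t z))) = ae_class torus_nu (\<lambda>z. g (shear t z))"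
  proof (rule torus_nu.UN_ae_class[OF g])
    fix g' assume g': "g' \<in> bounded_functions torus_nu" and "AE z in meas torus_nu. g z = g' z"
    then have "AE z in \<mu>. g z = g' z" unfolding torus_nu_simps by simp
    from AE_shear[OF this, of t]
    show "ae_class torus_nu (\<lambda>z. g' (shear t z)) = ae_class torus_nu (\<lambda>z. g (shear t z))"
      by (subst torus_nu_class_eq_iff[OF bounded_shear[OF g'] bounded_shear[OF g]]) (elim eventually_mono, simp)
  qed
  then show ?thesis by (simp add: U_map_def shear_def case_prod_unfold)
qed

lemma U_star_hom: "unital_star_hom (Linfty torus_nu) (Linfty torus_nu) (U_map t)"
  by (rule unital_star_hom_composition[OF torus_nu.pointwise_domain_axioms torus_nu.pointwise_domain_axioms
        bounded_shear U_map_ae_class])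

lemma U_map_carrier: "F \<in> carrier (Linfty torus_nu) \<Longrightarrow> U_map t F \<in> carrier (Linfty torus_nu)"
  using U_star_hom[of t] unfolding unital_star_hom_def linear_map_def by blast

lemma U_map_0: "F \<in> carrier (Linfty torus_nu) \<Longrightarrow> U_map 0 F = F"
  by (elim torus_nu.carrier_cases) (simp add: U_map_ae_class)

lemma U_map_add:
  assumes "F \<in> carrier (Linfty torus_nu)"
  shows "U_map (s + t) F = U_map s (U_map t F)"
proof -
  obtain g where g: "g \<in> bounded_functions torus_nu" "F = ae_class torus_nu g" using assms by (rule torus_nu.carrier_cases)
  show ?thesis
    unfolding g(2) U_map_ae_class[OF g(1)] U_map_ae_class[OF bounded_shear[OF g(1)]] shear_shear
    by (simp only: add.commute)
qed

lemma U_star_automorphism: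
  "star_automorphism (Linfty (torus_nu :: ((real ^ 'n) \<times> (real ^ 'n)) function_domain)) (U_map t)"
  unfolding star_automorphism_def
proof (rule conjI[OF U_star_hom])
  show "bij_betw (U_map t) (carrier (Linfty (torus_nu :: ((real ^ 'n) \<times> (real ^ 'n)) function_domain))) (carrier (Linfty torus_nu))"
  proof (rule bij_betw_byWitness[where f' = "U_map (- t)"])
    have cancel: "U_map r (U_map s F) = F" if "r + s = 0" "F \<in> carrier (Linfty torus_nu)" for r s and F :: "((real ^ 'n) \<times> (real ^ 'n) \<Rightarrow> complex) set"
      unfolding U_map_add[OF that(2), symmetric] that(1) by (rule U_map_0[OF that(2)])
    show "\<forall>F\<in>carrier (Linfty (torus_nu :: ((real ^ 'n) \<times> (real ^ 'n)) function_domain)). U_map (- t) (U_map t F) = F"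
      by (intro ballI cancel) simp_all
    show "\<forall>F\<in>carrier (Linfty (torus_nu :: ((real ^ 'n) \<times> (real ^ 'n)) function_domain)). U_map t (U_map (- t) F) = F"
      by (intro ballI cancel) simp_all
  qed (auto intro: U_map_carrier)
qed

lemma pairing_cube_nu:
  assumes "g \<in> bounded_functions torus_nu" "h \<in> borel_measurable \<mu>"
  shows "pairing torus_nu h (ae_class torus_nu g) = (\<integral>z. h z * g z \<partial>cube_nu)"
proof -
  have "(\<lambda>z. h z * g z) \<in> borel_measurable \<mu>"
    using assms unfolding bounded_torus_nu_iff by (intro borel_measurable_times) auto
  then show ?thesis
    unfolding torus_nu_pairing[OF assms] by (rule integral_cube_nu(1)[symmetric])
qed

lemma periodic_shear:
  assumes "\<And>x i y. k (x + axis i 1, y) = k (x, y)"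
  shows "k (shear t (x + axis i 1, y)) = k (shear t (x, y))"
proof -
  have "shear t (x + axis i 1, y) = (x - t *\<^sub>R y + axis i 1, y)" by (simp add: shear_def)
  then have "k (shear t (x + axis i 1, y)) = k (x - t *\<^sub>R y + axis i 1, y)" by (rule arg_cong)
  also have "\<dots> = k (shear t (x, y))" unfolding assms by (simp add: shear_def)
  finally show ?thesis .
qed

lemma U_trace_preserving: "trace_preserving (Linfty torus_nu) (Linfty torus_nu) (U_map t)"
  unfolding trace_preserving_def
proof
  fix F assume "F \<in> carrier (Linfty (torus_nu :: ((real ^ 'n) \<times> (real ^ 'n)) function_domain))"
  then obtain g where g: "g \<in> bounded_functions torus_nu" "F = ae_class torus_nu g" by (rule torus_nu.carrier_cases)
  have "(\<integral>z. 1 * g (shear t z) \<partial>cube_nu) = (\<integral>z. 1 * g z \<partial>cube_nu)"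
    using g(1) unfolding bounded_torus_nu_iff mult_1 by (intro integral_shear(1)) auto
  then show "tr (Linfty torus_nu) (U_map t F) = tr (Linfty torus_nu) F"
    unfolding torus_nu.tr_Linfty g(2) U_map_ae_class[OF g(1)]
    using pairing_cube_nu[OF g(1), of "\<lambda>_. 1"] pairing_cube_nu[OF bounded_shear[OF g(1)], of "\<lambda>_. 1" t] by simp
qed

lemma finite_measure_cube_nu: "finite_measure (cube_nu :: ((real ^ 'n) \<times> (real ^ 'n)) measure)"
proof (rule finite_measureI)
  have "integrable cube_nu (\<lambda>_ :: (real ^ 'n) \<times> (real ^ 'n). 1 :: complex)"
    by (subst integral_cube_nu(2)) (auto intro: set_integrable_lift_fst[OF cube_integrable_const])
  then show "emeasure cube_nu (space (cube_nu :: ((real ^ 'n) \<times> (real ^ 'n)) measure)) \<noteq> \<infinity>"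
    unfolding integrable_iff_bounded by simp
qed

text \<open>
  Translates of a bounded measurable \<open>g\<close> need not converge in norm, so the group is moved to the density
  \<open>h\<close>.  If \<open>h\<close> is a bounded continuous function \<open>\<phi>\<close> of the torus coordinates and \<open>y\<close>, dominated
  convergence applies.  In general \<open>h\<close> is an \<open>L\<^sup>1\<close> limit of such functions, and since shearing preserves the
  \<open>L\<^sup>1\<close> distance the pairings converge uniformly in \<open>t\<close>.
\<close>

lemma U_weak_star_continuous:
  assumes g: "g \<in> bounded_functions torus_nu" and h: "h \<in> borel_measurable \<mu>"
    and per: "\<And>x i y. h (x + axis i 1, y) = h (x, y)"
    and int: "set_integrable \<mu> (cbox 0 1 \<times> UNIV) h"
  shows "continuous_on UNIV (\<lambda>t. pairing torus_nu h (U_map t (ae_class torus_nu (g :: (real ^ 'n) \<times> (real ^ 'n) \<Rightarrow> complex))))"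
proof -
  interpret finite_measure "cube_nu :: ((real ^ 'n) \<times> (real ^ 'n)) measure" by (rule finite_measure_cube_nu)
  have g_meas: "g \<in> borel_measurable \<mu>" and g_per: "\<And>x i y. g (x + axis i 1, y) = g (x, y)"
    using g unfolding bounded_torus_nu_iff by auto
  obtain C where "AE z in \<mu>. norm (g z) \<le> C" using g unfolding bounded_torus_nu_iff by auto
  from AE_cube_nu[OF this] have C: "AE z in cube_nu. norm (g z) \<le> C" .
  have g_cube: "g \<in> borel_measurable cube_nu" and h_cube: "h \<in> borel_measurable cube_nu"
    using g_meas h by (simp_all only: measurable_cong_sets[OF sets_cube_nu refl])
  have h_int: "integrable cube_nu h" using int unfolding integral_cube_nu(2)[OF h] .
  have shear_cube: "(\<lambda>z. k (shear t z)) \<in> borel_measurable cube_nu" if "k \<in> borel_measurable \<mu>"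
    for k :: "(real ^ 'n) \<times> (real ^ 'n) \<Rightarrow> complex" and t
    using measurable_compose[OF shear_measurable that] by (simp only: measurable_cong_sets[OF sets_cube_nu refl])
  have hs_int: "integrable cube_nu (\<lambda>z. h (shear t z))" for t
    using h_int by (subst integral_shear(2)[OF h per])
  have mult_int: "integrable cube_nu (\<lambda>z. k z * g z)" if k: "integrable cube_nu k" for k
    by (rule integrable_mult_bounded[OF k g_cube C])
  \<comment> \<open>The group is moved to the density, which can be approximated.\<close>
  have dual: "pairing torus_nu h (U_map t (ae_class torus_nu g)) = (\<integral>z. h (shear (- t) z) * g z \<partial>cube_nu)" for t
  proof -
    let ?k = "\<lambda>z. h (shear (- t) z) * g z"
    have "?k \<in> borel_measurable \<mu>"
      by (intro borel_measurable_times g_meas measurable_compose[OF shear_measurable h])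
    moreover have "?k (x + axis i 1, y) = ?k (x, y)" for x i y
      using periodic_shear[of h, OF per] g_per by simp
    ultimately have "(\<integral>z. ?k (shear t z) \<partial>cube_nu) = (\<integral>z. ?k z \<partial>cube_nu)" by (rule integral_shear(1))
    then show ?thesis
      unfolding U_map_ae_class[OF g] pairing_cube_nu[OF bounded_shear[OF g] h] shear_shear by simp
  qed
  let ?q = "\<lambda>t (z :: (real ^ 'n) \<times> (real ^ 'n)). (torus_coords (fst (shear t z)), snd z)"
  have q_cube: "?q t \<in> borel_measurable cube_nu" for t
    using shear_coords_measurable[of t] by (simp only: measurable_cong_sets[OF sets_cube_nu refl])
  let ?H = "\<lambda>w. h (torus_point (fst w), snd w)"
  have H: "?H \<in> borel_measurable borel"
  proof -
    have "(\<lambda>z. (torus_point (fst z), snd z)) \<in> borel \<Otimes>\<^sub>M borel \<rightarrow>\<^sub>M \<mu>"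
      by measurable
    from measurable_compose[OF this h] show ?thesis by (simp add: borel_prod)
  qed
  let ?approx = "\<lambda>n \<phi>. continuous_on UNIV \<phi> \<and> bounded (range \<phi>) \<and> (\<integral>z. norm (h z - \<phi> (?q 0 z)) \<partial>cube_nu) < inverse (real (Suc n))"
  have "\<exists>\<phi>. continuous_on UNIV \<phi> \<and> bounded (range \<phi>) \<and> (\<integral>z. norm (h z - \<phi> (?q 0 z)) \<partial>cube_nu) < inverse (real (Suc n))" for n
  proof -
    have hH: "h z = ?H (?q 0 z)" for z
      using periodic_torus_point[of "\<lambda>x. h (x, snd z)" "fst z", OF per] by simp
    show ?thesis
      by (rule L1_approximable_pullback[OF finite_measure_cube_nu q_cube H hH h_int, of "inverse (real (Suc n))"]) auto
  qed
  then have "\<forall>n. \<exists>\<phi>. ?approx n \<phi>" by (rule allI)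
  from choice[OF this] obtain \<phi> where "\<forall>n. ?approx n (\<phi> n)" by (rule exE)
  then have approx: "?approx n (\<phi> n)" for n by (rule spec)
  note \<phi> = conjunct1[OF approx] conjunct1[OF conjunct2[OF approx]] and close = conjunct2[OF conjunct2[OF approx]]
  have \<phi>_meas: "\<phi> n \<in> borel_measurable borel" for n by (rule borel_measurable_continuous_onI[OF \<phi>(1)])
  have \<phi>q_meas: "(\<lambda>z. \<phi> n (?q t z)) \<in> borel_measurable cube_nu" for n t
    by (rule measurable_compose[OF q_cube \<phi>_meas])
  have \<phi>q_int: "integrable cube_nu (\<lambda>z. \<phi> n (?q t z))" for n t
  proof -
    obtain B where "\<And>w. norm (\<phi> n w) \<le> B" using \<phi>(2)[of n] by (auto simp: bounded_iff)
    then show ?thesis by (intro integrable_const_bound[of _ B] \<phi>q_meas) auto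
  qed
  have cont: "continuous_on UNIV (\<lambda>t. \<integral>z. \<phi> n (?q (- t) z) * g z \<partial>cube_nu)" for n
  proof (rule continuous_at_imp_continuous_on, rule ballI, rule continuous_at_sequentiallyI)
    fix s :: real and X :: "nat \<Rightarrow> real" assume X: "X \<longlonglongrightarrow> s"
    obtain B where B: "\<And>w. norm (\<phi> n w) \<le> B" using \<phi>(2)[of n] by (auto simp: bounded_iff)
    show "(\<lambda>k. \<integral>z. \<phi> n (?q (- X k) z) * g z \<partial>cube_nu) \<longlonglongrightarrow> (\<integral>z. \<phi> n (?q (- s) z) * g z \<partial>cube_nu)"
    proof (rule integral_dominated_convergence[where w = "\<lambda>z. B * norm (g z)"])
      show "(\<lambda>z. \<phi> n (?q (- s) z) * g z) \<in> borel_measurable cube_nu" by (intro borel_measurable_times \<phi>q_meas g_cube)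
      show "(\<lambda>z. \<phi> n (?q (- X k) z) * g z) \<in> borel_measurable cube_nu" for k by (intro borel_measurable_times \<phi>q_meas g_cube)
      show "integrable cube_nu (\<lambda>z. B * norm (g z))"
        using mult_int[of "\<lambda>_. 1"] by (intro integrable_mult_right integrable_norm) simp
      show "AE z in cube_nu. norm (\<phi> n (?q (- X k) z) * g z) \<le> B * norm (g z)" for k
        unfolding norm_mult using B by (intro AE_I2 mult_right_mono) auto
      show "AE z in cube_nu. (\<lambda>k. \<phi> n (?q (- X k) z) * g z) \<longlonglongrightarrow> \<phi> n (?q (- s) z) * g z"
      proof (intro AE_I2 tendsto_mult_right)
        fix z :: "(real ^ 'n) \<times> (real ^ 'n)"
        have "(\<lambda>k. fst z - (- X k) *\<^sub>R snd z) \<longlonglongrightarrow> fst z - (- s) *\<^sub>R snd z" by (intro tendsto_intros X)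
        then have "(\<lambda>k. torus_coords (fst (shear (- X k) z))) \<longlonglongrightarrow> torus_coords (fst (shear (- s) z))"
          unfolding shear_def fst_conv by (intro continuous_on_tendsto_compose[OF continuous_torus_coords[of UNIV]]) auto
        then have "(\<lambda>k. ?q (- X k) z) \<longlonglongrightarrow> ?q (- s) z" by (intro tendsto_Pair tendsto_const)
        then show "(\<lambda>k. \<phi> n (?q (- X k) z)) \<longlonglongrightarrow> \<phi> n (?q (- s) z)"
          by (intro continuous_on_tendsto_compose[OF \<phi>(1)]) auto
      qed
    qed
  qed
  have error: "norm ((\<integral>z. h (shear (- t) z) * g z \<partial>cube_nu) - (\<integral>z. \<phi> n (?q (- t) z) * g z \<partial>cube_nu)) \<le> \<bar>C\<bar> * inverse (real (Suc n))" for n t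
  proof -
    let ?d = "\<lambda>z. h z - \<phi> n (?q 0 z)"
    have d_meas: "?d \<in> borel_measurable \<mu>"
      using h \<phi>q_meas[of n 0] by (intro borel_measurable_diff) (simp_all only: measurable_cong_sets[OF sets_cube_nu refl])
    have per_q: "?q 0 (x + axis i 1, y) = ?q 0 (x, y)" for x i y
    proof -
      have "cis (2 * pi * (x + axis i 1) $ j) = cis (2 * pi * x $ j)" for j
        by (simp add: axis_def distrib_left cis_mult[symmetric] del: cis_mult)
      then show ?thesis by (simp add: torus_coords_def)
    qed
    have d_per: "?d (x + axis i 1, y) = ?d (x, y)" for x i y unfolding per_q per ..
    have ds: "h (shear (- t) z) - \<phi> n (?q (- t) z) = ?d (shear (- t) z)" for z by (simp add: shear_shear)
    have d_int: "integrable cube_nu (\<lambda>z. h (shear (- t) z) - \<phi> n (?q (- t) z))"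
      by (intro Bochner_Integration.integrable_diff hs_int \<phi>q_int)
    have "(\<integral>z. h (shear (- t) z) * g z \<partial>cube_nu) - (\<integral>z. \<phi> n (?q (- t) z) * g z \<partial>cube_nu)
        = (\<integral>z. (h (shear (- t) z) - \<phi> n (?q (- t) z)) * g z \<partial>cube_nu)"
      unfolding left_diff_distrib
      by (rule Bochner_Integration.integral_diff[symmetric]) (intro mult_int hs_int \<phi>q_int)+
    also have "norm \<dots> \<le> (\<integral>z. norm ((h (shear (- t) z) - \<phi> n (?q (- t) z)) * g z) \<partial>cube_nu)"
      by (rule integral_norm_bound)
    also have "\<dots> \<le> (\<integral>z. \<bar>C\<bar> * norm (h (shear (- t) z) - \<phi> n (?q (- t) z)) \<partial>cube_nu)"
    proof (rule integral_mono_AE)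
      show "integrable cube_nu (\<lambda>z. norm ((h (shear (- t) z) - \<phi> n (?q (- t) z)) * g z))"
        by (intro integrable_norm mult_int d_int)
      show "integrable cube_nu (\<lambda>z. \<bar>C\<bar> * norm (h (shear (- t) z) - \<phi> n (?q (- t) z)))"
        by (intro integrable_mult_right integrable_norm d_int)
      show "AE z in cube_nu. norm ((h (shear (- t) z) - \<phi> n (?q (- t) z)) * g z) \<le> \<bar>C\<bar> * norm (h (shear (- t) z) - \<phi> n (?q (- t) z))"
        using C
      proof eventually_elim
        case (elim z)
        then have "norm (g z) \<le> \<bar>C\<bar>" by linarith
        then show ?case unfolding norm_mult by (subst mult.commute) (intro mult_right_mono norm_ge_zero)
      qed
    qed
    also have "\<dots> = \<bar>C\<bar> * (\<integral>z. norm (?d (shear (- t) z)) \<partial>cube_nu)" unfolding ds by (rule integral_mult_right_zero)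
    also have "(\<integral>z. norm (?d (shear (- t) z)) \<partial>cube_nu) = (\<integral>z. norm (?d z) \<partial>cube_nu)"
      by (rule integral_shear(1)[of "\<lambda>z. norm (?d z)"]) (use d_meas d_per in \<open>auto intro: borel_measurable_norm\<close>)
    also have "\<bar>C\<bar> * (\<integral>z. norm (?d z) \<partial>cube_nu) \<le> \<bar>C\<bar> * inverse (real (Suc n))"
      using close[of n] by (intro mult_left_mono) auto
    finally show ?thesis .
  qed
  have "uniform_limit UNIV (\<lambda>n t. \<integral>z. \<phi> n (?q (- t) z) * g z \<partial>cube_nu) (\<lambda>t. \<integral>z. h (shear (- t) z) * g z \<partial>cube_nu) sequentially"
  proof (rule uniform_limitI)
    fix e :: real assume "e > 0"
    have "(\<lambda>n. \<bar>C\<bar> * inverse (real (Suc n))) \<longlonglongrightarrow> \<bar>C\<bar> * 0"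
      by (intro tendsto_mult tendsto_const LIMSEQ_inverse_real_of_nat)
    then have "\<forall>\<^sub>F n in sequentially. \<bar>C\<bar> * inverse (real (Suc n)) < e"
      by (rule order_tendstoD(2)) (use \<open>e > 0\<close> in simp)
    then show "\<forall>\<^sub>F n in sequentially. \<forall>t\<in>UNIV. dist (\<integral>z. \<phi> n (?q (- t) z) * g z \<partial>cube_nu) (\<integral>z. h (shear (- t) z) * g z \<partial>cube_nu) < e"
    proof eventually_elim
      case (elim n)
      show ?case
      proof
        fix t :: real
        show "dist (\<integral>z. \<phi> n (?q (- t) z) * g z \<partial>cube_nu) (\<integral>z. h (shear (- t) z) * g z \<partial>cube_nu) < e"
          using le_less_trans[OF error[of t n] elim] by (subst dist_commute) (simp only: dist_norm)
      qed
    qed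
  qed
  then show ?thesis
    unfolding dual using cont by (intro uniform_limit_theorem[OF always_eventually]) auto
qed

lemma U_weak_star_continuous_group:
  "weak_star_continuous_group (Linfty torus_nu) (U_map :: real \<Rightarrow> ((real ^ 'n) \<times> (real ^ 'n) \<Rightarrow> complex) set \<Rightarrow> _)"
  unfolding weak_star_continuous_group_def
proof (intro conjI allI ballI)
  fix F assume F: "F \<in> carrier (Linfty (torus_nu :: ((real ^ 'n) \<times> (real ^ 'n)) function_domain))"
  show "U_map 0 F = F" using F by (rule U_map_0)
  show "U_map (s + t) F = U_map s (U_map t F)" for s t using F by (rule U_map_add)
  obtain g where g: "g \<in> bounded_functions torus_nu" "F = ae_class torus_nu g" using F by (rule torus_nu.carrier_cases)
  fix \<omega> assume "\<omega> \<in> predual (Linfty (torus_nu :: ((real ^ 'n) \<times> (real ^ 'n)) function_domain))"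
  then obtain h where h: "\<omega> = pairing torus_nu h" "h \<in> borel_measurable \<mu>"
    "\<forall>x i y. h (x + axis i 1, y) = h (x, y)" "set_integrable \<mu> (cbox 0 1 \<times> UNIV) h"
    by (rule torus_nu_predualE)
  show "continuous_on UNIV (\<lambda>t. \<omega> (U_map t F))"
    unfolding h(1) g(2) using h(3) by (intro U_weak_star_continuous[OF g(1) h(2) _ h(4)]) blast
qed

section \<open>The dilation\<close>

text \<open>
  The definition of \<open>poisson\<close> is a union over all representatives; for each of them the integrals agree
  at every point \<open>x\<close>, not only almost everywhere, because the Fourier argument is applied to the
  essentially bounded periodic function \<open>y \<mapsto> f (x - y)\<close>.
\<close>

lemma poisson_eq:
  assumes t: "t \<ge> 0" and F: "F \<in> carrier (Linfty (torus :: (real ^ 'n) function_domain))"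
  shows "poisson t F = nu_expectation (U_map t (J_map F))"
proof (cases "t = 0")
  case True
  obtain f where f: "f \<in> bounded_functions torus" "F = ae_class torus f" using F by (rule torus.carrier_cases)
  have "U_map 0 (J_map F) = J_map F"
    unfolding f(2) J_map_ae_class[OF f(1)] by (intro U_map_0 torus_nu.ae_class_in_carrier bounded_lift_fst f(1))
  with True show ?thesis unfolding f(2) by (simp add: poisson_def nu_expectation_J_map[OF f(1)])
next
  case False
  with t have t: "t > 0" by simp
  have "ae_class torus (\<lambda>x. LINT y:cbox 0 1|lborel. poisson_kernel t y * f (x - y)) = nu_expectation (U_map t (J_map F))"
    if f: "f \<in> F" for f
  proof -
    obtain f0 where f0: "f0 \<in> bounded_functions torus" "F = ae_class torus f0" using F by (rule torus.carrier_cases)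
    with f have fb: "f \<in> bounded_functions torus" and "AE x in meas torus. f0 x = f x" by (simp_all add: ae_rel_def)
    then have Ff: "F = ae_class torus f" unfolding f0(2) by (subst torus.ae_class_eq_iff[OF f0(1) fb])
    obtain C where f_meas [measurable]: "f \<in> borel_measurable borel" and per: "\<And>x i. f (x + axis i 1) = f x"
      and C: "AE x in lborel. norm (f x) \<le> C" using fb unfolding bounded_torus_iff by auto
    have "(LINT y:cbox 0 1|lborel. poisson_kernel t y * f (x - y)) = nu_mean (\<lambda>z. f (fst (shear t z))) x" for x
    proof -
      have "(LINT y|nu_measure. f (x - t *\<^sub>R y)) = (LINT y:cbox 0 1|lborel. poisson_kernel t y * f (x - y))"
      proof (rule poisson_integral_eq[OF t, where g = "\<lambda>y. f (x - y)" and C = C])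
        show "(\<lambda>y. f (x - y)) \<in> borel_measurable borel" by measurable
        show "f (x - (y + axis i 1)) = f (x - y)" for y i
          using per[of "x - (y + axis i 1)" i] by simp
        show "AE y in lborel. norm (f (x - y)) \<le> C"
          using AE_lborel_affine[of "-1" _ x, OF _ C] by simp
      qed
      then show ?thesis by (simp add: nu_mean_def shear_def)
    qed
    then show ?thesis
      unfolding Ff J_map_ae_class[OF fb] U_map_ae_class[OF bounded_lift_fst[OF fb]]
        nu_expectation_ae_class[OF bounded_shear[OF bounded_lift_fst[OF fb]]] by (simp only:)
  qed
  moreover have "F \<noteq> {}"
    using F torus.self_in_ae_class by (elim torus.carrier_cases) blast
  ultimately show ?thesis
    unfolding poisson_def using False by (simp del: Image_singleton_iff)
qed

theorem mainTheorem8: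
  "let M = (torus_algebra :: (real ^ 'n \<Rightarrow> complex) set tracial_algebra);
       N = (N_algebra :: ((real ^ 'n) \<times> (real ^ 'n) \<Rightarrow> complex) set tracial_algebra);
       J = (J_map :: (real ^ 'n \<Rightarrow> complex) set \<Rightarrow> ((real ^ 'n) \<times> (real ^ 'n) \<Rightarrow> complex) set);
       U = (U_map :: real \<Rightarrow> ((real ^ 'n) \<times> (real ^ 'n) \<Rightarrow> complex) set \<Rightarrow>
                       ((real ^ 'n) \<times> (real ^ 'n) \<Rightarrow> complex) set);
       E = (E_map :: ((real ^ 'n) \<times> (real ^ 'n) \<Rightarrow> complex) set \<Rightarrow> (real ^ 'n \<Rightarrow> complex) set)
   in prob_space (nu_measure :: (real ^ 'n) measure) \<and>
      is_E_map E \<and> (\<forall>E'. is_E_map E' \<longrightarrow> E' = E) \<and>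
      unital_star_monomorphism M N J \<and> normal_map M N J \<and> trace_preserving M N J \<and>
      weak_star_continuous_group N U \<and>
      (\<forall>t. star_automorphism N (U t) \<and> trace_preserving N N (U t)) \<and>
      (\<forall>t\<ge>0. \<forall>F\<in>carrier M. poisson t F = E (U t (J F)))"
  unfolding Let_def torus_algebra_def N_algebra_eq E_map_eq
  using prob_space_nu is_E_map_nu_expectation is_E_map_unique[OF is_E_map_nu_expectation]
    J_star_monomorphism J_normal J_trace_preserving U_weak_star_continuous_group
    U_star_automorphism U_trace_preserving poisson_eq
  by blast

end
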